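(* The Sierpinski sickle $K$ admits a local regular Dirichlet form that satisfies the energy self-similar identity.
   Context: **Sierpinski sickle.** Let $p_1=(0,0)$, $p_2=(1,0)$, $p_3=(\frac12,\frac{\sqrt3}2)$, $V_0=\{p_1,p_2,p_3\}$. For integers $i,j\ge0$ put $q(i,j)=\frac17(i\,p_2+j\,p_3)$; for $i+j\le 6$ the "cell $(i,j)$" is the image of the triangle with vertices $V_0$ under $x\mapsto\frac17x+q(i,j)$, so the images of $p_1,p_2,p_3$ are $q(i,j),q(i+1,j),q(i,j+1)$. The IFS $\{F_i\}_{i=1}^{17}$ consists of the $17$ maps $F_i(x)=\frac17x+a_i$ for the following cells: the five left cells $(0,0),\dots,(0,4)$; the three top cells $(0,5),(1,5),(0,6)$; and nine right cells forming a simple chain from $z_0=q(2,5)$ to $z_9=q(7,0)=p_2$: there are points $z_0,\dots,z_9$ such that $z_{k-1}\neq z_k$ are vertices of the $k$-th right cell, consecutive right cells meet only at $z_k$, non-consecutive right cells are disjoint, the chain meets the left and top cells only in $z_0$, and the pair $\{z_{k-1},z_k\}$ is the image of $\{p_1,p_2\}$ for exactly four, of $\{p_2,p_3\}$ for exactly three, and of $\{p_3,p_1\}$ for exactly two of the nine right cells. (For example the right cells $(2,4),(3,3),(3,2),(2,2),(2,1),(3,0),(4,0),(5,0),(6,0)$; one such chain is fixed, and the assertion does not depend on which.) $K$ is the nonempty compact set with $K=\bigcup_{i=1}^{17}F_i(K)$. Put $V_n=\bigcup_iF_i(V_{n-1})$; for a word $\omega=\omega_1\cdots\omega_n$, $|\omega|=n$,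 $F_\omega=F_{\omega_1}\circ\cdots\circ F_{\omega_n}$, $V_\omega=F_\omega(V_0)$. **Dirichlet forms.** A Dirichlet form on $L^2(K,\nu)$ ($\nu$ a Radon measure with support $K$) is a closed, non-negative definite, densely defined symmetric bilinear form $\mathcal E$ with domain $\mathcal F$ having the Markov property; write $\mathcal E[u]=\mathcal E(u,u)$. It is regular if $\mathcal F\cap C(K)$ is dense in $C(K)$ (sup norm) and in $\mathcal F$ (norm $(\mathcal E[u]+\|u\|_2^2)^{1/2}$), and local if $\mathcal E(u,v)=0$ whenever $u,v\in\mathcal F$ have disjoint compact supports. The forms considered on $K$ are on $L^2(K,\nu)$ for a Radon measure $\nu$ of full support and are obtained as follows: one has energies $\mathcal E_n[u]=\sum_{|\omega|=n}\sum_{\{x,y\}\subset V_\omega}c_\omega(x,y)|u(x)-u(y)|^2$ on $V_n$ ($n\ge0$) with positive conductances, compatible in the sense that $\min\{\mathcal E_n[v]:v:V_n\to\mathbb R,\ v|_{V_{n-1}}=u\}=\mathcal E_{n-1}[u]$ for all $n\ge1$ and $u:V_{n-1}\to\mathbb R$; then $\mathcal E[u]=\lim_n\mathcal E_n[u]$ and $\mathcal F=\{u\in C(K):\mathcal E[u]<\infty\}$. *Energy self-similar identity:* there are $0<\tau_i<1$ with $\mathcal E[u]=\sum_{i=1}^{17}\tau_i^{-1}\mathcal E[u\circ F_i]$ for all $u\in\mathcal F$. *)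

theory Defs
  imports "HOL-Analysis.Analysis"
begin

section \<open>The iterated function system\<close>

type_synonym point = "real \<times> real"
type_synonym cell = "nat \<times> nat"

definition p1 :: point where "p1 = (0, 0)"
definition p2 :: point where "p2 = (1, 0)"
definition p3 :: point where "p3 = (1 / 2, sqrt 3 / 2)"

definition V0 :: "point set" where "V0 = {p1, p2, p3}"

definition q :: "nat \<Rightarrow> nat \<Rightarrow> point" where
  "q i j = (1 / 7) *\<^sub>R (real i *\<^sub>R p2 + real j *\<^sub>R p3)"

definition cell_map :: "cell \<Rightarrow> point \<Rightarrow> point" where
  "cell_map s x = (1 / 7) *\<^sub>R x + q (fst s) (snd s)"

definition cell_triangle :: "cell \<Rightarrow> point set" where
  "cell_triangle s = cell_map s ` (convex hull V0)"

definition left_cells :: "cell set" where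
  "left_cells = {(0, 0), (0, 1), (0, 2), (0, 3), (0, 4)}"

definition top_cells :: "cell set" where
  "top_cells = {(0, 5), (1, 5), (0, 6)}"

text \<open>\<open>r k\<close> is the \<open>k\<close>-th right cell (\<open>1 \<le> k \<le> 9\<close>); \<open>z 0, \<dots>, z 9\<close> are the
  points through which the chain passes. Other values of \<open>r\<close> and \<open>z\<close> are irrelevant.\<close>

definition right_chain :: "(nat \<Rightarrow> cell) \<Rightarrow> (nat \<Rightarrow> point) \<Rightarrow> bool" where
  "right_chain r z \<longleftrightarrow>
     (\<forall>k\<in>{1..9}. fst (r k) + snd (r k) \<le> 6) \<and>
     z 0 = q 2 5 \<and> z 9 = q 7 0 \<and>
     (\<forall>k\<in>{1..9}. z (k - 1) \<noteq> z k \<and>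
        z (k - 1) \<in> cell_map (r k) ` V0 \<and> z k \<in> cell_map (r k) ` V0) \<and>
     (\<forall>k\<in>{1..<9}. cell_triangle (r k) \<inter> cell_triangle (r (k + 1)) = {z k}) \<and>
     (\<forall>k\<in>{1..9}. \<forall>l\<in>{1..9}. k + 1 < l \<longrightarrow> cell_triangle (r k) \<inter> cell_triangle (r l) = {}) \<and>
     (\<Union>k\<in>{1..9}. cell_triangle (r k)) \<inter> (\<Union>s\<in>left_cells \<union> top_cells. cell_triangle s) = {z 0} \<and>
     card {k\<in>{1..9}. {z (k - 1), z k} = cell_map (r k) ` {p1, p2}} = 4 \<and>
     card {k\<in>{1..9}. {z (k - 1), z k} = cell_map (r k) ` {p2, p3}} = 3 \<and>
     card {k\<in>{1..9}. {z (k - 1), z k} = cell_map (r k) ` {p3, p1}} = 2"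

text \<open>The maps of the iterated function system are indexed by their cells instead of by
  \<open>1, \<dots>, 17\<close>. The disjointness conditions in \<^const>\<open>right_chain\<close> force the 17 cells to be
  pairwise distinct.\<close>

definition sickle_cells :: "(nat \<Rightarrow> cell) \<Rightarrow> cell set" where
  "sickle_cells r = left_cells \<union> top_cells \<union> r ` {1..9}"

definition is_attractor :: "cell set \<Rightarrow> point set \<Rightarrow> bool" where
  "is_attractor S K \<longleftrightarrow> K \<noteq> {} \<and> compact K \<and> K = (\<Union>s\<in>S. cell_map s ` K)"

definition words :: "cell set \<Rightarrow> nat \<Rightarrow> cell list set" where
  "words S n = {w. length w = n \<and> set w \<subseteq> S}"

definition word_map :: "cell list \<Rightarrow> point \<Rightarrow> point" where
  "word_map w = foldr (\<lambda>s f. cell_map s \<circ> f) w id"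

definition Vword :: "cell list \<Rightarrow> point set" where
  "Vword w = word_map w ` V0"

fun V :: "cell set \<Rightarrow> nat \<Rightarrow> point set" where
  "V S 0 = V0"
| "V S (Suc n) = (\<Union>s\<in>S. cell_map s ` V S n)"

section \<open>Dirichlet forms\<close>

text \<open>Elements of \<open>L\<^sup>2(\<nu>)\<close> are represented by square-integrable functions, and a set of
  elements of \<open>L\<^sup>2(\<nu>)\<close> by a set of functions that is saturated under equality almost
  everywhere. Values outside \<open>space \<nu>\<close> are irrelevant.\<close>

definition L2 :: "'a measure \<Rightarrow> ('a \<Rightarrow> real) set" where
  "L2 \<nu> = {u \<in> borel_measurable \<nu>. integrable \<nu> (\<lambda>x. (u x)\<^sup>2)}"

definition L2_norm :: "'a measure \<Rightarrow> ('a \<Rightarrow> real) \<Rightarrow> real" where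
  "L2_norm \<nu> u = sqrt (\<integral>x. (u x)\<^sup>2 \<partial>\<nu>)"

definition radon_measure_on :: "'a::topological_space set \<Rightarrow> 'a measure \<Rightarrow> bool" where
  "radon_measure_on K \<nu> \<longleftrightarrow>
     space \<nu> = K \<and> sets \<nu> = sets (restrict_space borel K) \<and>
     (\<forall>C. compact C \<and> C \<subseteq> K \<longrightarrow> emeasure \<nu> C < \<infinity>) \<and>
     (\<forall>B\<in>sets \<nu>. emeasure \<nu> B = (SUP C\<in>{C. compact C \<and> C \<subseteq> B}. emeasure \<nu> C))"

definition full_support :: "'a::topological_space measure \<Rightarrow> bool" where
  "full_support \<nu> \<longleftrightarrow>
     (\<forall>U. open U \<and> U \<inter> space \<nu> \<noteq> {} \<longrightarrow> emeasure \<nu> (U \<inter> space \<nu>) > 0)"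

definition form_norm ::
  "'a measure \<Rightarrow> (('a \<Rightarrow> real) \<Rightarrow> ('a \<Rightarrow> real) \<Rightarrow> real) \<Rightarrow> ('a \<Rightarrow> real) \<Rightarrow> real" where
  "form_norm \<nu> E u = sqrt (E u u + (L2_norm \<nu> u)\<^sup>2)"

definition symmetric_form ::
  "'a measure \<Rightarrow> ('a \<Rightarrow> real) set \<Rightarrow> (('a \<Rightarrow> real) \<Rightarrow> ('a \<Rightarrow> real) \<Rightarrow> real) \<Rightarrow> bool" where
  "symmetric_form \<nu> D E \<longleftrightarrow>
     D \<subseteq> L2 \<nu> \<and> D \<noteq> {} \<and>
     (\<forall>u\<in>D. \<forall>v\<in>D. \<forall>a b. (\<lambda>x. a * u x + b * v x) \<in> D) \<and>
     (\<forall>u\<in>D. \<forall>v\<in>L2 \<nu>. (AE x in \<nu>. u x = v x) \<longrightarrow> v \<in> D \<and> (\<forall>w\<in>D. E u w = E v w)) \<and>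
     (\<forall>u\<in>D. \<forall>v\<in>D. E u v = E v u) \<and>
     (\<forall>u\<in>D. \<forall>v\<in>D. \<forall>w\<in>D. \<forall>a b. E (\<lambda>x. a * u x + b * v x) w = a * E u w + b * E v w)"

definition densely_defined :: "'a measure \<Rightarrow> ('a \<Rightarrow> real) set \<Rightarrow> bool" where
  "densely_defined \<nu> D \<longleftrightarrow>
     (\<forall>u\<in>L2 \<nu>. \<forall>e>0. \<exists>v\<in>D. L2_norm \<nu> (\<lambda>x. u x - v x) < e)"

definition closed_form ::
  "'a measure \<Rightarrow> ('a \<Rightarrow> real) set \<Rightarrow> (('a \<Rightarrow> real) \<Rightarrow> ('a \<Rightarrow> real) \<Rightarrow> real) \<Rightarrow> bool" where
  "closed_form \<nu> D E \<longleftrightarrow>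
     (\<forall>f :: nat \<Rightarrow> 'a \<Rightarrow> real.
        (\<forall>n. f n \<in> D) \<and>
        (\<forall>e>0. \<exists>N. \<forall>m\<ge>N. \<forall>n\<ge>N. form_norm \<nu> E (\<lambda>x. f m x - f n x) < e)
        \<longrightarrow> (\<exists>g\<in>D. (\<lambda>n. form_norm \<nu> E (\<lambda>x. f n x - g x)) \<longlonglongrightarrow> 0))"

definition markovian ::
  "('a \<Rightarrow> real) set \<Rightarrow> (('a \<Rightarrow> real) \<Rightarrow> ('a \<Rightarrow> real) \<Rightarrow> real) \<Rightarrow> bool" where
  "markovian D E \<longleftrightarrow>
     (\<forall>u\<in>D. (\<lambda>x. min 1 (max 0 (u x))) \<in> D \<and>
        E (\<lambda>x. min 1 (max 0 (u x))) (\<lambda>x. min 1 (max 0 (u x))) \<le> E u u)"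

definition dirichlet_form ::
  "'a measure \<Rightarrow> ('a \<Rightarrow> real) set \<Rightarrow> (('a \<Rightarrow> real) \<Rightarrow> ('a \<Rightarrow> real) \<Rightarrow> real) \<Rightarrow> bool" where
  "dirichlet_form \<nu> D E \<longleftrightarrow>
     symmetric_form \<nu> D E \<and> (\<forall>u\<in>D. 0 \<le> E u u) \<and>
     densely_defined \<nu> D \<and> closed_form \<nu> D E \<and> markovian D E"

definition regular_form ::
  "'a::topological_space measure \<Rightarrow> ('a \<Rightarrow> real) set \<Rightarrow> (('a \<Rightarrow> real) \<Rightarrow> ('a \<Rightarrow> real) \<Rightarrow> real) \<Rightarrow> bool"
  where
  "regular_form \<nu> D E \<longleftrightarrow>
     (\<forall>u. continuous_on (space \<nu>) u \<longrightarrow>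
        (\<forall>e>0. \<exists>v\<in>D. continuous_on (space \<nu>) v \<and> (\<forall>x\<in>space \<nu>. \<bar>u x - v x\<bar> < e))) \<and>
     (\<forall>u\<in>D. \<forall>e>0. \<exists>v\<in>D. continuous_on (space \<nu>) v \<and> form_norm \<nu> E (\<lambda>x. u x - v x) < e)"

text \<open>The support of the measure \<open>u \<nu>\<close>; for continuous \<open>u\<close> and \<open>\<nu>\<close> of full support this is
  the closure of \<open>{x. u x \<noteq> 0}\<close> in \<open>space \<nu>\<close>.\<close>

definition fun_support :: "'a::topological_space measure \<Rightarrow> ('a \<Rightarrow> real) \<Rightarrow> 'a set" where
  "fun_support \<nu> u =
     {x \<in> space \<nu>. \<forall>U. open U \<and> x \<in> U \<longrightarrow> \<not> (AE y in \<nu>. y \<in> U \<longrightarrow> u y = 0)}"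

definition local_form ::
  "'a::topological_space measure \<Rightarrow> ('a \<Rightarrow> real) set \<Rightarrow> (('a \<Rightarrow> real) \<Rightarrow> ('a \<Rightarrow> real) \<Rightarrow> real) \<Rightarrow> bool"
  where
  "local_form \<nu> D E \<longleftrightarrow>
     (\<forall>u\<in>D. \<forall>v\<in>D. compact (fun_support \<nu> u) \<and> compact (fun_support \<nu> v) \<and>
        fun_support \<nu> u \<inter> fun_support \<nu> v = {} \<longrightarrow> E u v = 0)"

section \<open>Forms obtained from compatible energies\<close>

type_synonym conductance = "cell list \<Rightarrow> point \<Rightarrow> point \<Rightarrow> real"

definition positive_conductance :: "cell set \<Rightarrow> conductance \<Rightarrow> bool" where
  "positive_conductance S c \<longleftrightarrow>
     (\<forall>n. \<forall>w\<in>words S n. \<forall>x\<in>Vword w. \<forall>y\<in>Vword w. x \<noteq> y \<longrightarrow> 0 < c w x y \<and> c w x y = c w y x)"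

text \<open>The factor \<open>1 / 2\<close> turns the sum over ordered pairs into one over unordered pairs.\<close>

definition energy :: "cell set \<Rightarrow> conductance \<Rightarrow> nat \<Rightarrow> (point \<Rightarrow> real) \<Rightarrow> real" where
  "energy S c n u =
     (\<Sum>w\<in>words S n. 1 / 2 * (\<Sum>x\<in>Vword w. \<Sum>y\<in>Vword w. c w x y * \<bar>u x - u y\<bar>\<^sup>2))"

text \<open>The first conjunct under the quantifiers is a lower bound, the second says that it is attained.\<close>

definition compatible_energies :: "cell set \<Rightarrow> conductance \<Rightarrow> bool" where
  "compatible_energies S c \<longleftrightarrow>
     (\<forall>n\<ge>1. \<forall>u.
        (\<forall>v. (\<forall>x\<in>V S (n - 1). v x = u x) \<longrightarrow> energy S c (n - 1) u \<le> energy S c n v) \<and>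
        (\<exists>v. (\<forall>x\<in>V S (n - 1). v x = u x) \<and> energy S c n v = energy S c (n - 1) u))"

text \<open>For compatible conductances \<^term>\<open>\<lambda>n. energy S c n u\<close> is nondecreasing, so convergence
  means that the limit is finite.\<close>

definition finite_energy :: "point set \<Rightarrow> cell set \<Rightarrow> conductance \<Rightarrow> (point \<Rightarrow> real) set" where
  "finite_energy K S c = {u. continuous_on K u \<and> convergent (\<lambda>n. energy S c n u)}"

definition obtained_from_energies ::
  "point set \<Rightarrow> cell set \<Rightarrow> conductance \<Rightarrow> point measure \<Rightarrow>
   (point \<Rightarrow> real) set \<Rightarrow> ((point \<Rightarrow> real) \<Rightarrow> (point \<Rightarrow> real) \<Rightarrow> real) \<Rightarrow> bool" where
  "obtained_from_energies K S c \<nu> D E \<longleftrightarrow>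
     positive_conductance S c \<and> compatible_energies S c \<and>
     D = {f \<in> L2 \<nu>. \<exists>u\<in>finite_energy K S c. AE x in \<nu>. f x = u x} \<and>
     (\<forall>u\<in>finite_energy K S c. E u u = lim (\<lambda>n. energy S c n u))"

text \<open>The identity is stated for the continuous representatives of the elements of the domain,
  as composition with \<^term>\<open>cell_map s\<close> need not respect equality almost everywhere.\<close>

definition self_similar_energy ::
  "point set \<Rightarrow> cell set \<Rightarrow> (point \<Rightarrow> real) set \<Rightarrow>
   ((point \<Rightarrow> real) \<Rightarrow> (point \<Rightarrow> real) \<Rightarrow> real) \<Rightarrow> bool" where
  "self_similar_energy K S D E \<longleftrightarrow>
     (\<exists>\<tau> :: cell \<Rightarrow> real. (\<forall>s\<in>S. 0 < \<tau> s \<and> \<tau> s < 1) \<and>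
        (\<forall>u\<in>D. continuous_on K u \<longrightarrow>
           (\<forall>s\<in>S. u \<circ> cell_map s \<in> D) \<and>
           E u u = (\<Sum>s\<in>S. inverse (\<tau> s) * E (u \<circ> cell_map s) (u \<circ> cell_map s))))"

end

theory Submission
  imports Defs
begin

text \<open>Give every cell \<open>s\<close> a weight \<open>\<tau> s\<close> in \<open>(0, 1)\<close> and let the unit triangle (all three conductances
  1) carry the energy at generation 0. The words then get the products of the \<open>1 / \<tau> s\<close> as
  conductances, and everything rests on one renormalization equation: the network of the 17
  weighted triangles has to have the unit triangle as its trace on the three corners. This can be
  solved by hand. The top of the sickle is a triangle of triangles; each of the two chains hanging
  from it is a series connection, so it only adds a resistance to the branch of one corner. Choose
  \<open>16 / 25\<close> for the top cell and \<open>8 / 25\<close> for its two neighbours: in the equivalent star, the branch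
  of \<open>p3\<close> then has exactly the resistance it must have, while the branches of \<open>p1\<close> and \<open>p2\<close> are
  too small by \<open>11 / 25\<close> of it. The missing amounts are supplied by the chains, spread evenly over
  their 5 and 9 cells. \<open>top_network\<close> is the resulting identity of quadratic forms,
  \<open>sickle_trace_le\<close> and \<open>sickle_trace_attained\<close> are the two halves of the equation.

  The rest works for any solution of such an equation and is carried out in the locale
  \<open>harmonic_structure\<close>. Different cells meet only in corners, so optimal extensions can be glued and
  the equation propagates to all generations (\<open>compatible\<close>). As the weights are below 1, the energy
  inside a cell decreases geometrically with the generation; this bounds the oscillation of a
  function by its energy (\<open>oscillation_exists\<close>). Hence functions on the vertices with bounded energy
  extend continuously to \<open>K\<close>, there are enough of them to approximate every continuous function
  (\<open>finite_energy_dense\<close>), and for any Radon measure of full support the form norm dominates the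
  supremum norm (\<open>sup_bound\<close>), which gives closedness. Regularity, density, the Markov property,
  locality and self-similarity are then inherited from the discrete energies. A suitable measure
  is a series of point masses on the vertices.\<close>

section \<open>Cells in barycentric coordinates\<close>

text \<open>The coordinates with \<open>x = cx x *\<^sub>R p2 + cy x *\<^sub>R p3\<close>. In them the lattice points have coordinates
  \<open>i / 7\<close> and the irrational height of the triangle disappears.\<close>

definition cx :: "point \<Rightarrow> real" where "cx p = fst p - snd p / sqrt 3"
definition cy :: "point \<Rightarrow> real" where "cy p = 2 * snd p / sqrt 3"

definition triangle :: "point set" where
  "triangle = {p. 0 \<le> cx p \<and> 0 \<le> cy p \<and> cx p + cy p \<le> 1}"

lemma coords_eq_iff: "p = p' \<longleftrightarrow> cx p = cx p' \<and> cy p = cy p'"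
  by (auto simp: cx_def cy_def prod_eq_iff)

lemma coords_corner [simp]:
  "cx p1 = 0" "cy p1 = 0" "cx p2 = 1" "cy p2 = 0" "cx p3 = 0" "cy p3 = 1"
  by (simp_all add: cx_def cy_def p1_def p2_def p3_def)

lemma coords_q [simp]: "cx (q i j) = real i / 7" "cy (q i j) = real j / 7"
  by (simp_all add: cx_def cy_def q_def p2_def p3_def field_simps)

lemma coords_cell_map [simp]:
  "cx (cell_map s x) = (cx x + real (fst s)) / 7" "cy (cell_map s x) = (cy x + real (snd s)) / 7"
  by (simp_all add: cx_def cy_def q_def p2_def p3_def cell_map_def field_simps)

lemma corners_distinct [simp]:
  "p1 \<noteq> p2" "p2 \<noteq> p1" "p2 \<noteq> p3" "p3 \<noteq> p2" "p1 \<noteq> p3" "p3 \<noteq> p1"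
  by (simp_all add: coords_eq_iff)

lemma cell_map_eq_iff [simp]: "cell_map s x = cell_map s y \<longleftrightarrow> x = y"
  by (simp add: cell_map_def)

lemma dist_cell_map: "dist (cell_map s x) (cell_map s y) = dist x y / 7"
  by (simp add: cell_map_def dist_norm flip: scaleR_diff_right)

lemma continuous_cell_map: "continuous_on A (cell_map s)"
  unfolding cell_map_def by (intro continuous_intros)

lemma closed_triangle: "closed triangle"
proof -
  have "triangle = {p. 0 \<le> fst p - snd p / sqrt 3} \<inter> {p. 0 \<le> 2 * snd p / sqrt 3}
      \<inter> {p. fst p - snd p / sqrt 3 + 2 * snd p / sqrt 3 \<le> 1}"
    by (auto simp: triangle_def cx_def cy_def)
  also have "closed \<dots>"
    by (intro closed_Int closed_Collect_le continuous_intros) simp_all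
  finally show ?thesis .
qed

lemma V0_triangle: "V0 \<subseteq> triangle"
  by (auto simp: V0_def triangle_def)

lemma cell_map_triangle:
  assumes "fst s + snd s \<le> 6" "x \<in> triangle"
  shows "cell_map s x \<in> triangle"
proof -
  have "real (fst s) + real (snd s) \<le> 6" using assms(1) by linarith
  thus ?thesis using assms(2) by (auto simp: triangle_def field_simps)
qed

text \<open>Upward lattice triangles overlap only in lattice points: if \<open>s'\<close> lies further to the right
  (or higher) than \<open>s\<close>, a common point has to be the right (or upper) corner of \<open>s\<close>.\<close>

lemma cells_meet_in_corner:
  assumes "x \<in> triangle" "x' \<in> triangle" "cell_map s x = cell_map s' x'" "s \<noteq> s'"
  shows "x \<in> V0"
proof -
  obtain i j i' j' where s: "s = (i, j)" "s' = (i', j')" by fastforce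
  have x: "0 \<le> cx x" "0 \<le> cy x" "cx x + cy x \<le> 1" "0 \<le> cx x'" "0 \<le> cy x'" "cx x' + cy x' \<le> 1"
    using assms by (auto simp: triangle_def)
  have e: "cx x + i = cx x' + i'" "cy x + j = cy x' + j'"
    using assms(3) s by (auto simp: coords_eq_iff)
  have "(i' \<ge> i + 1 \<or> i \<ge> i' + 1) \<or> i = i' \<and> (j' \<ge> j + 1 \<or> j \<ge> j' + 1)"
    using assms(4) s by auto
  hence "cx x = 1 \<and> cy x = 0 \<or> cx x = 0 \<and> cy x = 1 \<or> cx x = 0 \<and> cy x = 0"
  proof (elim disjE conjE)
    assume "i' \<ge> i + 1"
    hence "real i' \<ge> real i + 1" by linarith
    thus ?thesis using x e by linarith
  next
    assume i: "i \<ge> i' + 1"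
    hence r: "real i \<ge> real i' + 1" by linarith
    hence "cx x' = 1" "cx x = 0" "cy x' = 0" "real i = real i' + 1" using x e by linarith+
    hence "cy x = real j' - real j" using e by linarith
    moreover have "j' = j \<or> j' = j + 1 \<or> real j' - real j < 0 \<or> real j' - real j > 1" by linarith
    ultimately show ?thesis using x \<open>cx x = 0\<close> by (auto; linarith)
  next
    assume "i = i'" "j' \<ge> j + 1"
    hence "real j' \<ge> real j + 1" by linarith
    thus ?thesis using x e by linarith
  next
    assume "i = i'" "j \<ge> j' + 1"
    hence "real j \<ge> real j' + 1" "cx x = cx x'" using e by auto
    hence "cy x = 0 \<and> cy x' = 1" using x e by linarith
    thus ?thesis using x \<open>cx x = cx x'\<close> by auto
  qed
  thus ?thesis by (auto simp: V0_def coords_eq_iff)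
qed

text \<open>The corners are extreme points of the triangle, so only a corner of a cell can hit one.\<close>

lemma corner_in_cell:
  assumes "fst s + snd s \<le> 6" "x \<in> triangle" "cell_map s x \<in> V0"
  shows "x \<in> V0 \<and> cell_map s x = x"
proof -
  have r: "real (fst s) + real (snd s) \<le> 6" using assms(1) by linarith
  have x: "0 \<le> cx x" "0 \<le> cy x" "cx x + cy x \<le> 1" using assms(2) by (auto simp: triangle_def)
  have n: "0 \<le> real (fst s)" "0 \<le> real (snd s)" by auto
  from assms(3) consider "cell_map s x = p1" | "cell_map s x = p2" | "cell_map s x = p3"
    by (auto simp: V0_def)
  thus ?thesis
  proof cases
    case 1
    hence "cx x + fst s = 0" "cy x + snd s = 0" by (auto simp: coords_eq_iff)
    hence "cx x = 0" "cy x = 0" using x n by linarith+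
    hence "x = p1" by (simp add: coords_eq_iff)
    thus ?thesis using 1 by (simp add: V0_def)
  next
    case 2
    hence "cx x + fst s = 7" "cy x + snd s = 0" by (auto simp: coords_eq_iff)
    hence "cx x = 1" "cy x = 0" using x n r by linarith+
    hence "x = p2" by (simp add: coords_eq_iff)
    thus ?thesis using 2 by (simp add: V0_def)
  next
    case 3
    hence "cx x + fst s = 0" "cy x + snd s = 7" by (auto simp: coords_eq_iff)
    hence "cx x = 0" "cy x = 1" using x n r by linarith+
    hence "x = p3" by (simp add: coords_eq_iff)
    thus ?thesis using 3 by (simp add: V0_def)
  qed
qed

section \<open>Words\<close>

lemma word_map_simps [simp]:
  "word_map [] = id" "word_map (s # w) = cell_map s \<circ> word_map w"
  by (simp_all add: word_map_def)

lemma word_map_eq_iff [simp]: "word_map w x = word_map w y \<longleftrightarrow> x = y"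
  by (induction w) auto

lemma dist_word_map: "dist (word_map w x) (word_map w y) = dist x y / 7 ^ length w"
  by (induction w) (auto simp: dist_cell_map)

lemma continuous_word_map: "continuous_on A (word_map w)"
proof (induction w)
  case (Cons s w)
  show ?case using continuous_on_compose[OF Cons.IH continuous_cell_map] by simp
qed (simp add: id_def)

lemma Vword_simps: "Vword [] = V0" "Vword (s # w) = cell_map s ` Vword w"
  by (auto simp: Vword_def)

lemma words_0 [simp]: "words S 0 = {[]}"
  by (auto simp: words_def)

lemma words_Suc: "words S (Suc n) = (\<lambda>(s, w). s # w) ` (S \<times> words S n)"
  by (auto simp: words_def length_Suc_conv image_iff)

lemma finite_words: "finite S \<Longrightarrow> finite (words S n)"
  by (induction n) (auto simp: words_Suc)

lemma finite_V0 [simp]: "finite V0"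
  by (simp add: V0_def)

lemma finite_Vword [simp]: "finite (Vword w)"
  by (simp add: Vword_def)

lemma Vword_subset_V: "w \<in> words S n \<Longrightarrow> Vword w \<subseteq> V S n"
proof (induction n arbitrary: w)
  case 0 thus ?case by (simp add: Vword_simps)
next
  case (Suc n)
  thus ?case by (force simp: words_Suc Vword_simps)
qed

lemma V_eq_words: "V S (n + k) = (\<Union>w\<in>words S n. word_map w ` V S k)"
proof (induction n)
  case (Suc n)
  show ?case
  proof (intro set_eqI iffI)
    fix p assume "p \<in> V S (Suc n + k)"
    then obtain s y where s: "s \<in> S" "y \<in> V S (n + k)" "p = cell_map s y" by auto
    then obtain w x where w: "w \<in> words S n" "x \<in> V S k" "y = word_map w x"
      unfolding Suc.IH by blast
    have "s # w \<in> words S (Suc n)" "p = word_map (s # w) x" using s w by (auto simp: words_def)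
    thus "p \<in> (\<Union>w\<in>words S (Suc n). word_map w ` V S k)" using w(2) by blast
  next
    fix p assume "p \<in> (\<Union>w\<in>words S (Suc n). word_map w ` V S k)"
    then obtain s w x where w: "s \<in> S" "w \<in> words S n" "x \<in> V S k" "p = word_map (s # w) x"
      by (auto simp: words_Suc simp del: word_map_simps)
    hence "word_map w x \<in> V S (n + k)" unfolding Suc.IH by blast
    thus "p \<in> V S (Suc n + k)" using w by auto
  qed
qed simp

lemma word_map_triangle:
  "\<lbrakk>\<forall>s\<in>set w. fst s + snd s \<le> 6; x \<in> triangle\<rbrakk> \<Longrightarrow> word_map w x \<in> triangle"
  by (induction w) (auto intro: cell_map_triangle)

text \<open>The same for words: peel off letters, each of which fixes the corner that is hit.\<close>

lemma corner_in_word: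
  assumes "\<forall>s\<in>set w. fst s + snd s \<le> 6" "x \<in> triangle" "word_map w x \<in> V0"
  shows "word_map w x \<in> Vword w"
  using assms
proof (induction w)
  case Nil thus ?case by (simp add: Vword_simps)
next
  case (Cons s w)
  have "word_map w x \<in> triangle" using Cons.prems by (auto intro: word_map_triangle)
  hence "word_map w x \<in> V0" using corner_in_cell[of s] Cons.prems by auto
  thus ?case using Cons by (auto simp: Vword_simps)
qed

text \<open>Two small cells of the same generation that touch share a vertex: at the first letter in
  which the words differ, the common point is a corner of both cells of that generation, and a
  corner stays a vertex of every smaller cell that contains it.\<close>

lemma touching_words_share_vertex:
  assumes "\<forall>s\<in>set w \<union> set w'. fst s + snd s \<le> 6" "length w = length w'"
    and "x \<in> triangle" "x' \<in> triangle" "word_map w x = word_map w' x'"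
  shows "Vword w \<inter> Vword w' \<noteq> {}"
  using assms
proof (induction w arbitrary: w')
  case Nil thus ?case by (auto simp: Vword_simps V0_def)
next
  case (Cons s w)
  then obtain s' v where w': "w' = s' # v" "length w = length v" by (cases w') auto
  show ?case
  proof (cases "s = s'")
    case True
    thus ?thesis using Cons w' Cons.IH[of v] by (auto simp: Vword_simps)
  next
    case False
    let ?y = "word_map w x" and ?y' = "word_map v x'"
    have t: "?y \<in> triangle" "?y' \<in> triangle" using Cons.prems w' by (auto intro: word_map_triangle)
    have e: "cell_map s ?y = cell_map s' ?y'" using Cons.prems w' by simp
    have "?y \<in> V0" "?y' \<in> V0"
      using cells_meet_in_corner[OF t e False] cells_meet_in_corner[OF t(2) t(1) e[symmetric]] False
      by auto
    hence "?y \<in> Vword w" "?y' \<in> Vword v" using Cons.prems w' by (auto intro!: corner_in_word)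
    thus ?thesis using e w' by (auto simp: Vword_simps)
  qed
qed

section \<open>Renormalizable weights and their energies\<close>

definition tri_energy :: "(point \<Rightarrow> real) \<Rightarrow> real" where
  "tri_energy f = (f p1 - f p2)\<^sup>2 + (f p2 - f p3)\<^sup>2 + (f p3 - f p1)\<^sup>2"

text \<open>The energy of the weighted triangles of generation one.\<close>

definition level_one_energy :: "cell set \<Rightarrow> (cell \<Rightarrow> real) \<Rightarrow> (point \<Rightarrow> real) \<Rightarrow> real" where
  "level_one_energy S \<tau> v = (\<Sum>s\<in>S. inverse (\<tau> s) * tri_energy (v \<circ> cell_map s))"

definition product_conductance :: "(cell \<Rightarrow> real) \<Rightarrow> conductance" where
  "product_conductance \<tau> w x y = prod_list (map (\<lambda>s. inverse (\<tau> s)) w)"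

text \<open>The polarization of \<^const>\<open>energy\<close>.\<close>

definition energy_form ::
  "cell set \<Rightarrow> conductance \<Rightarrow> nat \<Rightarrow> (point \<Rightarrow> real) \<Rightarrow> (point \<Rightarrow> real) \<Rightarrow> real" where
  "energy_form S c n u v =
     (\<Sum>w\<in>words S n. 1 / 2 * (\<Sum>x\<in>Vword w. \<Sum>y\<in>Vword w. c w x y * ((u x - u y) * (v x - v y))))"

lemma energy_form_diag: "energy_form S c n u u = energy S c n u"
  by (simp add: energy_form_def energy_def power2_eq_square)

lemma energy_form_sym: "energy_form S c n u v = energy_form S c n v u"
  by (simp add: energy_form_def mult.commute)

lemma energy_form_linear:
  "energy_form S c n (\<lambda>x. a * u x + b * v x) g = a * energy_form S c n u g + b * energy_form S c n v g"
proof -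
  have "c w x y * (((a * u x + b * v x) - (a * u y + b * v y)) * (g x - g y)) =
      a * (c w x y * ((u x - u y) * (g x - g y))) + b * (c w x y * ((v x - v y) * (g x - g y)))"
    for w x y by (simp add: algebra_simps)
  thus ?thesis
    by (simp only: energy_form_def sum.distrib distrib_left sum_distrib_left[symmetric] mult.left_commute[of "1 / 2"])
qed

lemma energy_form_cong:
  assumes "\<And>x. x \<in> V S n \<Longrightarrow> u x = u' x" "\<And>x. x \<in> V S n \<Longrightarrow> v x = v' x"
  shows "energy_form S c n u v = energy_form S c n u' v'"
proof -
  have "u x = u' x \<and> v x = v' x" if "w \<in> words S n" "x \<in> Vword w" for w x
    using assms(1)[of x] assms(2)[of x] subsetD[OF Vword_subset_V[OF that(1)] that(2)] by blast
  thus ?thesis by (simp add: energy_form_def)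
qed

lemma energy_cong:
  assumes "\<And>x. x \<in> V S n \<Longrightarrow> u x = u' x"
  shows "energy S c n u = energy S c n u'"
  using energy_form_cong[of S n u u' u u' c] assms by (simp add: energy_form_diag)

lemma energy_linear:
  "energy S c n (\<lambda>x. a * u x + b * v x) =
     a\<^sup>2 * energy S c n u + 2 * a * b * energy_form S c n u v + b\<^sup>2 * energy S c n v"
proof -
  let ?g = "\<lambda>x. a * u x + b * v x"
  have "energy S c n ?g = a * energy_form S c n u ?g + b * energy_form S c n v ?g"
    by (simp only: energy_form_diag[symmetric] energy_form_linear)
  also have "energy_form S c n u ?g = a * energy S c n u + b * energy_form S c n u v"
    by (simp only: energy_form_sym[of S c n u ?g] energy_form_linear energy_form_diag
        energy_form_sym[of S c n v u])
  also have "energy_form S c n v ?g = a * energy_form S c n u v + b * energy S c n v"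
    by (simp only: energy_form_sym[of S c n v ?g] energy_form_linear energy_form_diag)
  finally show ?thesis by (simp add: power2_eq_square algebra_simps)
qed

lemma energy_0: "energy S (product_conductance \<tau>) 0 u = tri_energy u"
  by (simp add: energy_def Vword_simps V0_def product_conductance_def tri_energy_def
        power2_eq_square algebra_simps)

text \<open>The self-similar identity for the discrete energies: split off the first letter of each word.\<close>

lemma energy_Suc:
  "energy S (product_conductance \<tau>) (Suc n) u =
     (\<Sum>s\<in>S. inverse (\<tau> s) * energy S (product_conductance \<tau>) n (u \<circ> cell_map s))"
proof -
  have split: "(\<Sum>w\<in>words S (Suc n). G w) = (\<Sum>s\<in>S. \<Sum>w\<in>words S n. G (s # w))"
    for G :: "cell list \<Rightarrow> real"
    unfolding words_Suc by (subst sum.reindex) (auto simp: inj_on_def sum.cartesian_product split_beta)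
  have cell: "1 / 2 * (\<Sum>x\<in>Vword (s # w). \<Sum>y\<in>Vword (s # w).
        product_conductance \<tau> (s # w) x y * \<bar>u x - u y\<bar>\<^sup>2) =
      inverse (\<tau> s) * (1 / 2 * (\<Sum>x\<in>Vword w. \<Sum>y\<in>Vword w.
        product_conductance \<tau> w x y * \<bar>(u \<circ> cell_map s) x - (u \<circ> cell_map s) y\<bar>\<^sup>2))" for s w
    by (simp add: Vword_simps sum.reindex inj_on_def product_conductance_def mult.assoc
          flip: sum_distrib_left)
  show ?thesis
    unfolding energy_def split cell by (simp only: sum_distrib_left)
qed

text \<open>The assumptions \<open>trace_le\<close> and \<open>trace_attained\<close> say that the network of generation one has the
  unit triangle as its trace on the corners. The assumption \<open>connected\<close> is the quantitative form of
  its connectedness: each potential difference is controlled by the energy. The three corner cells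
  make the corners fixed points, so that the vertex sets increase.\<close>

locale harmonic_structure =
  fixes S :: "cell set" and K :: "point set" and \<tau> :: "cell \<Rightarrow> real"
  assumes finite_cells: "finite S"
    and cell_in_triangle: "s \<in> S \<Longrightarrow> fst s + snd s \<le> 6"
    and corner_cells: "(0, 0) \<in> S" "(6, 0) \<in> S" "(0, 6) \<in> S"
    and attractor: "is_attractor S K"
    and weight: "s \<in> S \<Longrightarrow> 0 < \<tau> s" "s \<in> S \<Longrightarrow> \<tau> s < 1"
    and trace_le: "tri_energy v \<le> level_one_energy S \<tau> v"
    and trace_attained: "\<exists>v. (\<forall>x\<in>V0. v x = u x) \<and> level_one_energy S \<tau> v = tri_energy u"
    and connected: "\<exists>B\<ge>0. \<forall>v. \<forall>s\<in>S.
      \<bar>v (cell_map s p1) - v p1\<bar> \<le> B * sqrt (level_one_energy S \<tau> v)"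
begin

abbreviation En :: "nat \<Rightarrow> (point \<Rightarrow> real) \<Rightarrow> real" where
  "En \<equiv> energy S (product_conductance \<tau>)"

lemma level_one: "En (Suc 0) u = level_one_energy S \<tau> u"
  by (simp add: energy_Suc energy_0 level_one_energy_def)

lemma word_in_triangle: "w \<in> words S n \<Longrightarrow> \<forall>s\<in>set w. fst s + snd s \<le> 6"
  using cell_in_triangle by (auto simp: words_def)

lemma corner_fixed: "a \<in> V0 \<Longrightarrow> \<exists>s\<in>S. cell_map s a = a"
  using corner_cells by (auto simp: V0_def coords_eq_iff intro: bexI[of _ "(0,0)"]
      bexI[of _ "(6,0)"] bexI[of _ "(0,6)"])

lemma V_mono_Suc: "V S n \<subseteq> V S (Suc n)"
proof (induction n)
  case 0
  show ?case using corner_fixed by force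
next
  case (Suc n)
  thus ?case unfolding V.simps(2) by (intro UN_mono image_mono subset_refl)
qed

lemma V_mono: "n \<le> m \<Longrightarrow> V S n \<subseteq> V S m"
  by (rule lift_Suc_mono_le[of "V S"]) (use V_mono_Suc in auto)

lemma V0_subset_V: "V0 \<subseteq> V S n"
  using V_mono[of 0 n] by simp

lemma p1_in_V: "p1 \<in> V S n"
  using V0_subset_V by (auto simp: V0_def)

lemma finite_V: "finite (V S n)"
  by (induction n) (auto simp: finite_cells)

lemma V_subset_triangle: "V S n \<subseteq> triangle"
proof (induction n)
  case 0 show ?case by (simp add: V0_triangle)
next
  case (Suc n) thus ?case using cell_map_triangle cell_in_triangle by fastforce
qed

lemma positive_product_conductance: "positive_conductance S (product_conductance \<tau>)"
proof -
  have "0 < prod_list (map (\<lambda>s. inverse (\<tau> s)) w)" if "set w \<subseteq> S" for w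
    using that by (induction w) (auto simp: weight)
  thus ?thesis by (auto simp: positive_conductance_def product_conductance_def words_def)
qed

lemma energy_nonneg: "0 \<le> En n u"
proof (induction n arbitrary: u)
  case 0 show ?case by (simp add: energy_0 tri_energy_def)
next
  case (Suc n)
  show ?case unfolding energy_Suc using weight(1)
    by (intro sum_nonneg mult_nonneg_nonneg Suc) (simp add: less_imp_le)
qed

text \<open>A normal contraction of \<open>u\<close> decreases every summand.\<close>

lemma energy_contraction:
  assumes "\<And>x y. \<bar>v x - v y\<bar> \<le> \<bar>u x - u y\<bar>"
  shows "En n v \<le> En n u"
proof -
  have pos: "0 \<le> prod_list (map (\<lambda>s. inverse (\<tau> s)) w)" if "set w \<subseteq> S" for w
    using that
  proof (induction w)
    case (Cons s w)
    thus ?case using weight(1)[of s] by simp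
  qed simp
  have "\<bar>v x - v y\<bar>\<^sup>2 \<le> \<bar>u x - u y\<bar>\<^sup>2" for x y
    using assms[of x y] by (intro power_mono) auto
  thus ?thesis
    unfolding energy_def product_conductance_def
    by (intro sum_mono mult_left_mono) (auto simp: words_def intro: pos)
qed

text \<open>The bound holds inside each cell by the previous generation, and the energies of the cells add
  up with the same weights on both sides.\<close>

lemma energy_le_extension:
  "(\<And>x. x \<in> V S n \<Longrightarrow> v x = u x) \<Longrightarrow> En n u \<le> En (Suc n) v"
proof (induction n arbitrary: u v)
  case 0
  hence "tri_energy u = tri_energy v" by (simp add: tri_energy_def V0_def)
  thus ?case using trace_le by (simp add: energy_0 level_one)
next
  case (Suc n)
  have "En n (u \<circ> cell_map s) \<le> En (Suc n) (v \<circ> cell_map s)" if "s \<in> S" for s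
  proof (rule Suc.IH)
    fix x assume "x \<in> V S n"
    hence "cell_map s x \<in> V S (Suc n)" using that by auto
    thus "(v \<circ> cell_map s) x = (u \<circ> cell_map s) x" using Suc.prems by simp
  qed
  thus ?case unfolding energy_Suc[of S \<tau> n u] energy_Suc[of S \<tau> "Suc n" v]
    by (intro sum_mono mult_left_mono) (simp_all add: weight(1) less_imp_le)
qed

lemma energy_mono: "n \<le> m \<Longrightarrow> En n u \<le> En m u"
  by (rule lift_Suc_mono_le[of "\<lambda>n. En n u"]) (use energy_le_extension in auto)

text \<open>Distinct cells meet only where both have a corner, and there both pieces agree with \<open>f\<close>.\<close>

lemma glue:
  assumes "A \<subseteq> triangle" and "\<And>s x. s \<in> S \<Longrightarrow> x \<in> V0 \<Longrightarrow> g s x = f (cell_map s x)"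
  shows "\<exists>v. \<forall>s\<in>S. \<forall>x\<in>A. v (cell_map s x) = (g s x :: real)"
proof -
  have eq: "g s x = g s' x'"
    if "s \<in> S" "s' \<in> S" "x \<in> A" "x' \<in> A" "cell_map s x = cell_map s' x'" for s s' x x'
  proof (cases "s = s'")
    case False
    have "x \<in> triangle" "x' \<in> triangle" using that assms(1) by blast+
    hence "x \<in> V0" "x' \<in> V0"
      using cells_meet_in_corner[of x x' s s'] cells_meet_in_corner[of x' x s' s] that False
      by simp_all
    thus ?thesis using assms(2) that by simp
  qed (use that in simp)
  define e where "e p = (SOME z. fst z \<in> S \<and> snd z \<in> A \<and> cell_map (fst z) (snd z) = p)" for p
  have "g (fst (e (cell_map s x))) (snd (e (cell_map s x))) = g s x" if "s \<in> S" "x \<in> A" for s x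
  proof -
    have "\<exists>z. fst z \<in> S \<and> snd z \<in> A \<and> cell_map (fst z) (snd z) = cell_map s x"
      using that by (intro exI[of _ "(s, x)"]) simp
    from someI_ex[OF this] show ?thesis
      unfolding e_def[symmetric] by (intro eq) (use that in simp_all)
  qed
  hence "\<forall>s\<in>S. \<forall>x\<in>A. (\<lambda>p. g (fst (e p)) (snd (e p))) (cell_map s x) = g s x" by blast
  thus ?thesis by (rule exI[where x = "\<lambda>p. g (fst (e p)) (snd (e p))"])
qed

text \<open>The optimal extensions of \<open>u \<circ> cell_map s\<close> keep the values of \<open>u\<close> at the corners, so they can be
  glued to an optimal extension of \<open>u\<close>.\<close>

lemma optimal_extension: "\<exists>v. (\<forall>x\<in>V S n. v x = u x) \<and> En (Suc n) v = En n u"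
proof (induction n arbitrary: u)
  case 0
  show ?case using trace_attained[of u] by (simp add: level_one energy_0)
next
  case (Suc n)
  have "\<forall>s. \<exists>v. (\<forall>x\<in>V S n. v x = u (cell_map s x)) \<and> En (Suc n) v = En n (u \<circ> cell_map s)"
    using Suc.IH[of "u \<circ> cell_map _"] unfolding comp_def by blast
  then obtain g where g: "\<And>s x. x \<in> V S n \<Longrightarrow> g s x = u (cell_map s x)"
    "\<And>s. En (Suc n) (g s) = En n (u \<circ> cell_map s)" by metis
  obtain v where v: "\<And>s x. s \<in> S \<Longrightarrow> x \<in> V S (Suc n) \<Longrightarrow> v (cell_map s x) = g s x"
    using glue[of "V S (Suc n)" g u] V_subset_triangle g(1) V0_subset_V by blast
  have "v p = u p" if p: "p \<in> V S (Suc n)" for p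
  proof -
    obtain s x where sx: "s \<in> S" "x \<in> V S n" "p = cell_map s x" using p by auto
    hence "x \<in> V S (Suc n)" using V_mono_Suc by blast
    thus ?thesis using sx v g(1) by simp
  qed
  moreover have "En (Suc (Suc n)) v = En (Suc n) u"
  proof -
    have "En (Suc n) (v \<circ> cell_map s) = En n (u \<circ> cell_map s)" if "s \<in> S" for s
    proof -
      have "En (Suc n) (v \<circ> cell_map s) = En (Suc n) (g s)"
        using v that by (intro energy_cong) (simp only: comp_def)
      thus ?thesis by (simp only: g)
    qed
    thus ?thesis
      unfolding energy_Suc[of S \<tau> "Suc n" v] energy_Suc[of S \<tau> n u]
      by (intro sum.cong refl) simp
  qed
  ultimately show ?case by blast
qed

lemma compatible: "compatible_energies S (product_conductance \<tau>)"
  unfolding compatible_energies_def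
proof (intro allI impI conjI)
  fix n :: nat and u v :: "point \<Rightarrow> real" assume n: "1 \<le> n"
  assume "\<forall>x\<in>V S (n - 1). v x = u x"
  thus "En (n - 1) u \<le> En n v" using energy_le_extension[of "n - 1" v u] n by simp
next
  fix n :: nat and u :: "point \<Rightarrow> real" assume n: "1 \<le> n"
  thus "\<exists>v. (\<forall>x\<in>V S (n - 1). v x = u x) \<and> En n v = En (n - 1) u"
    using optimal_extension[of "n - 1" u] by simp
qed

subsection \<open>Energy controls oscillation\<close>

text \<open>Entering a cell multiplies the energy by at most the largest weight, hence the oscillation by
  its square root.\<close>

definition contraction :: real where
  "contraction = sqrt (Max (\<tau> ` S))"

lemma contraction_bounds: "0 < contraction" "contraction < 1"
proof -
  have ne: "finite (\<tau> ` S)" "\<tau> ` S \<noteq> {}" using finite_cells corner_cells by auto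
  hence "Max (\<tau> ` S) \<in> \<tau> ` S" by (rule Max_in)
  thus "0 < contraction" "contraction < 1" using weight unfolding contraction_def by auto
qed

lemma weight_le: "s \<in> S \<Longrightarrow> \<tau> s \<le> contraction\<^sup>2"
proof -
  assume s: "s \<in> S"
  have m: "\<tau> s \<le> Max (\<tau> ` S)" using finite_cells s by auto
  moreover have "0 < \<tau> s" using s by (rule weight)
  ultimately have "0 \<le> Max (\<tau> ` S)" by linarith
  thus ?thesis using m by (simp add: contraction_def)
qed

lemma energy_cell_le:
  assumes "s \<in> S"
  shows "En n (u \<circ> cell_map s) \<le> contraction\<^sup>2 * En (Suc n) u"
proof -
  have "inverse (\<tau> s) * En n (u \<circ> cell_map s) \<le> En (Suc n) u"
    unfolding energy_Suc using assms finite_cells weight(1) energy_nonneg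
    by (intro member_le_sum) (auto simp: less_imp_le)
  hence "En n (u \<circ> cell_map s) \<le> \<tau> s * En (Suc n) u"
    using weight(1)[OF assms] by (simp add: field_simps)
  also have "\<dots> \<le> contraction\<^sup>2 * En (Suc n) u"
    using weight_le[OF assms] energy_nonneg by (intro mult_right_mono)
  finally show ?thesis .
qed

lemma energy_word_le:
  "w \<in> words S m \<Longrightarrow> En n (u \<circ> word_map w) \<le> (contraction ^ m)\<^sup>2 * En (m + n) u"
proof (induction m arbitrary: w u)
  case 0 thus ?case by simp
next
  case (Suc m)
  then obtain s v where w: "w = s # v" "s \<in> S" "v \<in> words S m" by (auto simp: words_Suc)
  have "En n (u \<circ> word_map w) = En n ((u \<circ> cell_map s) \<circ> word_map v)" by (simp add: w comp_assoc)
  also have "\<dots> \<le> (contraction ^ m)\<^sup>2 * En (m + n) (u \<circ> cell_map s)" using w by (intro Suc.IH)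
  also have "\<dots> \<le> (contraction ^ m)\<^sup>2 * (contraction\<^sup>2 * En (Suc (m + n)) u)"
    using w by (intro mult_left_mono energy_cell_le) auto
  also have "\<dots> = (contraction ^ Suc m)\<^sup>2 * En (Suc m + n) u" by (simp add: power_mult_distrib)
  finally show ?case .
qed

text \<open>Walk from \<open>p1\<close> to the first corner of the generation-one cell of \<open>x\<close>, then recurse inside this
  cell: the energy there is smaller by the factor \<open>contraction\<^sup>2\<close>, so the bounds sum up to a
  geometric series.\<close>

lemma oscillation_exists:
  "\<exists>A\<ge>0. \<forall>n u. \<forall>x\<in>V S n. \<bar>u x - u p1\<bar> \<le> A * sqrt (En n u)"
proof -
  obtain B where B: "0 \<le> B"
    "\<And>v s. s \<in> S \<Longrightarrow> \<bar>v (cell_map s p1) - v p1\<bar> \<le> B * sqrt (level_one_energy S \<tau> v)"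
    using connected by blast
  \<comment> \<open>The fixed point of \<open>A = A * contraction + (B + 1)\<close>, which closes the induction; the \<open>+ 1\<close>
    makes \<open>1 \<le> A\<close>, as needed for the corners in generation 0.\<close>
  define A where "A = (B + 1) / (1 - contraction)"
  have r: "0 < contraction" "contraction < 1" by (rule contraction_bounds)+
  have A: "0 \<le> A" "A * contraction + (B + 1) = A" "1 \<le> A"
    using r B(1) by (auto simp: A_def field_simps)
  have "\<bar>u x - u p1\<bar> \<le> A * sqrt (En n u)" if "x \<in> V S n" for n u x
    using that
  proof (induction n arbitrary: u x)
    case 0
    have "(u x - u p1)\<^sup>2 \<le> tri_energy u"
      using 0 by (auto simp: V0_def tri_energy_def power2_commute)
    hence "\<bar>u x - u p1\<bar> \<le> sqrt (tri_energy u)" by (simp add: real_le_rsqrt)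
    also have "\<dots> \<le> A * sqrt (tri_energy u)"
      using mult_right_mono[OF A(3), of "sqrt (tri_energy u)"] by (simp add: tri_energy_def)
    finally show ?case by (simp add: energy_0)
  next
    case (Suc n)
    then obtain s y where s: "s \<in> S" "y \<in> V S n" "x = cell_map s y" by auto
    have "\<bar>u x - u (cell_map s p1)\<bar> \<le> A * sqrt (En n (u \<circ> cell_map s))"
      using Suc.IH[OF s(2), of "u \<circ> cell_map s"] unfolding s(3) comp_def .
    also have "\<dots> \<le> A * sqrt (contraction\<^sup>2 * En (Suc n) u)"
      using A(1) energy_cell_le[OF s(1)] by (intro mult_left_mono real_sqrt_le_mono)
    also have "\<dots> = A * contraction * sqrt (En (Suc n) u)"
      using r by (simp add: real_sqrt_mult)
    finally have 1: "\<bar>u x - u (cell_map s p1)\<bar> \<le> A * contraction * sqrt (En (Suc n) u)" .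
    have "\<bar>u (cell_map s p1) - u p1\<bar> \<le> B * sqrt (En (Suc 0) u)"
      using B(2)[OF s(1)] by (simp add: level_one)
    also have "\<dots> \<le> (B + 1) * sqrt (En (Suc n) u)"
      using B(1) by (intro mult_mono real_sqrt_le_mono energy_mono) (auto simp: energy_nonneg)
    finally have "\<bar>u x - u p1\<bar> \<le> (A * contraction + (B + 1)) * sqrt (En (Suc n) u)"
      using 1 by (simp add: distrib_right)
    thus ?case unfolding A(2) .
  qed
  thus ?thesis using A(1) by blast
qed

definition osc_const :: real where
  "osc_const = (SOME A. 0 \<le> A \<and> (\<forall>n u. \<forall>x\<in>V S n. \<bar>u x - u p1\<bar> \<le> A * sqrt (En n u)))"

lemma osc_const_nonneg: "0 \<le> osc_const"
  and osc_p1: "x \<in> V S n \<Longrightarrow> \<bar>u x - u p1\<bar> \<le> osc_const * sqrt (En n u)"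
  using someI_ex[OF oscillation_exists[unfolded Bex_def]] unfolding osc_const_def by blast+

lemma osc_word:
  assumes "w \<in> words S m" "x \<in> V S n" "y \<in> V S n"
  shows "\<bar>u (word_map w x) - u (word_map w y)\<bar>
     \<le> 2 * osc_const * contraction ^ m * sqrt (En (m + n) u)"
proof -
  have "\<bar>u (word_map w x) - u (word_map w y)\<bar> \<le> 2 * (osc_const * sqrt (En n (u \<circ> word_map w)))"
    using osc_p1[OF assms(2), of "u \<circ> word_map w"] osc_p1[OF assms(3), of "u \<circ> word_map w"]
    unfolding comp_def by linarith
  also have "\<dots> \<le> 2 * (osc_const * sqrt ((contraction ^ m)\<^sup>2 * En (m + n) u))"
    using energy_word_le[OF assms(1)] osc_const_nonneg
    by (intro mult_left_mono real_sqrt_le_mono) auto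
  also have "\<dots> = 2 * osc_const * contraction ^ m * sqrt (En (m + n) u)"
    using contraction_bounds by (simp add: real_sqrt_mult)
  finally show ?thesis .
qed

end

lemma images_meet:
  assumes "f ` A \<inter> g ` B \<noteq> {}"
  shows "\<exists>x\<in>A. \<exists>y\<in>B. f x = g y"
proof -
  obtain p where p: "p \<in> f ` A" "p \<in> g ` B" using assms by blast
  obtain x where "x \<in> A" "p = f x" using p(1) by blast
  moreover obtain y where "y \<in> B" "p = g y" using p(2) by blast
  ultimately have "f x = g y" by simp
  thus ?thesis using \<open>x \<in> A\<close> \<open>y \<in> B\<close> by blast
qed

context harmonic_structure
begin

subsection \<open>The attractor\<close>

lemma compact_K: "compact K" and K_nonempty: "K \<noteq> {}"
  and K_cells: "K = (\<Union>s\<in>S. cell_map s ` K)"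
  using attractor by (auto simp: is_attractor_def)

lemma cell_map_K: "s \<in> S \<Longrightarrow> x \<in> K \<Longrightarrow> cell_map s x \<in> K"
  using K_cells by blast

lemma K_words: "K = (\<Union>w\<in>words S n. word_map w ` K)"
proof (induction n)
  case (Suc n)
  have "(\<Union>w\<in>words S (Suc n). word_map w ` K) = (\<Union>s\<in>S. cell_map s ` (\<Union>w\<in>words S n. word_map w ` K))"
    unfolding words_Suc by (force simp: image_iff)
  thus ?case using Suc.IH K_cells by simp
qed simp

lemma word_map_K: "w \<in> words S n \<Longrightarrow> x \<in> K \<Longrightarrow> word_map w x \<in> K"
  using K_words by blast

lemma obtain_small_cells:
  assumes "0 < e"
  obtains N where "\<And>n w x y. N \<le> n \<Longrightarrow> w \<in> words S n \<Longrightarrow> x \<in> K \<union> V0 \<Longrightarrow> y \<in> K \<union> V0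
    \<Longrightarrow> dist (word_map w x) (word_map w y) < e"
proof -
  have "bounded (K \<union> V0)" using compact_K by (simp add: compact_imp_bounded finite_imp_bounded)
  then obtain D' where D': "\<forall>x\<in>K \<union> V0. \<forall>y\<in>K \<union> V0. dist x y \<le> D'"
    unfolding bounded_two_points ..
  define D where "D = max D' 1"
  have D: "0 < D" "\<And>x y. x \<in> K \<union> V0 \<Longrightarrow> y \<in> K \<union> V0 \<Longrightarrow> dist x y \<le> D"
    using D' by (auto simp: D_def le_max_iff_disj)
  obtain N where N: "(1 / 7 :: real) ^ N < e / D"
    using real_arch_pow_inv[of "e / D" "1 / 7"] assms D(1) by auto
  show ?thesis
  proof (rule that)
    fix n w x y assume n: "N \<le> n" and w: "w \<in> words S n" and xy: "x \<in> K \<union> V0" "y \<in> K \<union> V0"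
    have "dist (word_map w x) (word_map w y) = dist x y * (1 / 7) ^ n"
      using w by (simp add: dist_word_map words_def power_divide)
    also have "\<dots> \<le> D * (1 / 7) ^ n" using D(2)[OF xy] by (intro mult_right_mono) auto
    also have "\<dots> \<le> D * (1 / 7) ^ N"
      using n D(1) by (intro mult_left_mono power_decreasing) auto
    also have "\<dots> < e" using N D(1) by (simp add: field_simps)
    finally show "dist (word_map w x) (word_map w y) < e" .
  qed
qed

definition Vstar :: "point set" where "Vstar = (\<Union>n. V S n)"

text \<open>A corner is the limit of the images of any point of \<open>K\<close> under the iterates of the map of its
  corner cell.\<close>

lemma V0_subset_K: "V0 \<subseteq> K"
proof
  fix a assume a: "a \<in> V0"
  then obtain s where s: "s \<in> S" "cell_map s a = a" using corner_fixed by blast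
  obtain x where x: "x \<in> K" using K_nonempty by blast
  have "a \<in> closure K"
  proof (rule closure_approachable[THEN iffD2], intro allI impI)
    fix e :: real assume "0 < e"
    then obtain n where n: "\<And>w x y. w \<in> words S n \<Longrightarrow> x \<in> K \<union> V0 \<Longrightarrow> y \<in> K \<union> V0
      \<Longrightarrow> dist (word_map w x) (word_map w y) < e" using obtain_small_cells by (metis order_refl)
    have w: "replicate n s \<in> words S n" using s by (auto simp: words_def)
    have "word_map (replicate n s) a = a" by (induction n) (auto simp: s)
    hence "dist (word_map (replicate n s) x) a < e" using n[OF w, of x a] x a by simp
    thus "\<exists>y\<in>K. dist y a < e" using word_map_K[OF w x] by blast
  qed
  thus "a \<in> K" using compact_K by (simp add: compact_imp_closed)
qed

lemma V_subset_K: "V S n \<subseteq> K"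
proof (induction n)
  case 0 show ?case by (simp add: V0_subset_K)
next
  case (Suc n)
  thus ?case unfolding V.simps(2) by (subst K_cells) (intro UN_mono image_mono subset_refl)
qed

lemma Vstar_subset_K: "Vstar \<subseteq> K"
  using V_subset_K by (auto simp: Vstar_def)

text \<open>Each point of \<open>K\<close> lies in arbitrarily small cells, and each of these has a vertex.\<close>

lemma K_subset_closure_Vstar: "K \<subseteq> closure Vstar"
proof
  fix x assume x: "x \<in> K"
  show "x \<in> closure Vstar"
  proof (rule closure_approachable[THEN iffD2], intro allI impI)
    fix e :: real assume "0 < e"
    then obtain n where n: "\<And>w x y. w \<in> words S n \<Longrightarrow> x \<in> K \<union> V0 \<Longrightarrow> y \<in> K \<union> V0
      \<Longrightarrow> dist (word_map w x) (word_map w y) < e" using obtain_small_cells by (metis order_refl)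
    obtain w y where w: "w \<in> words S n" "y \<in> K" "x = word_map w y" using x K_words by blast
    have "p1 \<in> V0" by (simp add: V0_def)
    hence "dist (word_map w p1) x < e" "word_map w p1 \<in> V S n"
      using n[OF w(1), of p1 y] w Vword_subset_V[OF w(1)] by (auto simp: Vword_def)
    thus "\<exists>y\<in>Vstar. dist y x < e" by (auto simp: Vstar_def)
  qed
qed

lemma closure_Vstar: "closure Vstar = K"
  using K_subset_closure_Vstar closure_minimal[OF Vstar_subset_K] compact_K
  by (auto simp: compact_imp_closed)

lemma K_subset_triangle: "K \<subseteq> triangle"
proof -
  have "Vstar \<subseteq> triangle" using V_subset_triangle by (auto simp: Vstar_def)
  hence "closure Vstar \<subseteq> triangle" using closed_triangle by (rule closure_minimal)
  thus ?thesis by (simp add: closure_Vstar)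
qed

text \<open>The finitely many cells of generation \<open>n\<close> are compact, so those that do not touch have a
  positive distance.\<close>

lemma near_cells_share_vertex:
  "\<exists>\<delta>>0. \<forall>w\<in>words S n. \<forall>w'\<in>words S n. \<forall>x\<in>word_map w ` K. \<forall>y\<in>word_map w' ` K.
     dist x y < \<delta> \<longrightarrow> Vword w \<inter> Vword w' \<noteq> {}"
proof -
  let ?W = "words S n \<times> words S n"
  have "\<exists>d>0. \<forall>x\<in>word_map (fst p) ` K. \<forall>y\<in>word_map (snd p) ` K.
      dist x y < d \<longrightarrow> Vword (fst p) \<inter> Vword (snd p) \<noteq> {}" if p: "p \<in> ?W" for p
  proof (cases "word_map (fst p) ` K \<inter> word_map (snd p) ` K = {}")
    case True
    have "compact (word_map w ` K)" for w
      using compact_K by (intro compact_continuous_image continuous_word_map)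
    then obtain d where "0 < d" "\<forall>x\<in>word_map (fst p) ` K. \<forall>y\<in>word_map (snd p) ` K. d \<le> dist x y"
      using separate_compact_closed[OF _ _ True] compact_imp_closed by blast
    thus ?thesis by (intro exI[of _ d]) (auto simp: not_less[symmetric])
  next
    case False
    from images_meet[OF this] obtain x y where xy: "x \<in> K" "y \<in> K" "word_map (fst p) x = word_map (snd p) y"
      by blast
    have w: "fst p \<in> words S n" "snd p \<in> words S n" using p by auto
    have "x \<in> triangle" "y \<in> triangle" using xy K_subset_triangle by blast+
    hence "Vword (fst p) \<inter> Vword (snd p) \<noteq> {}"
      using xy w word_in_triangle[OF w(1)] word_in_triangle[OF w(2)]
      by (intro touching_words_share_vertex[of "fst p" "snd p" x y]) (auto simp: words_def)
    thus ?thesis by (intro exI[of _ 1]) auto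
  qed
  then obtain d where d: "\<And>p. p \<in> ?W \<Longrightarrow> 0 < d p"
    "\<And>p x y. p \<in> ?W \<Longrightarrow> x \<in> word_map (fst p) ` K \<Longrightarrow> y \<in> word_map (snd p) ` K \<Longrightarrow>
      dist x y < d p \<Longrightarrow> Vword (fst p) \<inter> Vword (snd p) \<noteq> {}" by metis
  have fin: "finite (insert 1 (d ` ?W))" using finite_words[OF finite_cells] by auto
  show ?thesis
  proof (intro exI[of _ "Min (insert 1 (d ` ?W))"] conjI ballI impI)
    show "0 < Min (insert 1 (d ` ?W))" using fin d(1) by (subst Min_gr_iff) auto
  next
    fix w w' x y
    assume w: "w \<in> words S n" "w' \<in> words S n" and xy: "x \<in> word_map w ` K" "y \<in> word_map w' ` K"
      and dist: "dist x y < Min (insert 1 (d ` ?W))"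
    have "Min (insert 1 (d ` ?W)) \<le> d (w, w')" using fin w by (intro Min_le) auto
    thus "Vword w \<inter> Vword w' \<noteq> {}" using d(2)[of "(w, w')" x y] w xy dist by simp
  qed
qed

subsection \<open>Functions of finite energy\<close>

text \<open>Nearby points lie in cells of generation \<open>m\<close> that share a vertex; compare both values with the
  value there, using that the oscillation in each of the cells is of order \<open>contraction ^ m\<close>.\<close>

lemma bounded_energy_continuous:
  assumes "\<And>n. En n h \<le> M"
  shows "uniformly_continuous_on Vstar h"
  unfolding uniformly_continuous_on_def
proof (intro allI impI)
  fix e :: real assume e: "0 < e"
  have r: "0 < contraction" "contraction < 1" by (rule contraction_bounds)+
  have M: "0 \<le> M" using assms[of 0] energy_nonneg[of 0 h] by linarith
  \<comment> \<open>Two cells contribute \<open>2 * osc_const * sqrt M\<close> each; the \<open>+ 1\<close> allows division by \<open>C\<close>.\<close>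
  define C where "C = 4 * osc_const * sqrt M + 1"
  have C: "0 < C" using osc_const_nonneg M by (simp add: C_def add_nonneg_pos)
  obtain m where m: "contraction ^ m < e / C"
    using real_arch_pow_inv[of "e / C" contraction] r e C by auto
  obtain \<delta> where \<delta>: "0 < \<delta>" "\<And>w w' x y. w \<in> words S m \<Longrightarrow> w' \<in> words S m \<Longrightarrow>
      x \<in> word_map w ` K \<Longrightarrow> y \<in> word_map w' ` K \<Longrightarrow> dist x y < \<delta> \<Longrightarrow> Vword w \<inter> Vword w' \<noteq> {}"
    using near_cells_share_vertex[of m] by blast
  have "dist (h y) (h x) < e" if xy: "x \<in> Vstar" "y \<in> Vstar" "dist y x < \<delta>" for x y
  proof -
    obtain i j where "x \<in> V S i" "y \<in> V S j" using xy by (auto simp: Vstar_def)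
    hence "x \<in> V S (m + (i + j))" "y \<in> V S (m + (i + j))"
      using V_mono[of i "m + (i + j)"] V_mono[of j "m + (i + j)"] by auto
    then obtain w w' a b where w: "w \<in> words S m" "w' \<in> words S m"
      "a \<in> V S (i + j)" "x = word_map w a" "b \<in> V S (i + j)" "y = word_map w' b"
      unfolding V_eq_words by blast
    have "x \<in> word_map w ` K" "y \<in> word_map w' ` K" using w V_subset_K by blast+
    hence "Vword w \<inter> Vword w' \<noteq> {}" using \<delta>(2)[OF w(1,2)] xy(3) by (simp add: dist_commute)
    from images_meet[OF this[unfolded Vword_def]] obtain c c' where c: "c \<in> V0" "c' \<in> V0" "word_map w c = word_map w' c'"
      by blast
    have V0: "c \<in> V S (i + j)" "c' \<in> V S (i + j)" using c V0_subset_V by blast+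
    let ?b = "2 * osc_const * contraction ^ m * sqrt M"
    have b: "2 * osc_const * contraction ^ m * sqrt (En k h) \<le> ?b" for k
      using assms osc_const_nonneg r by (intro mult_left_mono real_sqrt_le_mono) auto
    have "\<bar>h x - h (word_map w c)\<bar> \<le> ?b" "\<bar>h (word_map w' c') - h y\<bar> \<le> ?b"
      using osc_word[OF w(1) w(3) V0(1), of h] osc_word[OF w(2) V0(2) w(5), of h] b w
      by (meson order_trans)+
    hence "\<bar>h x - h y\<bar> \<le> ?b + ?b" unfolding c(3) by linarith
    also have "?b + ?b = 4 * osc_const * sqrt M * contraction ^ m" by simp
    also have "\<dots> \<le> C * contraction ^ m" using r by (intro mult_right_mono) (auto simp: C_def)
    also have "\<dots> < e" using m C by (simp add: field_simps)
    finally show ?thesis by (simp add: dist_real_def abs_minus_commute)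
  qed
  thus "\<exists>\<delta>>0. \<forall>x\<in>Vstar. \<forall>x'\<in>Vstar. dist x' x < \<delta> \<longrightarrow> dist (h x') (h x) < e"
    using \<delta>(1) by blast
qed

abbreviation "FE \<equiv> finite_energy K S (product_conductance \<tau>)"

definition limit_energy :: "(point \<Rightarrow> real) \<Rightarrow> real" where
  "limit_energy u = lim (\<lambda>n. En n u)"

lemma finite_energyI:
  assumes "continuous_on K u" "\<And>n. En n u \<le> M"
  shows "u \<in> FE" "limit_energy u \<le> M"
proof -
  have "incseq (\<lambda>n. En n u)" using energy_mono by (simp add: incseq_def)
  then obtain l where l: "(\<lambda>n. En n u) \<longlonglongrightarrow> l" "\<And>n. En n u \<le> l"
    using incseq_convergent assms(2) by metis
  show "u \<in> FE" using assms(1) l(1) by (auto simp: finite_energy_def convergent_def)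
  show "limit_energy u \<le> M"
    unfolding limit_energy_def limI[OF l(1)] using assms(2) by (intro LIMSEQ_le_const2[OF l(1)]) blast
qed

lemma finite_energyD:
  assumes "u \<in> FE"
  shows "continuous_on K u" "(\<lambda>n. En n u) \<longlonglongrightarrow> limit_energy u" "En n u \<le> limit_energy u"
    "0 \<le> limit_energy u"
proof -
  show "continuous_on K u" and l: "(\<lambda>n. En n u) \<longlonglongrightarrow> limit_energy u"
    using assms by (auto simp: finite_energy_def limit_energy_def convergent_LIMSEQ_iff)
  have "incseq (\<lambda>n. En n u)" using energy_mono by (simp add: incseq_def)
  hence le: "En n u \<le> limit_energy u" for n using l by (rule incseq_le)
  show "En n u \<le> limit_energy u" by (rule le)
  show "0 \<le> limit_energy u" using energy_nonneg[of 0 u] le[of 0] by linarith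
qed

lemma finite_energy_cong:
  assumes "\<And>x. x \<in> K \<Longrightarrow> u x = v x"
  shows "u \<in> FE \<longleftrightarrow> v \<in> FE"
proof -
  have "En n u = En n v" for n using assms V_subset_K by (intro energy_cong) blast
  thus ?thesis
    using continuous_on_cong[of K K u v] assms by (simp add: finite_energy_def simp_implies_def)
qed

lemma finite_energy_oscillation:
  assumes "u \<in> FE" "x \<in> K" "y \<in> K"
  shows "\<bar>u x - u y\<bar> \<le> 2 * osc_const * sqrt (limit_energy u)"
proof -
  have *: "\<bar>u x - u p1\<bar> \<le> osc_const * sqrt (limit_energy u)" if "x \<in> K" for x
  proof -
    let ?C = "{x \<in> K. \<bar>u x - u p1\<bar> \<le> osc_const * sqrt (limit_energy u)}"
    let ?c = "osc_const * sqrt (limit_energy u)"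
    have "closed (K \<inter> (\<lambda>x. u x - u p1) -` {- ?c..?c})"
      using finite_energyD(1)[OF assms(1)] compact_K
      by (intro continuous_closed_preimage continuous_intros) (auto simp: compact_imp_closed)
    also have "K \<inter> (\<lambda>x. u x - u p1) -` {- ?c..?c} = ?C" by (auto simp: abs_le_iff)
    finally have "closed ?C" .
    moreover have "Vstar \<subseteq> ?C"
    proof
      fix x assume x: "x \<in> Vstar"
      then obtain n where "x \<in> V S n" by (auto simp: Vstar_def)
      hence "\<bar>u x - u p1\<bar> \<le> osc_const * sqrt (En n u)" by (rule osc_p1)
      also have "\<dots> \<le> osc_const * sqrt (limit_energy u)"
        using finite_energyD(3)[OF assms(1)] osc_const_nonneg
        by (intro mult_left_mono real_sqrt_le_mono)
      finally show "x \<in> ?C" using x Vstar_subset_K by blast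
    qed
    ultimately have "closure Vstar \<subseteq> ?C" by (intro closure_minimal)
    thus ?thesis using that closure_Vstar by blast
  qed
  from *[OF assms(2)] *[OF assms(3)] show ?thesis by linarith
qed

lemma finite_energy_contraction:
  assumes "u \<in> FE" "continuous_on K v" "\<And>x y. \<bar>v x - v y\<bar> \<le> \<bar>u x - u y\<bar>"
  shows "v \<in> FE" "limit_energy v \<le> limit_energy u"
proof -
  have "En n v \<le> limit_energy u" for n
    using energy_contraction[OF assms(3)] finite_energyD(3)[OF assms(1)] by (rule order_trans)
  thus "v \<in> FE" "limit_energy v \<le> limit_energy u" using finite_energyI[OF assms(2)] by auto
qed

lemma finite_energy_clamp:
  assumes "u \<in> FE"
  shows "(\<lambda>x. min b (max a (u x))) \<in> FE"
    "limit_energy (\<lambda>x. min b (max a (u x))) \<le> limit_energy u"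
  using assms finite_energyD(1)[OF assms]
  by (auto intro!: finite_energy_contraction[of u] continuous_intros)

lemma finite_energy_linear:
  assumes "u \<in> FE" "v \<in> FE"
  shows "(\<lambda>x. a * u x + b * v x) \<in> FE"
proof (rule finite_energyI)
  show "continuous_on K (\<lambda>x. a * u x + b * v x)"
    using assms by (intro continuous_intros finite_energyD)
  fix n
  have "En n (\<lambda>x. a * u x + b * v x) + En n (\<lambda>x. a * u x + (- b) * v x)
      = 2 * a\<^sup>2 * En n u + 2 * b\<^sup>2 * En n v"
    unfolding energy_linear by simp
  also have "\<dots> \<le> 2 * a\<^sup>2 * limit_energy u + 2 * b\<^sup>2 * limit_energy v"
    using assms by (intro add_mono mult_left_mono finite_energyD) auto
  finally show "En n (\<lambda>x. a * u x + b * v x) \<le> 2 * a\<^sup>2 * limit_energy u + 2 * b\<^sup>2 * limit_energy v"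
    using energy_nonneg[of n "\<lambda>x. a * u x + (- b) * v x"] by linarith
qed

definition limit_form :: "(point \<Rightarrow> real) \<Rightarrow> (point \<Rightarrow> real) \<Rightarrow> real" where
  "limit_form u v = lim (\<lambda>n. energy_form S (product_conductance \<tau>) n u v)"

lemma limit_form_tendsto:
  assumes "u \<in> FE" "v \<in> FE"
  shows "(\<lambda>n. energy_form S (product_conductance \<tau>) n u v) \<longlonglongrightarrow> limit_form u v"
proof -
  have "energy_form S (product_conductance \<tau>) n u v =
      (En n (\<lambda>x. 1 * u x + 1 * v x) - En n u - En n v) / 2" for n
    unfolding energy_linear by simp
  moreover have "(\<lambda>n. (En n (\<lambda>x. 1 * u x + 1 * v x) - En n u - En n v) / 2) \<longlonglongrightarrow>
      (limit_energy (\<lambda>x. 1 * u x + 1 * v x) - limit_energy u - limit_energy v) / 2"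
    using assms by (intro tendsto_intros finite_energyD finite_energy_linear) simp_all
  ultimately have "(\<lambda>n. energy_form S (product_conductance \<tau>) n u v) \<longlonglongrightarrow>
      (limit_energy (\<lambda>x. 1 * u x + 1 * v x) - limit_energy u - limit_energy v) / 2"
    by presburger
  thus ?thesis by (simp only: limit_form_def limI)
qed

lemma limit_form_diag: "limit_form u u = limit_energy u"
  by (simp add: limit_form_def limit_energy_def energy_form_diag)

lemma limit_form_cong:
  assumes "\<And>x. x \<in> K \<Longrightarrow> u x = u' x" "\<And>x. x \<in> K \<Longrightarrow> v x = v' x"
  shows "limit_form u v = limit_form u' v'"
proof -
  have "energy_form S (product_conductance \<tau>) n u v = energy_form S (product_conductance \<tau>) n u' v'"
    for n using assms V_subset_K by (intro energy_form_cong) blast+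
  thus ?thesis by (simp add: limit_form_def)
qed

lemma limit_form_sym: "limit_form u v = limit_form v u"
  using energy_form_sym by (simp add: limit_form_def)

lemma limit_form_linear:
  assumes "u \<in> FE" "v \<in> FE" "g \<in> FE"
  shows "limit_form (\<lambda>x. a * u x + b * v x) g = a * limit_form u g + b * limit_form v g"
  unfolding limit_form_def[of "\<lambda>x. a * u x + b * v x"] energy_form_linear
  using assms by (intro limI tendsto_intros limit_form_tendsto)

lemma finite_energy_self_similar:
  assumes "u \<in> FE"
  shows "\<And>s. s \<in> S \<Longrightarrow> u \<circ> cell_map s \<in> FE"
    and "limit_energy u = (\<Sum>s\<in>S. inverse (\<tau> s) * limit_energy (u \<circ> cell_map s))"
proof -
  show FE: "u \<circ> cell_map s \<in> FE" if s: "s \<in> S" for s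
  proof (rule finite_energyI)
    show "continuous_on K (u \<circ> cell_map s)"
      using cell_map_K[OF s] finite_energyD(1)[OF assms]
      by (intro continuous_on_compose continuous_cell_map)
        (auto intro: continuous_on_subset)
    fix n
    have "En n (u \<circ> cell_map s) \<le> contraction\<^sup>2 * En (Suc n) u" using s by (rule energy_cell_le)
    also have "\<dots> \<le> contraction\<^sup>2 * limit_energy u"
      using finite_energyD(3)[OF assms] by (intro mult_left_mono) auto
    finally show "En n (u \<circ> cell_map s) \<le> contraction\<^sup>2 * limit_energy u" .
  qed
  have "(\<lambda>n. En (Suc n) u) \<longlonglongrightarrow> (\<Sum>s\<in>S. inverse (\<tau> s) * limit_energy (u \<circ> cell_map s))"
    unfolding energy_Suc using FE by (intro tendsto_intros finite_energyD)
  moreover have "(\<lambda>n. En (Suc n) u) \<longlonglongrightarrow> limit_energy u"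
    using finite_energyD(2)[OF assms] by (rule LIMSEQ_Suc)
  ultimately show "limit_energy u = (\<Sum>s\<in>S. inverse (\<tau> s) * limit_energy (u \<circ> cell_map s))"
    by (rule LIMSEQ_unique[rotated])
qed

subsection \<open>Finite-energy functions with prescribed values\<close>

text \<open>Iterating optimal extensions keeps the energy constant, so the resulting function on
  \<open>Vstar\<close> is uniformly continuous and extends to \<open>K\<close>. Clamping it between the extreme corner values
  changes no corner value and does not increase the energy, so it replaces a maximum principle.\<close>

lemma finite_energy_interpolation:
  "\<exists>g\<in>FE. (\<forall>a\<in>V0. g a = u a) \<and>
     (\<forall>lo hi. (\<forall>a\<in>V0. lo \<le> u a \<and> u a \<le> hi) \<longrightarrow> (\<forall>x\<in>K. lo \<le> g x \<and> g x \<le> hi))"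
proof -
  have "\<exists>v. \<forall>n. (n = 0 \<longrightarrow> v n = u) \<and>
      ((\<forall>x\<in>V S n. v (Suc n) x = v n x) \<and> En (Suc n) (v (Suc n)) = En n (v n))"
    by (rule dependent_nat_choice) (use optimal_extension in auto)
  then obtain v where v: "v 0 = u" "\<And>n x. x \<in> V S n \<Longrightarrow> v (Suc n) x = v n x"
    "\<And>n. En (Suc n) (v (Suc n)) = En n (v n)" by blast
  have stable: "v (n + k) x = v n x" if "x \<in> V S n" for n k x
  proof (induction k)
    case (Suc k)
    have "x \<in> V S (n + k)" using that V_mono[of n "n + k"] by auto
    thus ?case using Suc v(2) by simp
  qed simp
  define h where "h x = v (LEAST n. x \<in> V S n) x" for x
  have h: "h x = v n x" if "x \<in> V S n" for n x
  proof -
    have "x \<in> V S (LEAST n. x \<in> V S n)" "(LEAST n. x \<in> V S n) \<le> n"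
      using that by (rule LeastI, rule Least_le)
    thus ?thesis using stable[of x "LEAST n. x \<in> V S n" "n - (LEAST n. x \<in> V S n)"]
      by (simp add: h_def)
  qed
  have En: "En n h = En 0 u" for n
  proof -
    have "En n h = En n (v n)" by (rule energy_cong) (rule h)
    also have "\<dots> = En 0 u" by (induction n) (simp_all add: v)
    finally show ?thesis .
  qed
  have "uniformly_continuous_on Vstar h"
    using En by (intro bounded_energy_continuous[of h "En 0 u"]) simp
  then obtain g where g: "uniformly_continuous_on K g" "\<And>x. x \<in> Vstar \<Longrightarrow> h x = g x"
    using uniformly_continuous_on_extension_on_closure[of Vstar h] closure_Vstar by metis
  have "En n g = En 0 u" for n
  proof -
    have "En n g = En n h"
      using g(2) unfolding Vstar_def by (intro energy_cong) (metis UN_I UNIV_I)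
    thus ?thesis using En by simp
  qed
  hence gFE: "g \<in> FE"
    using g(1) by (intro finite_energyI[of g "En 0 u"] uniformly_continuous_imp_continuous) auto
  have gV0: "g a = u a" if "a \<in> V0" for a
  proof -
    have a: "a \<in> V S 0" using that by simp
    hence "a \<in> Vstar" unfolding Vstar_def by blast
    thus ?thesis using h[OF a] g(2)[of a] v(1) by simp
  qed
  define lo hi where "lo = Min (u ` V0)" and "hi = Max (u ` V0)"
  have ne: "finite (u ` V0)" "u ` V0 \<noteq> {}" by (auto simp: V0_def)
  have bounds: "lo \<le> u a \<and> u a \<le> hi" if "a \<in> V0" for a
    using that ne by (auto simp: lo_def hi_def)
  have lohi: "lo \<le> hi" using bounds[of p1] by (auto simp: V0_def)
  show ?thesis
  proof (intro bexI[of _ "\<lambda>x. min hi (max lo (g x))"] conjI ballI allI impI)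
    show "(\<lambda>x. min hi (max lo (g x))) \<in> FE" using gFE by (rule finite_energy_clamp)
    show "min hi (max lo (g a)) = u a" if "a \<in> V0" for a
      using gV0[OF that] bounds[OF that] by simp
  next
    fix lo' hi' :: real and x assume *: "\<forall>a\<in>V0. lo' \<le> u a \<and> u a \<le> hi'"
    have "lo' \<le> lo" "hi \<le> hi'" using * ne unfolding lo_def hi_def by auto
    thus "lo' \<le> min hi (max lo (g x))" "min hi (max lo (g x)) \<le> hi'"
      using lohi by auto
  qed
qed

text \<open>Interpolate in each cell of generation \<open>n\<close> separately and glue: the values in a cell then stay
  between bounds for its own vertices.\<close>

lemma finite_energy_interpolation_words:
  "\<exists>g\<in>FE. (\<forall>a\<in>V0. g a = u a) \<and>
     (\<forall>w\<in>words S n. \<forall>lo hi. (\<forall>a\<in>Vword w. lo \<le> u a \<and> u a \<le> hi) \<longrightarrow>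
        (\<forall>x\<in>K. lo \<le> g (word_map w x) \<and> g (word_map w x) \<le> hi))"
proof (induction n arbitrary: u)
  case 0
  show ?case using finite_energy_interpolation[of u] by (simp add: Vword_simps)
next
  case (Suc n)
  have "\<forall>s. \<exists>g. g \<in> FE \<and> (\<forall>a\<in>V0. g a = (u \<circ> cell_map s) a) \<and>
      (\<forall>w\<in>words S n. \<forall>lo hi. (\<forall>a\<in>Vword w. lo \<le> (u \<circ> cell_map s) a \<and> (u \<circ> cell_map s) a \<le> hi) \<longrightarrow>
        (\<forall>x\<in>K. lo \<le> g (word_map w x) \<and> g (word_map w x) \<le> hi))"
    using Suc.IH unfolding Bex_def by blast
  then obtain g where g: "\<And>s. g s \<in> FE" "\<And>s a. a \<in> V0 \<Longrightarrow> g s a = u (cell_map s a)"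
    "\<And>s w lo hi x. w \<in> words S n \<Longrightarrow> (\<And>a. a \<in> Vword w \<Longrightarrow> lo \<le> u (cell_map s a) \<and> u (cell_map s a) \<le> hi)
      \<Longrightarrow> x \<in> K \<Longrightarrow> lo \<le> g s (word_map w x) \<and> g s (word_map w x) \<le> hi"
    unfolding comp_def by metis
  obtain v where v: "\<And>s x. s \<in> S \<Longrightarrow> x \<in> K \<Longrightarrow> v (cell_map s x) = g s x"
    using glue[of K g u] K_subset_triangle g(2) by blast
  have "continuous_on (\<Union>s\<in>S. cell_map s ` K) v"
  proof (rule continuous_on_closed_Union)
    fix s assume s: "s \<in> S"
    show "closed (cell_map s ` K)"
      using compact_K by (intro compact_imp_closed compact_continuous_image continuous_cell_map)
    have "continuous_on (cell_map s ` K) (g s \<circ> (\<lambda>p. 7 *\<^sub>R (p - q (fst s) (snd s))))"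
      using finite_energyD(1)[OF g(1)[of s]]
      by (intro continuous_on_compose continuous_intros)
         (simp add: image_image cell_map_def)
    also have "?this \<longleftrightarrow> continuous_on (cell_map s ` K) v"
      using s v by (intro continuous_on_cong refl) (auto simp: cell_map_def)
    finally show "continuous_on (cell_map s ` K) v" .
  qed (rule finite_cells)
  hence cont: "continuous_on K v" using K_cells by simp
  have En_cell: "En m (v \<circ> cell_map s) = En m (g s)" if "s \<in> S" for m s
    using v[OF that] V_subset_K by (intro energy_cong) (auto simp del: V.simps)
  have "v \<in> FE"
  proof (rule finite_energyI[OF cont])
    fix m
    have "En m v \<le> En (Suc m) v" by (rule energy_mono) simp
    also have "\<dots> \<le> (\<Sum>s\<in>S. inverse (\<tau> s) * limit_energy (g s))"
      unfolding energy_Suc using weight(1) En_cell finite_energyD(3)[OF g(1)]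
      by (intro sum_mono mult_mono) (simp_all add: less_imp_le energy_nonneg)
    finally show "En m v \<le> (\<Sum>s\<in>S. inverse (\<tau> s) * limit_energy (g s))" .
  qed
  moreover have "v a = u a" if a: "a \<in> V0" for a
  proof -
    obtain s where s: "s \<in> S" "cell_map s a = a" using corner_fixed a by blast
    have "a \<in> K" using a V0_subset_K by blast
    thus ?thesis using v[OF s(1), of a] g(2)[OF a, of s] s(2) by simp
  qed
  moreover have "lo \<le> v (word_map w x) \<and> v (word_map w x) \<le> hi"
    if w: "w \<in> words S (Suc n)" and b: "\<forall>a\<in>Vword w. lo \<le> u a \<and> u a \<le> hi" and x: "x \<in> K"
    for w lo hi x
  proof -
    obtain s w' where sw: "w = s # w'" "s \<in> S" "w' \<in> words S n" using w by (auto simp: words_Suc)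
    have "lo \<le> g s (word_map w' x) \<and> g s (word_map w' x) \<le> hi"
      using b sw by (intro g(3) x) (auto simp: Vword_simps)
    thus ?thesis using v[OF sw(2) word_map_K[OF sw(3) x]] sw(1) by simp
  qed
  ultimately show ?case by blast
qed

text \<open>In cells so small that \<open>f\<close> oscillates by less than \<open>e / 2\<close>, the interpolation of \<open>f\<close> at the vertices
  cannot leave the \<open>e / 2\<close>-neighbourhood of \<open>f\<close>.\<close>

lemma finite_energy_dense:
  assumes f: "continuous_on K f" and e: "0 < e"
  shows "\<exists>g\<in>FE. \<forall>x\<in>K. \<bar>f x - g x\<bar> < e"
proof -
  have "uniformly_continuous_on K f" using f compact_K by (rule compact_uniformly_continuous)
  then obtain d where d: "0 < d" "\<And>x y. x \<in> K \<Longrightarrow> y \<in> K \<Longrightarrow> dist y x < d \<Longrightarrow> dist (f y) (f x) < e / 2"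
    unfolding uniformly_continuous_on_def using e half_gt_zero by metis
  obtain n where n: "\<And>w x y. w \<in> words S n \<Longrightarrow> x \<in> K \<union> V0 \<Longrightarrow> y \<in> K \<union> V0
      \<Longrightarrow> dist (word_map w x) (word_map w y) < d" using obtain_small_cells[OF d(1)] by (metis order_refl)
  obtain g where g: "g \<in> FE" "\<And>w lo hi x. w \<in> words S n \<Longrightarrow> \<forall>a\<in>Vword w. lo \<le> f a \<and> f a \<le> hi \<Longrightarrow>
      x \<in> K \<Longrightarrow> lo \<le> g (word_map w x) \<and> g (word_map w x) \<le> hi"
    using finite_energy_interpolation_words[of f n] by blast
  have "\<bar>f x - g x\<bar> < e" if x: "x \<in> K" for x
  proof -
    obtain w y where w: "w \<in> words S n" "y \<in> K" "x = word_map w y" using K_words x by blast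
    have "f x - e / 2 \<le> f a \<and> f a \<le> f x + e / 2" if a: "a \<in> Vword w" for a
    proof -
      obtain b where b: "b \<in> V0" "a = word_map w b" using a by (auto simp: Vword_def)
      have "a \<in> K" using b V0_subset_K word_map_K[OF w(1)] by blast
      moreover have "dist a x < d" using n[OF w(1), of b y] w b by simp
      ultimately have "dist (f a) (f x) < e / 2" using d(2) x by blast
      thus ?thesis unfolding dist_real_def by linarith
    qed
    hence "f x - e / 2 \<le> g x \<and> g x \<le> f x + e / 2" using g(2)[OF w(1)] w by blast
    thus ?thesis using e by (simp add: abs_less_iff)
  qed
  thus ?thesis using g(1) by blast
qed

end

section \<open>Measures of full support and square-integrable functions\<close>

text \<open>Put the mass \<open>2\<^bsup>-n\<^esup>\<close> at the \<open>n\<close>-th point of a countable dense set.\<close>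

lemma full_support_measure_exists:
  fixes K :: "point set"
  assumes K: "compact K" and T: "countable T" "T \<noteq> {}" "T \<subseteq> K" "K \<subseteq> closure T"
  shows "\<exists>\<nu>. radon_measure_on K \<nu> \<and> full_support \<nu>"
proof -
  define x where "x = from_nat_into T"
  have x: "range x = T" using T by (simp add: x_def range_from_nat_into)
  define M where "M = distr (density (count_space UNIV) (\<lambda>n. ennreal ((1 / 2) ^ n))) borel x"
  have M: "sets M = sets borel" "space M = UNIV" by (simp_all add: M_def)
  have emM: "emeasure M A = (\<Sum>n. ennreal ((1 / 2) ^ n) * indicator A (x n))" if "A \<in> sets borel" for A
  proof -
    let ?w = "\<lambda>n :: nat. ennreal ((1 / 2) ^ n)"
    have "emeasure M A = emeasure (density (count_space UNIV) ?w) (x -` A)"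
      unfolding M_def using that by (subst emeasure_distr) auto
    also have "\<dots> = (\<integral>\<^sup>+n. ?w n * indicator (x -` A) n \<partial>count_space UNIV)"
      by (rule emeasure_density) auto
    also have "\<dots> = (\<Sum>n. ?w n * indicator (x -` A) n)" by (rule nn_integral_count_space_nat)
    also have "\<dots> = (\<Sum>n. ?w n * indicator A (x n))" by (simp only: indicator_def vimage_eq)
    finally show ?thesis .
  qed
  have "emeasure M UNIV = (\<Sum>n. ennreal ((1 / 2) ^ n))" 
    using emM[of UNIV] by (simp only: indicator_UNIV mult_1_right borel_open[OF open_UNIV])
  also have "\<dots> = ennreal (\<Sum>n. (1 / 2) ^ n)"
    by (rule suminf_ennreal2) (auto intro: summable_geometric)
  finally have fin: "emeasure M UNIV < \<infinity>" by simp
  have Kb: "K \<in> sets borel" using K by (simp add: borel_compact)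
  define \<nu> where "\<nu> = restrict_space M K"
  have sets: "A \<in> sets \<nu> \<longleftrightarrow> A \<subseteq> K \<and> A \<in> sets borel" for A
    using Kb M by (simp add: \<nu>_def sets_restrict_space_iff)
  have em: "emeasure \<nu> A = emeasure M A" if "A \<subseteq> K" for A
    using that Kb M by (simp add: \<nu>_def emeasure_restrict_space)
  have space: "space \<nu> = K" using M by (simp add: \<nu>_def space_restrict_space)
  have fin_le: "emeasure M A < \<infinity>" for A
    using le_less_trans[OF emeasure_space[of M A]] fin M by simp
  have "radon_measure_on K \<nu>"
    unfolding radon_measure_on_def
  proof (intro conjI allI impI ballI)
    show "sets \<nu> = sets (restrict_space borel K)"
      unfolding \<nu>_def by (rule sets_restrict_space_cong) (rule M)
    show "emeasure \<nu> C < \<infinity>" if "compact C \<and> C \<subseteq> K" for C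
      using that em fin_le by simp
    fix B assume "B \<in> sets \<nu>"
    hence B: "B \<subseteq> K" "B \<in> sets borel" using sets by auto
    have "emeasure M B = (SUP C\<in>{C. C \<subseteq> B \<and> compact C}. emeasure M C)"
      using M fin_le[of UNIV] B(2) by (intro inner_regular) auto
    also have "\<dots> = (SUP C\<in>{C. compact C \<and> C \<subseteq> B}. emeasure \<nu> C)"
      using B(1) by (intro SUP_cong) (auto simp: em)
    finally show "emeasure \<nu> B = (SUP C\<in>{C. compact C \<and> C \<subseteq> B}. emeasure \<nu> C)"
      using em B(1) by simp
  qed (rule space)
  moreover have "full_support \<nu>"
    unfolding full_support_def
  proof (intro allI impI, elim conjE)
    fix U :: "point set" assume U: "open U" "U \<inter> space \<nu> \<noteq> {}"
    then obtain p where "p \<in> U" "p \<in> closure T" using T(4) space by blast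
    hence "U \<inter> T \<noteq> {}" using open_Int_closure_eq_empty[OF U(1), of T] by blast
    then obtain n where n: "x n \<in> U \<inter> K" using T(3) x by blast
    have UK: "U \<inter> K \<in> sets borel" using U Kb by auto
    have "ennreal ((1 / 2) ^ n) * indicator (U \<inter> K) (x n) \<le> emeasure M (U \<inter> K)"
    proof -
      let ?f = "\<lambda>n. ennreal ((1 / 2) ^ n) * indicator (U \<inter> K) (x n)"
      have "sum ?f {n} \<le> suminf ?f" by (rule sum_le_suminf) auto
      thus ?thesis unfolding emM[OF UK]
        by (simp only: sum.insert finite.emptyI empty_iff not_False_eq_True sum.empty add_0_right)
    qed
    moreover have "(0 :: ennreal) < ennreal ((1 / 2) ^ n) * indicator (U \<inter> K) (x n)"
      using n by simp
    ultimately show "0 < emeasure \<nu> (U \<inter> space \<nu>)" using em space by auto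
  qed
  ultimately show ?thesis by blast
qed

lemma radon_finite_measure:
  "radon_measure_on K \<nu> \<Longrightarrow> compact K \<Longrightarrow> finite_measure \<nu>"
  unfolding radon_measure_on_def by (intro finite_measureI) fastforce

lemma sq_add_le: "((a::real) + b)\<^sup>2 \<le> 2 * a\<^sup>2 + 2 * b\<^sup>2"
  using zero_le_power2[of "a - b"] by (simp add: power2_eq_square algebra_simps)

lemma integral_sq_triangle:
  fixes u v f :: "'a \<Rightarrow> real"
  assumes [measurable]: "u \<in> borel_measurable M" "v \<in> borel_measurable M" "f \<in> borel_measurable M"
    and i: "integrable M (\<lambda>x. (u x - v x)\<^sup>2)" "integrable M (\<lambda>x. (v x - f x)\<^sup>2)"
  shows "integrable M (\<lambda>x. (u x - f x)\<^sup>2)"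
    and "(\<integral>x. (u x - f x)\<^sup>2 \<partial>M) \<le> 2 * (\<integral>x. (u x - v x)\<^sup>2 \<partial>M) + 2 * (\<integral>x. (v x - f x)\<^sup>2 \<partial>M)"
proof -
  let ?b = "\<lambda>x. 2 * (u x - v x)\<^sup>2 + 2 * (v x - f x)\<^sup>2"
  have le: "(u x - f x)\<^sup>2 \<le> ?b x" for x
    using sq_add_le[of "u x - v x" "v x - f x"] by simp
  have b: "integrable M ?b" using i by simp
  show int: "integrable M (\<lambda>x. (u x - f x)\<^sup>2)"
    using le by (intro Bochner_Integration.integrable_bound[OF b]) (auto intro!: AE_I2)
  have "(\<integral>x. (u x - f x)\<^sup>2 \<partial>M) \<le> (\<integral>x. ?b x \<partial>M)"
    using int b le by (intro integral_mono)
  also have "\<dots> = 2 * (\<integral>x. (u x - v x)\<^sup>2 \<partial>M) + 2 * (\<integral>x. (v x - f x)\<^sup>2 \<partial>M)"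
    using i by simp
  finally show "(\<integral>x. (u x - f x)\<^sup>2 \<partial>M)
      \<le> 2 * (\<integral>x. (u x - v x)\<^sup>2 \<partial>M) + 2 * (\<integral>x. (v x - f x)\<^sup>2 \<partial>M)" .
qed

context
  fixes K :: "'a::metric_space set" and \<nu> :: "'a measure"
  assumes radon: "radon_measure_on K \<nu>" and K: "compact K"
begin

interpretation finite_measure \<nu>
  using radon K by (rule radon_finite_measure)

lemma radon_space: "space \<nu> = K" and radon_sets: "sets \<nu> = sets (restrict_space borel K)"
  using radon by (auto simp: radon_measure_on_def)

lemma continuous_measurable:
  assumes "continuous_on K (f :: 'a \<Rightarrow> real)"
  shows "f \<in> borel_measurable \<nu>"
  using borel_measurable_continuous_on_restrict[OF assms] measurable_cong_sets[OF radon_sets refl]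
  by blast

lemma continuous_bounded_on:
  assumes "continuous_on K (f :: 'a \<Rightarrow> real)"
  obtains B where "\<And>x. x \<in> K \<Longrightarrow> \<bar>f x\<bar> \<le> B"
  using compact_imp_bounded[OF compact_continuous_image[OF assms K]]
  by (auto simp: bounded_real)

lemma bounded_sq_integrable:
  assumes [measurable]: "f \<in> borel_measurable \<nu>" and "\<And>x. x \<in> K \<Longrightarrow> \<bar>f x :: real\<bar> \<le> B"
  shows "integrable \<nu> (\<lambda>x. (f x)\<^sup>2)"
proof (rule integrable_const_bound[of _ "B\<^sup>2"])
  have "norm ((f x)\<^sup>2) \<le> B\<^sup>2" if "x \<in> K" for x
    using power_mono[OF assms(2)[OF that], of 2] by simp
  thus "AE x in \<nu>. norm ((f x)\<^sup>2) \<le> B\<^sup>2" using radon_space by (intro AE_I2) simp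
qed measurable

lemma continuous_sq_integrable:
  assumes "continuous_on K (f :: 'a \<Rightarrow> real)"
  shows "integrable \<nu> (\<lambda>x. (f x)\<^sup>2)"
proof -
  obtain B where "\<And>x. x \<in> K \<Longrightarrow> \<bar>f x\<bar> \<le> B" using continuous_bounded_on[OF assms] by blast
  thus ?thesis using continuous_measurable[OF assms] bounded_sq_integrable by blast
qed

definition L2_approximable :: "('a \<Rightarrow> real) \<Rightarrow> bool" where
  "L2_approximable u \<longleftrightarrow> u \<in> borel_measurable \<nu> \<and>
     (\<forall>e>0. \<exists>f. continuous_on K f \<and> integrable \<nu> (\<lambda>x. (u x - f x)\<^sup>2) \<and> (\<integral>x. (u x - f x)\<^sup>2 \<partial>\<nu>) < e)"

lemma L2_approximable_limit:
  assumes u: "u \<in> borel_measurable \<nu>"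
    and v: "\<And>e. 0 < e \<Longrightarrow> \<exists>v. L2_approximable v \<and> integrable \<nu> (\<lambda>x. (u x - v x)\<^sup>2) \<and> (\<integral>x. (u x - v x)\<^sup>2 \<partial>\<nu>) < e"
  shows "L2_approximable u"
  unfolding L2_approximable_def
proof (intro conjI u allI impI)
  fix e :: real assume e: "0 < e"
  obtain v where v: "L2_approximable v" "integrable \<nu> (\<lambda>x. (u x - v x)\<^sup>2)" "(\<integral>x. (u x - v x)\<^sup>2 \<partial>\<nu>) < e / 4"
    using v[of "e / 4"] e by auto
  have "0 < e / 4" using e by simp
  then obtain f where f: "continuous_on K f" "integrable \<nu> (\<lambda>x. (v x - f x)\<^sup>2)" "(\<integral>x. (v x - f x)\<^sup>2 \<partial>\<nu>) < e / 4"
    using v(1) unfolding L2_approximable_def by meson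
  have vm: "v \<in> borel_measurable \<nu>" using v(1) by (simp add: L2_approximable_def)
  note tri = integral_sq_triangle[OF u vm continuous_measurable[OF f(1)] v(2) f(2)]
  have "(\<integral>x. (u x - f x)\<^sup>2 \<partial>\<nu>) < e" using tri(2) v(3) f(3) by linarith
  thus "\<exists>f. continuous_on K f \<and> integrable \<nu> (\<lambda>x. (u x - f x)\<^sup>2) \<and> (\<integral>x. (u x - f x)\<^sup>2 \<partial>\<nu>) < e"
    using tri(1) f(1) by blast
qed

lemma L2_approximable_add_mult:
  assumes "L2_approximable u" "L2_approximable v"
  shows "L2_approximable (\<lambda>x. a * u x + v x)"
  unfolding L2_approximable_def
proof (intro conjI allI impI)
  have um[measurable]: "u \<in> borel_measurable \<nu>" and vm[measurable]: "v \<in> borel_measurable \<nu>"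
    using assms by (auto simp: L2_approximable_def)
  show "(\<lambda>x. a * u x + v x) \<in> borel_measurable \<nu>" by measurable
  fix e :: real assume e: "0 < e"
  have "0 < e / (4 * (a\<^sup>2 + 1))" "0 < e / 4" using e by (auto simp: add_nonneg_pos)
  then obtain f g where f: "continuous_on K f" "integrable \<nu> (\<lambda>x. (u x - f x)\<^sup>2)"
      "(\<integral>x. (u x - f x)\<^sup>2 \<partial>\<nu>) < e / (4 * (a\<^sup>2 + 1))"
    and g: "continuous_on K g" "integrable \<nu> (\<lambda>x. (v x - g x)\<^sup>2)" "(\<integral>x. (v x - g x)\<^sup>2 \<partial>\<nu>) < e / 4"
    using assms unfolding L2_approximable_def by meson
  note [measurable] = continuous_measurable[OF f(1)] continuous_measurable[OF g(1)]
  let ?s = "\<lambda>x. a * u x + v x" and ?t = "\<lambda>x. a * f x + v x" and ?r = "\<lambda>x. a * f x + g x"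
  have eq: "(?s x - ?t x)\<^sup>2 = a\<^sup>2 * (u x - f x)\<^sup>2" "(?t x - ?r x)\<^sup>2 = (v x - g x)\<^sup>2" for x
    by (simp_all add: power_mult_distrib flip: right_diff_distrib)
  have "integrable \<nu> (\<lambda>x. (?s x - ?r x)\<^sup>2)" and
    le: "(\<integral>x. (?s x - ?r x)\<^sup>2 \<partial>\<nu>) \<le> 2 * (a\<^sup>2 * (\<integral>x. (u x - f x)\<^sup>2 \<partial>\<nu>)) + 2 * (\<integral>x. (v x - g x)\<^sup>2 \<partial>\<nu>)"
    using integral_sq_triangle[of ?s \<nu> ?t ?r] f(2) g(2) unfolding eq by auto
  moreover have "a\<^sup>2 * (\<integral>x. (u x - f x)\<^sup>2 \<partial>\<nu>) \<le> e / 4"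
  proof -
    have "a\<^sup>2 * (\<integral>x. (u x - f x)\<^sup>2 \<partial>\<nu>) \<le> (a\<^sup>2 + 1) * (e / (4 * (a\<^sup>2 + 1)))"
      using f(3) by (intro mult_mono) (auto intro: less_imp_le)
    also have "\<dots> = e / 4" by (simp add: field_simps add_nonneg_eq_0_iff)
    finally show ?thesis .
  qed
  ultimately have "(\<integral>x. (?s x - ?r x)\<^sup>2 \<partial>\<nu>) < e" using g(3) by linarith
  thus "\<exists>h. continuous_on K h \<and> integrable \<nu> (\<lambda>x. (?s x - h x)\<^sup>2) \<and> (\<integral>x. (?s x - h x)\<^sup>2 \<partial>\<nu>) < e"
    using \<open>integrable \<nu> (\<lambda>x. (?s x - ?r x)\<^sup>2)\<close> f(1) g(1)
    by (intro exI[of _ ?r] conjI continuous_intros)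
qed

text \<open>The indicator of a compact set is the decreasing limit of the tents
  \<open>max 0 (1 - n * infdist x C)\<close>.\<close>

lemma L2_approximable_compact:
  assumes C: "compact C" "C \<subseteq> K"
  shows "L2_approximable (indicator C)"
proof (cases "C = {}")
  case True
  have "indicator C = (\<lambda>x. 0 :: real)" using True by auto
  thus ?thesis unfolding L2_approximable_def by (auto intro!: exI[of _ "\<lambda>x. 0"])
next
  case False
  have "C \<in> sets \<nu>" using C by (auto simp: radon_sets sets_restrict_space intro!: image_eqI[of _ _ C] borel_compact)
  hence m[measurable]: "indicator C \<in> borel_measurable \<nu>" by simp
  define f where "f n x = max 0 (1 - real n * infdist x C)" for n x
  have cont: "continuous_on K (f n)" for n unfolding f_def by (intro continuous_intros)
  note [measurable] = continuous_measurable[OF cont]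
  have bound: "\<bar>indicator C x - f n x\<bar> \<le> 1" for n x
    using infdist_nonneg[of x C] by (auto simp: f_def indicator_def)
  have lim: "(\<lambda>n. f n x) \<longlonglongrightarrow> indicator C x" for x
  proof (cases "x \<in> C")
    case True thus ?thesis by (simp add: f_def)
  next
    case xC: False
    have pos: "0 < infdist x C"
      using xC False C(1) by (intro infdist_pos_not_in_closed) (auto simp: compact_imp_closed)
    obtain N where N: "1 < real N * infdist x C"
      using reals_Archimedean3[OF pos] by blast
    have "f n x = 0" if "N \<le> n" for n
    proof -
      have "real N * infdist x C \<le> real n * infdist x C" using that pos by simp
      thus ?thesis using N by (simp add: f_def)
    qed
    hence "eventually (\<lambda>n. f n x = indicator C x) sequentially"
      using xC by (auto simp: eventually_sequentially)
    thus ?thesis by (rule tendsto_eventually)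
  qed
  have sq: "\<bar>(indicator C x - f n x)\<^sup>2\<bar> \<le> 1" for n x
    using bound[of x n] by (simp add: abs_square_le_1)
  have int: "integrable \<nu> (\<lambda>x. (indicator C x - f n x)\<^sup>2)" for n
    using sq by (intro integrable_const_bound[of _ 1]) (auto intro!: AE_I2)
  have "(\<lambda>n. \<integral>x. (indicator C x - f n x)\<^sup>2 \<partial>\<nu>) \<longlonglongrightarrow> (\<integral>x. 0 \<partial>\<nu>)"
  proof (rule integral_dominated_convergence[where w = "\<lambda>x. 1"])
    have "(\<lambda>n. (indicator C x - f n x)\<^sup>2) \<longlonglongrightarrow> (indicator C x - indicator C x)\<^sup>2" for x
      by (intro tendsto_intros lim)
    thus "AE x in \<nu>. (\<lambda>n. (indicator C x - f n x)\<^sup>2) \<longlonglongrightarrow> 0" by simp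
  qed (use sq in auto)
  hence ev: "\<forall>\<^sub>F n in sequentially. (\<integral>x. (indicator C x - f n x)\<^sup>2 \<partial>\<nu>) < e" if "0 < e" for e
    using that by (simp add: order_tendstoD(2))
  show ?thesis
    unfolding L2_approximable_def
  proof (intro conjI m allI impI)
    fix e :: real assume "0 < e"
    from ev[OF this] obtain n where "(\<integral>x. (indicator C x - f n x)\<^sup>2 \<partial>\<nu>) < e"
      by (auto simp: eventually_sequentially)
    thus "\<exists>f. continuous_on K f \<and> integrable \<nu> (\<lambda>x. (indicator C x - f x)\<^sup>2) \<and>
        (\<integral>x. (indicator C x - f x)\<^sup>2 \<partial>\<nu>) < e"
      using cont int by blast
  qed
qed

text \<open>By inner regularity it is enough to treat compact sets.\<close>

lemma L2_approximable_indicator: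
  assumes B: "B \<in> sets \<nu>"
  shows "L2_approximable (indicator B)"
proof (rule L2_approximable_limit)
  show "indicator B \<in> borel_measurable \<nu>" using B by simp
  fix e :: real assume e: "0 < e"
  have reg: "emeasure \<nu> B = (SUP C\<in>{C. compact C \<and> C \<subseteq> B}. emeasure \<nu> C)"
    using radon B by (auto simp: radon_measure_on_def)
  have "\<exists>C. compact C \<and> C \<subseteq> B \<and> measure \<nu> B - measure \<nu> C < e"
  proof (cases "measure \<nu> B < e")
    case True thus ?thesis by (intro exI[of _ "{}"]) auto
  next
    case False
    have "ennreal (measure \<nu> B - e) < emeasure \<nu> B"
      using False e by (simp add: emeasure_eq_measure ennreal_lessI)
    then obtain C where "compact C" "C \<subseteq> B" "ennreal (measure \<nu> B - e) < emeasure \<nu> C"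
      unfolding reg less_SUP_iff by blast
    thus ?thesis using False e by (intro exI[of _ C]) (auto simp: emeasure_eq_measure ennreal_less_iff)
  qed
  then obtain C where C: "compact C" "C \<subseteq> B" "measure \<nu> B - measure \<nu> C < e" by blast
  have BK: "B \<subseteq> K" using B sets.sets_into_space radon_space by blast
  have Cs: "C \<in> sets \<nu>"
    using C BK by (auto simp: radon_sets sets_restrict_space intro!: image_eqI[of _ _ C] borel_compact)
  have sq: "(indicator B x - indicator C x)\<^sup>2 = (indicator (B - C) x :: real)" for x
    using C(2) by (auto simp: indicator_def)
  have "L2_approximable (indicator C)" using C BK by (intro L2_approximable_compact) auto
  moreover have "integrable \<nu> (indicator (B - C) :: _ \<Rightarrow> real)"
    using B Cs by (intro integrable_const_bound[of _ 1]) (auto intro!: AE_I2 simp: indicator_def)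
  moreover have "(\<integral>x. indicator (B - C) x \<partial>\<nu>) < e"
    using C(2,3) B Cs by (simp add: finite_measure_Diff)
  ultimately show "\<exists>v. L2_approximable v \<and> integrable \<nu> (\<lambda>x. (indicator B x - v x)\<^sup>2) \<and>
      (\<integral>x. (indicator B x - v x)\<^sup>2 \<partial>\<nu>) < e"
    by (intro exI[of _ "indicator C"]) (simp add: sq)
qed

lemma L2_approximable_simple:
  assumes F: "simple_function \<nu> (F :: 'a \<Rightarrow> real)"
  shows "L2_approximable F"
proof -
  have fin: "finite (F ` space \<nu>)" using F by (simp add: simple_function_def)
  have s: "F -` {y} \<inter> space \<nu> \<in> sets \<nu>" for y using F by (rule simple_functionD)
  have "L2_approximable (\<lambda>x. \<Sum>y\<in>A. y * indicator (F -` {y} \<inter> space \<nu>) x)" if "finite A" for A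
    using that
  proof (induction A)
    case empty
    show ?case using L2_approximable_compact[of "{}"] by (simp add: indicator_def[abs_def])
  next
    case (insert y A)
    show ?case unfolding sum.insert[OF insert.hyps]
      using L2_approximable_indicator[OF s] insert.IH by (rule L2_approximable_add_mult)
  qed
  from this[OF fin] have "L2_approximable (\<lambda>x. \<Sum>y\<in>F ` space \<nu>. y * indicator (F -` {y} \<inter> space \<nu>) x)" .
  moreover have "(\<Sum>y\<in>F ` space \<nu>. y * indicator (F -` {y} \<inter> space \<nu>) x) = F x" if "x \<in> space \<nu>" for x
  proof -
    have "(\<Sum>y\<in>F ` space \<nu>. y * indicator (F -` {y} \<inter> space \<nu>) x) = (\<Sum>y\<in>F ` space \<nu>. if y = F x then y else 0)"
      using that by (intro sum.cong) auto
    also have "\<dots> = F x" using that fin by simp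
    finally show ?thesis .
  qed
  hence "integrable \<nu> (\<lambda>x. ((\<Sum>y\<in>F ` space \<nu>. y * indicator (F -` {y} \<inter> space \<nu>) x) - f x)\<^sup>2)
        = integrable \<nu> (\<lambda>x. (F x - f x)\<^sup>2)"
      "(\<integral>x. ((\<Sum>y\<in>F ` space \<nu>. y * indicator (F -` {y} \<inter> space \<nu>) x) - f x)\<^sup>2 \<partial>\<nu>)
        = (\<integral>x. (F x - f x)\<^sup>2 \<partial>\<nu>)" for f
    by (auto intro!: Bochner_Integration.integrable_cong Bochner_Integration.integral_cong)
  ultimately show ?thesis
    using borel_measurable_simple_function[OF F] by (auto simp only: L2_approximable_def)
qed

text \<open>Simple functions bounded by \<open>2 * \<bar>u\<bar>\<close> converge to \<open>u\<close> pointwise, hence in \<open>L\<^sup>2\<close> by dominated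
  convergence.\<close>

lemma continuous_dense_L2:
  assumes u: "u \<in> L2 \<nu>" and e: "0 < e"
  shows "\<exists>f. continuous_on K f \<and> L2_norm \<nu> (\<lambda>x. u x - f x) < e"
proof -
  have um[measurable]: "u \<in> borel_measurable \<nu>" and ui: "integrable \<nu> (\<lambda>x. (u x)\<^sup>2)"
    using u by (auto simp: L2_def)
  obtain F where F: "\<And>i. simple_function \<nu> (F i)" "\<And>x. x \<in> space \<nu> \<Longrightarrow> (\<lambda>i. F i x) \<longlonglongrightarrow> u x"
    "\<And>i x. x \<in> space \<nu> \<Longrightarrow> dist (F i x) 0 \<le> 2 * dist (u x) 0"
    using borel_measurable_implies_sequence_metric[OF um, of 0] by blast
  note [measurable] = borel_measurable_simple_function[OF F(1)]
  have sq: "norm ((u x - F i x)\<^sup>2) \<le> 9 * (u x)\<^sup>2" if "x \<in> space \<nu>" for i x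
  proof -
    have "\<bar>u x - F i x\<bar> \<le> \<bar>3 * u x\<bar>" using F(3)[OF that, of i] by (simp add: dist_real_def)
    hence "(u x - F i x)\<^sup>2 \<le> (3 * u x)\<^sup>2" by (simp only: abs_le_square_iff)
    thus ?thesis by (simp add: power_mult_distrib)
  qed
  have w: "integrable \<nu> (\<lambda>x. 9 * (u x)\<^sup>2)" using ui by simp
  have int: "integrable \<nu> (\<lambda>x. (u x - F i x)\<^sup>2)" for i
    using sq by (intro Bochner_Integration.integrable_bound[OF w]) (auto intro!: AE_I2)
  have "(\<lambda>i. \<integral>x. (u x - F i x)\<^sup>2 \<partial>\<nu>) \<longlonglongrightarrow> (\<integral>x. 0 \<partial>\<nu>)"
  proof (rule integral_dominated_convergence[OF _ _ w])
    have "(\<lambda>i. (u x - F i x)\<^sup>2) \<longlonglongrightarrow> (u x - u x)\<^sup>2" if "x \<in> space \<nu>" for x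
      using that by (intro tendsto_intros F)
    thus "AE x in \<nu>. (\<lambda>i. (u x - F i x)\<^sup>2) \<longlonglongrightarrow> 0" by (intro AE_I2) simp
  qed (use sq in auto)
  hence ev: "\<forall>\<^sub>F i in sequentially. (\<integral>x. (u x - F i x)\<^sup>2 \<partial>\<nu>) < d" if "0 < d" for d
    using that by (simp add: order_tendstoD(2))
  have "L2_approximable u"
  proof (rule L2_approximable_limit[OF um])
    fix d :: real assume "0 < d"
    from ev[OF this] obtain i where "(\<integral>x. (u x - F i x)\<^sup>2 \<partial>\<nu>) < d"
      by (auto simp: eventually_sequentially)
    thus "\<exists>v. L2_approximable v \<and> integrable \<nu> (\<lambda>x. (u x - v x)\<^sup>2) \<and> (\<integral>x. (u x - v x)\<^sup>2 \<partial>\<nu>) < d"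
      using int L2_approximable_simple[OF F(1)] by blast
  qed
  moreover have "0 < e\<^sup>2" using e by simp
  ultimately obtain f where f: "continuous_on K f" "(\<integral>x. (u x - f x)\<^sup>2 \<partial>\<nu>) < e\<^sup>2"
    unfolding L2_approximable_def by meson
  have "L2_norm \<nu> (\<lambda>x. u x - f x) < sqrt (e\<^sup>2)"
    using f(2) unfolding L2_norm_def by (rule real_sqrt_less_mono)
  thus ?thesis using f(1) e by auto
qed

end

section \<open>The Dirichlet form\<close>

locale harmonic_dirichlet = harmonic_structure +
  fixes \<nu> :: "point measure"
  assumes radon: "radon_measure_on K \<nu>" and full: "full_support \<nu>"
begin

sublocale finite_measure \<nu>
  using radon compact_K by (rule radon_finite_measure)

lemmas space_nu = radon_space[OF radon compact_K]
lemmas sets_nu = radon_sets[OF radon compact_K]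
lemmas continuous_nu_measurable = continuous_measurable[OF radon compact_K]
lemmas continuous_nu_sq_integrable = continuous_sq_integrable[OF radon compact_K]

definition mass :: real where "mass = measure \<nu> K"

lemma mass_pos: "0 < mass"
proof -
  have "0 < emeasure \<nu> (UNIV \<inter> space \<nu>)"
    using full K_nonempty space_nu unfolding full_support_def by blast
  thus ?thesis using space_nu by (simp add: mass_def emeasure_eq_measure)
qed

text \<open>The set of the points of \<open>U\<close> where \<open>g\<close> does not vanish is relatively open, so it has positive
  measure as soon as it is not empty.\<close>

lemma support_continuous:
  assumes g: "continuous_on K g" and U: "open U" and x: "x \<in> K" "x \<in> U" "g x \<noteq> (0 :: real)"
  shows "\<not> (AE y in \<nu>. y \<in> U \<longrightarrow> g y = 0)"
proof
  assume AE: "AE y in \<nu>. y \<in> U \<longrightarrow> g y = 0"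
  have "open (- {0 :: real})" by (intro open_Compl closed_singleton)
  then obtain W where W: "open W" "W \<inter> K = g -` (- {0}) \<inter> K"
    using g unfolding continuous_on_open_invariant by blast
  have UW: "open (U \<inter> W)" using U W by blast
  have "U \<inter> W \<inter> space \<nu> \<in> sets \<nu>"
    using UW by (auto simp: sets_nu space_nu sets_restrict_space intro!: image_eqI[of _ _ "U \<inter> W"])
  moreover have "{y \<in> space \<nu>. \<not> (y \<in> U \<longrightarrow> g y = 0)} = U \<inter> W \<inter> space \<nu>"
    using W(2) space_nu by blast
  ultimately have "emeasure \<nu> (U \<inter> W \<inter> space \<nu>) = 0" using AE by (simp only: AE_iff_measurable)
  moreover have "U \<inter> W \<inter> space \<nu> \<noteq> {}" using x W(2) space_nu by blast
  ultimately show False using full UW unfolding full_support_def by force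
qed

lemma continuous_AE_eq:
  assumes "continuous_on K u" "continuous_on K v" "AE x in \<nu>. u x = (v x :: real)" "x \<in> K"
  shows "u x = v x"
proof (rule ccontr)
  assume "u x \<noteq> v x"
  hence "\<not> (AE y in \<nu>. y \<in> UNIV \<longrightarrow> u y - v y = 0)"
    using assms by (intro support_continuous[of _ _ x] continuous_intros) auto
  thus False using assms(3) by simp
qed

lemma finite_energy_L2: "u \<in> FE \<Longrightarrow> u \<in> L2 \<nu>"
  using finite_energyD(1) continuous_nu_measurable continuous_nu_sq_integrable
  by (auto simp: L2_def)

definition form_domain :: "(point \<Rightarrow> real) set" where
  "form_domain = {f \<in> L2 \<nu>. \<exists>u\<in>FE. AE x in \<nu>. f x = u x}"

text \<open>The continuous representative; on \<open>K\<close> it is unique because \<open>\<nu>\<close> has full support.\<close>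

definition rep :: "(point \<Rightarrow> real) \<Rightarrow> point \<Rightarrow> real" where
  "rep f = (SOME u. u \<in> FE \<and> (AE x in \<nu>. f x = u x))"

definition form :: "(point \<Rightarrow> real) \<Rightarrow> (point \<Rightarrow> real) \<Rightarrow> real" where
  "form f g = limit_form (rep f) (rep g)"

lemma form_domainI: "f \<in> L2 \<nu> \<Longrightarrow> u \<in> FE \<Longrightarrow> (AE x in \<nu>. f x = u x) \<Longrightarrow> f \<in> form_domain"
  by (auto simp: form_domain_def)

lemma finite_energy_in_domain: "u \<in> FE \<Longrightarrow> u \<in> form_domain"
  by (rule form_domainI) (auto simp: finite_energy_L2)

lemma rep_FE: "f \<in> form_domain \<Longrightarrow> rep f \<in> FE" and rep_AE: "f \<in> form_domain \<Longrightarrow> AE x in \<nu>. f x = rep f x"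
proof -
  assume "f \<in> form_domain"
  hence "\<exists>u. u \<in> FE \<and> (AE x in \<nu>. f x = u x)" by (auto simp: form_domain_def)
  from someI_ex[OF this] show "rep f \<in> FE" "AE x in \<nu>. f x = rep f x" by (auto simp: rep_def)
qed

lemma rep_eq:
  assumes "f \<in> L2 \<nu>" "u \<in> FE" "AE x in \<nu>. f x = u x" "x \<in> K"
  shows "rep f x = u x"
proof -
  have f: "f \<in> form_domain" using assms by (intro form_domainI)
  have "AE x in \<nu>. rep f x = u x" using rep_AE[OF f] assms(3) by eventually_elim simp
  thus ?thesis using finite_energyD(1) rep_FE[OF f] assms by (intro continuous_AE_eq) auto
qed

lemma form_eq:
  assumes "f \<in> L2 \<nu>" "u \<in> FE" "AE x in \<nu>. f x = u x"
    and "g \<in> L2 \<nu>" "v \<in> FE" "AE x in \<nu>. g x = v x"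
  shows "form f g = limit_form u v"
  unfolding form_def using assms by (intro limit_form_cong rep_eq)

lemma form_finite_energy: "u \<in> FE \<Longrightarrow> form u u = limit_energy u"
  using form_eq[of u u u u] finite_energy_L2 by (simp add: limit_form_diag)

lemma L2_linear:
  assumes "u \<in> L2 \<nu>" "v \<in> L2 \<nu>"
  shows "(\<lambda>x. a * u x + b * v x) \<in> L2 \<nu>"
proof -
  have [measurable]: "u \<in> borel_measurable \<nu>" "v \<in> borel_measurable \<nu>"
    and i: "integrable \<nu> (\<lambda>x. (u x)\<^sup>2)" "integrable \<nu> (\<lambda>x. (v x)\<^sup>2)"
    using assms by (auto simp: L2_def)
  have "integrable \<nu> (\<lambda>x. (a * u x - - (b * v x))\<^sup>2)"
  proof (rule integral_sq_triangle(1)[of "\<lambda>x. a * u x" \<nu> "\<lambda>x. 0" "\<lambda>x. - (b * v x)"])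
    show "integrable \<nu> (\<lambda>x. (a * u x - 0)\<^sup>2)" "integrable \<nu> (\<lambda>x. (0 - - (b * v x))\<^sup>2)"
      using i by (simp_all add: power_mult_distrib)
  qed measurable
  hence "integrable \<nu> (\<lambda>x. (a * u x + b * v x)\<^sup>2)" by simp
  thus ?thesis by (simp add: L2_def)
qed

lemma form_domain_L2: "f \<in> form_domain \<Longrightarrow> f \<in> L2 \<nu>"
  by (simp add: form_domain_def)

lemma linear_AE:
  assumes "f \<in> form_domain" "g \<in> form_domain"
  shows "AE x in \<nu>. a * f x + b * g x = a * rep f x + b * rep g x"
  using rep_AE[OF assms(1)] rep_AE[OF assms(2)] by eventually_elim simp

lemma form_domain_linear:
  assumes "f \<in> form_domain" "g \<in> form_domain"
  shows "(\<lambda>x. a * f x + b * g x) \<in> form_domain"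
  using assms by (intro form_domainI[OF L2_linear finite_energy_linear linear_AE] form_domain_L2 rep_FE)

lemma form_symmetric: "symmetric_form \<nu> form_domain form"
  unfolding symmetric_form_def
proof (intro conjI ballI allI impI)
  show "form_domain \<subseteq> L2 \<nu>" by (auto simp: form_domain_def)
  have "(\<lambda>x. 0) \<in> FE"
    by (rule finite_energyI[of _ 0]) (auto simp: energy_def)
  thus "form_domain \<noteq> {}" using finite_energy_in_domain by blast
next
  fix f g a b assume "f \<in> form_domain" "g \<in> form_domain"
  thus "(\<lambda>x. a * f x + b * g x) \<in> form_domain" by (rule form_domain_linear)
next
  fix f g assume f: "f \<in> form_domain" and g: "g \<in> L2 \<nu>" "AE x in \<nu>. f x = g x"
  have AE: "AE x in \<nu>. g x = rep f x" using rep_AE[OF f] g(2) by eventually_elim simp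
  show gd: "g \<in> form_domain" using g(1) rep_FE[OF f] AE by (rule form_domainI)
  fix h assume h: "h \<in> form_domain"
  show "form f h = form g h"
    using form_eq[OF g(1) rep_FE[OF f] AE form_domain_L2[OF h] rep_FE[OF h] rep_AE[OF h]]
    by (simp add: form_def)
next
  fix f g show "form f g = form g f" by (simp add: form_def limit_form_sym)
next
  fix f g h a b assume d: "f \<in> form_domain" "g \<in> form_domain" "h \<in> form_domain"
  have "form (\<lambda>x. a * f x + b * g x) h = limit_form (\<lambda>x. a * rep f x + b * rep g x) (rep h)"
    using d by (intro form_eq L2_linear form_domain_L2 finite_energy_linear rep_FE linear_AE rep_AE)
  also have "\<dots> = a * form f h + b * form g h"
    unfolding form_def using d by (intro limit_form_linear rep_FE)
  finally show "form (\<lambda>x. a * f x + b * g x) h = a * form f h + b * form g h" .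
qed

lemma form_diag: "form f f = limit_energy (rep f)"
  by (simp add: form_def limit_form_diag)

lemma form_nonneg: "f \<in> form_domain \<Longrightarrow> 0 \<le> form f f"
  using finite_energyD(4)[OF rep_FE] by (simp add: form_diag)

text \<open>Approximate first by a continuous function, then uniformly by one of finite energy; as the
  measure is finite, the second step is small in \<open>L\<^sup>2\<close> too.\<close>

lemma form_dense: "densely_defined \<nu> form_domain"
  unfolding densely_defined_def
proof (intro ballI allI impI)
  fix u and e :: real assume u: "u \<in> L2 \<nu>" and e: "0 < e"
  have um: "u \<in> borel_measurable \<nu>" using u by (simp add: L2_def)
  obtain f where f: "continuous_on K f" "L2_norm \<nu> (\<lambda>x. u x - f x) < e / 2"
    using continuous_dense_L2[OF radon compact_K u, of "e / 2"] e by auto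
  have fm: "f \<in> borel_measurable \<nu>" by (rule continuous_nu_measurable) (rule f)
  \<comment> \<open>Small enough for \<open>d\<^sup>2 * mass < (e / 2)\<^sup>2\<close>, as \<open>mass < (mass + 1)\<^sup>2\<close>.\<close>
  define d where "d = e / (2 * (mass + 1))"
  have d: "0 < d" using e mass_pos by (simp add: d_def)
  obtain g where g: "g \<in> FE" "\<And>x. x \<in> K \<Longrightarrow> \<bar>f x - g x\<bar> < d"
    using finite_energy_dense[OF f(1) d] by blast
  have gm: "g \<in> borel_measurable \<nu>" using g(1) by (intro continuous_nu_measurable finite_energyD)
  have ufi: "integrable \<nu> (\<lambda>x. (u x - f x)\<^sup>2)"
    using integral_sq_triangle(1)[of u \<nu> "\<lambda>x. 0" f] um fm u continuous_nu_sq_integrable[OF f(1)]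
    by (simp add: L2_def)
  have fgi: "integrable \<nu> (\<lambda>x. (f x - g x)\<^sup>2)"
    using f(1) finite_energyD(1)[OF g(1)] by (intro continuous_nu_sq_integrable continuous_intros)
  have "(\<integral>x. (f x - g x)\<^sup>2 \<partial>\<nu>) \<le> (\<integral>x. d\<^sup>2 \<partial>\<nu>)"
  proof (rule integral_mono[OF fgi])
    show "(f x - g x)\<^sup>2 \<le> d\<^sup>2" if "x \<in> space \<nu>" for x
      using g(2)[of x] that space_nu d by (intro abs_le_square_iff[THEN iffD1]) auto
  qed simp
  also have "\<dots> = d\<^sup>2 * mass" using space_nu by (simp add: mass_def)
  also have "\<dots> < (e / 2)\<^sup>2"
  proof -
    have "d\<^sup>2 * mass < d\<^sup>2 * (mass + 1)\<^sup>2"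
    proof (rule mult_strict_left_mono)
      have "(mass + 1)\<^sup>2 - mass = mass * mass + mass + 1"
        by (simp add: power2_eq_square algebra_simps)
      moreover have "0 < mass * mass" using mass_pos by simp
      ultimately show "mass < (mass + 1)\<^sup>2" using mass_pos by linarith
    qed (use d in simp)
    also have "\<dots> = (d * (mass + 1))\<^sup>2" by (simp only: power_mult_distrib)
    also have "d * (mass + 1) = e / 2" using mass_pos by (simp add: d_def field_simps)
    finally show ?thesis .
  qed
  finally have fg: "(\<integral>x. (f x - g x)\<^sup>2 \<partial>\<nu>) < (e / 2)\<^sup>2" .
  have uf: "(\<integral>x. (u x - f x)\<^sup>2 \<partial>\<nu>) < (e / 2)\<^sup>2"
  proof -
    have "(L2_norm \<nu> (\<lambda>x. u x - f x))\<^sup>2 < (e / 2)\<^sup>2"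
      using f(2) by (intro power_strict_mono) (auto simp: L2_norm_def)
    thus ?thesis by (simp add: L2_norm_def)
  qed
  have "(\<integral>x. (u x - g x)\<^sup>2 \<partial>\<nu>) < e\<^sup>2"
    using integral_sq_triangle(2)[OF um fm gm ufi fgi] uf fg by (simp add: power_divide)
  hence "L2_norm \<nu> (\<lambda>x. u x - g x) < sqrt (e\<^sup>2)"
    unfolding L2_norm_def by (rule real_sqrt_less_mono)
  thus "\<exists>v\<in>form_domain. L2_norm \<nu> (\<lambda>x. u x - v x) < e"
    using e finite_energy_in_domain[OF g(1)] by auto
qed

text \<open>The square of the form norm, for continuous representatives.\<close>

definition sq_norm :: "(point \<Rightarrow> real) \<Rightarrow> real" where
  "sq_norm u = limit_energy u + (\<integral>x. (u x)\<^sup>2 \<partial>\<nu>)"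

lemma form_norm_eq:
  assumes f: "f \<in> L2 \<nu>" and u: "u \<in> FE" "AE x in \<nu>. f x = u x"
  shows "form_norm \<nu> form f = sqrt (sq_norm u)"
proof -
  have "(\<integral>x. (f x)\<^sup>2 \<partial>\<nu>) = (\<integral>x. (u x)\<^sup>2 \<partial>\<nu>)"
    using f finite_energy_L2[OF u(1)] u(2) by (intro integral_cong_AE) (auto simp: L2_def)
  moreover have "form f f = limit_energy u"
    using form_eq[OF f u f u] by (simp add: limit_form_diag)
  ultimately show ?thesis by (simp add: form_norm_def sq_norm_def L2_norm_def)
qed

text \<open>Integrating \<open>u(x)\<^sup>2 \<le> 2 u(y)\<^sup>2 + 2 (u(x) - u(y))\<^sup>2\<close> over \<open>y\<close> turns the oscillation bound into
  an embedding into \<open>C(K)\<close>.\<close>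

definition sup_const :: real where "sup_const = 2 / mass + 8 * osc_const\<^sup>2"

lemma sup_const_pos: "0 < sup_const"
  using mass_pos by (simp add: sup_const_def add_pos_nonneg)

lemma sup_bound:
  assumes u: "u \<in> FE" and x: "x \<in> K"
  shows "(u x)\<^sup>2 \<le> sup_const * sq_norm u"
proof -
  let ?E = "limit_energy u" and ?I = "\<integral>x. (u x)\<^sup>2 \<partial>\<nu>"
  have E: "0 \<le> ?E" using finite_energyD(4)[OF u] .
  have I: "0 \<le> ?I" by (rule Bochner_Integration.integral_nonneg) simp
  have int: "integrable \<nu> (\<lambda>x. (u x)\<^sup>2)" using u by (intro continuous_nu_sq_integrable finite_energyD)
  have pw: "(u x)\<^sup>2 \<le> 2 * (u y)\<^sup>2 + 8 * osc_const\<^sup>2 * ?E" if "y \<in> K" for y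
  proof -
    have "(u x - u y)\<^sup>2 \<le> (2 * osc_const * sqrt ?E)\<^sup>2"
      using finite_energy_oscillation[OF u x that] osc_const_nonneg E
      by (intro abs_le_square_iff[THEN iffD1]) auto
    also have "\<dots> = 4 * osc_const\<^sup>2 * ?E" using E by (simp add: power_mult_distrib)
    finally show ?thesis using sq_add_le[of "u y" "u x - u y"] by simp
  qed
  have "(u x)\<^sup>2 * mass = (\<integral>y. (u x)\<^sup>2 \<partial>\<nu>)" using space_nu by (simp add: mass_def)
  also have "\<dots> \<le> (\<integral>y. 2 * (u y)\<^sup>2 + 8 * osc_const\<^sup>2 * ?E \<partial>\<nu>)"
    using int pw space_nu by (intro integral_mono) auto
  also have "\<dots> = 2 * ?I + 8 * osc_const\<^sup>2 * ?E * mass"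
    using int space_nu by (simp add: mass_def)
  finally have "(u x)\<^sup>2 \<le> (2 * ?I + 8 * osc_const\<^sup>2 * ?E * mass) / mass"
    using mass_pos by (simp add: pos_le_divide_eq)
  also have "\<dots> = 2 / mass * ?I + 8 * osc_const\<^sup>2 * ?E" using mass_pos by (simp add: field_simps)
  also have "\<dots> \<le> sup_const * ?I + sup_const * ?E"
    using E I mass_pos by (intro add_mono mult_right_mono) (auto simp: sup_const_def)
  finally show ?thesis by (simp add: sq_norm_def distrib_left add.commute)
qed

text \<open>A Cauchy sequence converges uniformly by the embedding into \<open>C(K)\<close>, and each \<open>En k\<close> is
  continuous for pointwise convergence, which makes the energy lower semicontinuous.\<close>

lemma form_closed: "closed_form \<nu> form_domain form"
  unfolding closed_form_def
proof (intro allI impI, elim conjE)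
  fix f :: "nat \<Rightarrow> point \<Rightarrow> real"
  assume "\<forall>n. f n \<in> form_domain"
  hence f: "f n \<in> form_domain" for n by blast
  assume Cauchy: "\<forall>e>0. \<exists>N. \<forall>m\<ge>N. \<forall>n\<ge>N. form_norm \<nu> form (\<lambda>x. f m x - f n x) < e"
  define u where "u n = rep (f n)" for n
  have u: "u n \<in> FE" "AE x in \<nu>. f n x = u n x" for n
    using rep_FE[OF f] rep_AE[OF f] by (auto simp: u_def)
  have diff_FE: "(\<lambda>x. a x - b x) \<in> FE" if "a \<in> FE" "b \<in> FE" for a b
    using finite_energy_linear[OF that, of 1 "-1"] by simp
  have diff_L2: "(\<lambda>x. a x - b x) \<in> L2 \<nu>" if "a \<in> L2 \<nu>" "b \<in> L2 \<nu>" for a b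
    using L2_linear[OF that, of 1 "-1"] by simp
  have norm_eq: "form_norm \<nu> form (\<lambda>x. f m x - f n x) = sqrt (sq_norm (\<lambda>x. u m x - u n x))" for m n
  proof (rule form_norm_eq)
    show "AE x in \<nu>. f m x - f n x = u m x - u n x"
      using u(2)[of m] u(2)[of n] by eventually_elim simp
  qed (intro diff_L2 form_domain_L2 f diff_FE u)+
  have ex: "\<exists>N. \<forall>m\<ge>N. \<forall>n\<ge>N. sq_norm (\<lambda>x. u m x - u n x) < e\<^sup>2" if "0 < e" for e
  proof -
    have "\<exists>N. \<forall>m\<ge>N. \<forall>n\<ge>N. sqrt (sq_norm (\<lambda>x. u m x - u n x)) < e"
      using Cauchy that unfolding norm_eq by simp
    then obtain N where N: "\<And>m n. m \<ge> N \<Longrightarrow> n \<ge> N \<Longrightarrow> sqrt (sq_norm (\<lambda>x. u m x - u n x)) < e"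
      by blast
    have "sq_norm (\<lambda>x. u m x - u n x) < e\<^sup>2" if "m \<ge> N" "n \<ge> N" for m n
      using N[OF that] \<open>0 < e\<close> by (auto intro: real_sqrt_less_iff[THEN iffD1])
    thus ?thesis by blast
  qed
  have "uniformly_Cauchy_on K u"
  proof (rule uniformly_Cauchy_onI)
    fix e :: real assume e: "0 < e"
    let ?d = "e / sqrt sup_const"
    have d: "0 < ?d" using e sup_const_pos by simp
    obtain N where N: "\<And>m n. m \<ge> N \<Longrightarrow> n \<ge> N \<Longrightarrow> sq_norm (\<lambda>x. u m x - u n x) < ?d\<^sup>2"
      using ex[OF d] by blast
    have "dist (u m x) (u n x) < e" if "x \<in> K" "m \<ge> N" "n \<ge> N" for x m n
    proof -
      have "(u m x - u n x)\<^sup>2 \<le> sup_const * sq_norm (\<lambda>x. u m x - u n x)"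
        using sup_bound[OF diff_FE[OF u(1) u(1)] that(1)] .
      also have "\<dots> < sup_const * ?d\<^sup>2" using N[OF that(2,3)] sup_const_pos by simp
      also have "\<dots> = e\<^sup>2" using sup_const_pos by (simp add: power_divide)
      finally show ?thesis using e power2_less_imp_less[of "\<bar>u m x - u n x\<bar>" e]
        by (simp add: dist_real_def)
    qed
    thus "\<exists>M. \<forall>x\<in>K. \<forall>m\<ge>M. \<forall>n\<ge>M. dist (u m x) (u n x) < e" by blast
  qed
  then obtain g where g: "uniform_limit K u g sequentially"
    using Cauchy_uniformly_convergent unfolding uniformly_convergent_on_def by blast
  have g_cont: "continuous_on K g"
    using g by (rule uniform_limit_theorem[rotated]) (auto intro!: always_eventually finite_energyD u)
  have lim: "(\<lambda>n. u n x) \<longlonglongrightarrow> g x" if "x \<in> K" for x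
    using tendsto_uniform_limitI[OF g that] .
  \<comment> \<open>The Cauchy condition passes to the limit in one argument.\<close>
  have close: "(\<lambda>x. u n x - g x) \<in> FE \<and> limit_energy (\<lambda>x. u n x - g x) \<le> e\<^sup>2 \<and>
      (\<forall>x\<in>K. (u n x - g x)\<^sup>2 \<le> sup_const * e\<^sup>2)"
    if N: "\<And>m. m \<ge> n \<Longrightarrow> sq_norm (\<lambda>x. u n x - u m x) < e\<^sup>2" for n e
  proof -
    have En: "En k (\<lambda>x. u n x - g x) \<le> e\<^sup>2" for k
    proof (rule LIMSEQ_le_const2)
      have "x \<in> K" if "w \<in> words S k" "x \<in> Vword w" for w x
        using Vword_subset_V[OF that(1)] V_subset_K that(2) by blast
      thus "(\<lambda>m. En k (\<lambda>x. u n x - u m x)) \<longlonglongrightarrow> En k (\<lambda>x. u n x - g x)"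
        unfolding energy_def by (intro tendsto_intros lim) auto
      have "En k (\<lambda>x. u n x - u m x) \<le> e\<^sup>2" if "m \<ge> n" for m
      proof -
        have "En k (\<lambda>x. u n x - u m x) \<le> limit_energy (\<lambda>x. u n x - u m x)"
          by (intro finite_energyD diff_FE u)
        also have "\<dots> \<le> sq_norm (\<lambda>x. u n x - u m x)" by (simp add: sq_norm_def)
        finally show ?thesis using N[OF that] by linarith
      qed
      thus "\<exists>M. \<forall>m\<ge>M. En k (\<lambda>x. u n x - u m x) \<le> e\<^sup>2" by blast
    qed
    have "continuous_on K (\<lambda>x. u n x - g x)"
      by (intro continuous_intros g_cont finite_energyD u)
    note finite_energyI[OF this En]
    moreover have "(u n x - g x)\<^sup>2 \<le> sup_const * e\<^sup>2" if x: "x \<in> K" for x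
    proof (rule LIMSEQ_le_const2)
      show "(\<lambda>m. (u n x - u m x)\<^sup>2) \<longlonglongrightarrow> (u n x - g x)\<^sup>2" by (intro tendsto_intros lim x)
      have "(u n x - u m x)\<^sup>2 \<le> sup_const * e\<^sup>2" if "m \<ge> n" for m
      proof -
        have "(u n x - u m x)\<^sup>2 \<le> sup_const * sq_norm (\<lambda>x. u n x - u m x)"
          using sup_bound[OF diff_FE[OF u(1) u(1)] x] .
        also have "\<dots> \<le> sup_const * e\<^sup>2"
          using N[OF that] sup_const_pos by (intro mult_left_mono) auto
        finally show ?thesis .
      qed
      thus "\<exists>M. \<forall>m\<ge>M. (u n x - u m x)\<^sup>2 \<le> sup_const * e\<^sup>2" by blast
    qed
    ultimately show ?thesis by blast
  qed
  have g_FE: "g \<in> FE"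
  proof -
    obtain N where N: "\<And>m n. m \<ge> N \<Longrightarrow> n \<ge> N \<Longrightarrow> sq_norm (\<lambda>x. u m x - u n x) < 1\<^sup>2"
      using ex[of 1] by auto
    have "(\<lambda>x. u N x - g x) \<in> FE" using close[of N 1] N by blast
    from diff_FE[OF u(1)[of N] this] show ?thesis by simp
  qed
  have "(\<lambda>n. form_norm \<nu> form (\<lambda>x. f n x - g x)) \<longlonglongrightarrow> 0"
  proof (rule LIMSEQ_I)
    fix e :: real assume e: "0 < e"
    \<comment> \<open>The energy contributes 1 and the \<open>L\<^sup>2\<close> part \<open>sup_const * mass\<close>; one more unit makes the
      estimate strict.\<close>
    define C where "C = 2 + sup_const * mass"
    have C: "0 < C" using sup_const_pos mass_pos by (simp add: C_def add_pos_pos)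
    have d: "0 < e / sqrt C" using e C by simp
    obtain N where N: "\<And>m n. m \<ge> N \<Longrightarrow> n \<ge> N \<Longrightarrow> sq_norm (\<lambda>x. u m x - u n x) < (e / sqrt C)\<^sup>2"
      using ex[OF d] by blast
    have "norm (form_norm \<nu> form (\<lambda>x. f n x - g x) - 0) < e" if n: "n \<ge> N" for n
    proof -
      let ?v = "\<lambda>x. u n x - g x" and ?e = "(e / sqrt C)\<^sup>2"
      have v: "?v \<in> FE" "limit_energy ?v \<le> ?e" "\<And>x. x \<in> K \<Longrightarrow> (?v x)\<^sup>2 \<le> sup_const * ?e"
        using close[of n "e / sqrt C"] N n by auto
      have "(\<integral>x. (?v x)\<^sup>2 \<partial>\<nu>) \<le> (\<integral>x. sup_const * ?e \<partial>\<nu>)"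
        using v finite_energyD(1)[OF v(1)] space_nu
        by (intro integral_mono continuous_nu_sq_integrable) auto
      also have "\<dots> = sup_const * ?e * mass" using space_nu by (simp add: mass_def)
      finally have "sq_norm ?v \<le> ?e + sup_const * ?e * mass" using v(2) by (simp add: sq_norm_def)
      also have "\<dots> = (C - 1) * ?e" by (simp add: C_def algebra_simps)
      also have "\<dots> < C * ?e" by (rule mult_strict_right_mono[OF _ zero_less_power[OF d]]) simp
      also have "\<dots> = e\<^sup>2" using C by (simp add: power_divide)
      finally have "sqrt (sq_norm ?v) < sqrt (e\<^sup>2)" by (rule real_sqrt_less_mono)
      moreover have "form_norm \<nu> form (\<lambda>x. f n x - g x) = sqrt (sq_norm ?v)"
      proof (rule form_norm_eq)
        show "AE x in \<nu>. f n x - g x = u n x - g x" using u(2)[of n] by eventually_elim simp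
      qed (intro v diff_L2 form_domain_L2 f finite_energy_L2 g_FE)+
      moreover have "0 \<le> sq_norm ?v"
        using finite_energyD(4)[OF v(1)] by (simp add: sq_norm_def)
      ultimately show ?thesis using e by simp
    qed
    thus "\<exists>N. \<forall>n\<ge>N. norm (form_norm \<nu> form (\<lambda>x. f n x - g x) - 0) < e" by blast
  qed
  thus "\<exists>g\<in>form_domain. (\<lambda>n. form_norm \<nu> form (\<lambda>x. f n x - g x)) \<longlonglongrightarrow> 0"
    using finite_energy_in_domain[OF g_FE] by blast
qed

lemma form_markovian: "markovian form_domain form"
  unfolding markovian_def
proof (intro ballI conjI)
  fix f assume f: "f \<in> form_domain"
  let ?c = "\<lambda>(u :: point \<Rightarrow> real) x. min 1 (max 0 (u x))"
  have fL2: "f \<in> borel_measurable \<nu>" "integrable \<nu> (\<lambda>x. (f x)\<^sup>2)"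
    using form_domain_L2[OF f] by (auto simp: L2_def)
  note [measurable] = fL2(1)
  have "(min 1 (max 0 (f x)))\<^sup>2 \<le> (f x)\<^sup>2" for x
    by (intro abs_le_square_iff[THEN iffD1]) (auto simp: min_def max_def)
  hence "integrable \<nu> (\<lambda>x. (?c f x)\<^sup>2)"
    by (intro Bochner_Integration.integrable_bound[OF fL2(2)]) (auto intro!: AE_I2)
  hence L2: "?c f \<in> L2 \<nu>" by (simp add: L2_def)
  have AE: "AE x in \<nu>. ?c f x = ?c (rep f) x" using rep_AE[OF f] by eventually_elim simp
  note FE = finite_energy_clamp[OF rep_FE[OF f], of 1 0]
  show "?c f \<in> form_domain" using L2 FE(1) AE by (rule form_domainI)
  have "form (?c f) (?c f) = limit_energy (?c (rep f))"
    using form_eq[OF L2 FE(1) AE L2 FE(1) AE] by (simp add: limit_form_diag)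
  thus "form (?c f) (?c f) \<le> form f f" using FE(2) by (simp add: form_diag)
qed

lemma form_dirichlet: "dirichlet_form \<nu> form_domain form"
  using form_symmetric form_nonneg form_dense form_closed form_markovian
  by (simp add: dirichlet_form_def)

lemma form_regular: "regular_form \<nu> form_domain form"
  unfolding regular_form_def space_nu
proof (intro conjI allI impI ballI)
  fix u :: "point \<Rightarrow> real" and e :: real assume "continuous_on K u" "0 < e"
  from finite_energy_dense[OF this] show "\<exists>v\<in>form_domain. continuous_on K v \<and> (\<forall>x\<in>K. \<bar>u x - v x\<bar> < e)"
    using finite_energy_in_domain finite_energyD(1) by blast
next
  fix f and e :: real assume f: "f \<in> form_domain" and e: "0 < e"
  have "form_norm \<nu> form (\<lambda>x. f x - rep f x) = sqrt (sq_norm (\<lambda>x. 0))"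
  proof (rule form_norm_eq)
    show "(\<lambda>x. f x - rep f x) \<in> L2 \<nu>"
      using L2_linear[OF form_domain_L2[OF f] finite_energy_L2[OF rep_FE[OF f]], of 1 "-1"] by simp
    show "(\<lambda>x. 0) \<in> FE" using finite_energy_linear[OF rep_FE[OF f] rep_FE[OF f], of 0 0] by simp
    show "AE x in \<nu>. f x - rep f x = 0" using rep_AE[OF f] by eventually_elim simp
  qed
  also have "\<dots> = 0" by (simp add: sq_norm_def limit_energy_def energy_def)
  finally show "\<exists>v\<in>form_domain. continuous_on K v \<and> form_norm \<nu> form (\<lambda>x. f x - v x) < e"
    using rep_FE[OF f] finite_energy_in_domain finite_energyD(1) e by (intro bexI[of _ "rep f"]) auto
qed

text \<open>Disjoint compact sets have positive distance, so small cells never meet both supports.\<close>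

lemma form_local: "local_form \<nu> form_domain form"
  unfolding local_form_def
proof (intro ballI impI, elim conjE)
  fix f g assume f: "f \<in> form_domain" and g: "g \<in> form_domain"
    and comp: "compact (fun_support \<nu> f)" "compact (fun_support \<nu> g)"
    and disj: "fun_support \<nu> f \<inter> fun_support \<nu> g = {}"
  have supp: "x \<in> fun_support \<nu> h" if h: "h \<in> form_domain" and x: "x \<in> K" "rep h x \<noteq> 0" for h x
  proof -
    have "\<not> (AE y in \<nu>. y \<in> U \<longrightarrow> h y = 0)" if U: "open U" "x \<in> U" for U
    proof
      assume "AE y in \<nu>. y \<in> U \<longrightarrow> h y = 0"
      hence "AE y in \<nu>. y \<in> U \<longrightarrow> rep h y = 0" using rep_AE[OF h] by eventually_elim simp
      thus False using support_continuous[OF finite_energyD(1)[OF rep_FE[OF h]] U(1) x(1) U(2) x(2)]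
        by blast
    qed
    thus ?thesis using x(1) by (simp add: fun_support_def space_nu)
  qed
  obtain d where d: "0 < d" "\<And>x y. x \<in> fun_support \<nu> f \<Longrightarrow> y \<in> fun_support \<nu> g \<Longrightarrow> d \<le> dist x y"
    using separate_compact_closed[OF comp(1) compact_imp_closed[OF comp(2)] disj] by blast
  obtain N where N: "\<And>n w x y. N \<le> n \<Longrightarrow> w \<in> words S n \<Longrightarrow> x \<in> K \<union> V0 \<Longrightarrow> y \<in> K \<union> V0
    \<Longrightarrow> dist (word_map w x) (word_map w y) < d" using obtain_small_cells[OF d(1)] by metis
  have zero: "energy_form S (product_conductance \<tau>) n (rep f) (rep g) = 0" if n: "N \<le> n" for n
  proof -
    have "(rep f x - rep f y) * (rep g x - rep g y) = 0"
      if w: "w \<in> words S n" and xy: "x \<in> Vword w" "y \<in> Vword w" for w x y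
    proof -
      have K: "a \<in> K" if "a \<in> Vword w" for a
        using Vword_subset_V[OF w] V_subset_K that by blast
      have "rep f a = 0 \<or> rep g b = 0" if a: "a \<in> Vword w" and b: "b \<in> Vword w" for a b
      proof (rule ccontr)
        assume "\<not> (rep f a = 0 \<or> rep g b = 0)"
        hence "d \<le> dist a b" using supp[OF f K[OF a]] supp[OF g K[OF b]] d(2) by blast
        moreover have "dist a b < d" using a b N[OF n w] by (auto simp: Vword_def)
        ultimately show False by linarith
      qed
      from this[OF xy(1) xy(1)] this[OF xy(1) xy(2)] this[OF xy(2) xy(1)] this[OF xy(2) xy(2)]
      show ?thesis by auto
    qed
    hence "(\<Sum>x\<in>Vword w. \<Sum>y\<in>Vword w. product_conductance \<tau> w x y *
        ((rep f x - rep f y) * (rep g x - rep g y))) = 0" if "w \<in> words S n" for w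
      using that by (intro sum.neutral ballI) (simp only: mult_zero_right)
    thus ?thesis unfolding energy_form_def by (intro sum.neutral ballI) (simp only: mult_zero_right)
  qed
  have "(\<lambda>n. energy_form S (product_conductance \<tau>) n (rep f) (rep g)) \<longlonglongrightarrow> 0"
    using zero by (intro tendsto_eventually) (auto simp: eventually_sequentially)
  thus "form f g = 0" by (simp add: form_def limit_form_def limI)
qed

lemma form_obtained: "obtained_from_energies K S (product_conductance \<tau>) \<nu> form_domain form"
  unfolding obtained_from_energies_def
  using positive_product_conductance compatible form_finite_energy
  by (auto simp: form_domain_def limit_energy_def)

lemma form_self_similar: "self_similar_energy K S form_domain form"
  unfolding self_similar_energy_def
proof (intro exI[of _ \<tau>] conjI ballI impI)
  fix f assume f: "f \<in> form_domain" and cont: "continuous_on K f"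
  have "f x = rep f x" if "x \<in> K" for x
    using continuous_AE_eq[OF cont finite_energyD(1)[OF rep_FE[OF f]] rep_AE[OF f] that] .
  hence FE: "f \<in> FE" using finite_energy_cong[of f "rep f"] rep_FE[OF f] by blast
  note sim = finite_energy_self_similar[OF FE]
  show "f \<circ> cell_map s \<in> form_domain" if "s \<in> S" for s using sim(1)[OF that] by (rule finite_energy_in_domain)
  show "form f f = (\<Sum>s\<in>S. inverse (\<tau> s) * form (f \<circ> cell_map s) (f \<circ> cell_map s))"
    using sim form_finite_energy FE by simp
qed (auto simp: weight)

end

context harmonic_structure
begin

lemma dirichlet_form_exists:
  "\<exists>\<nu> c D E. radon_measure_on K \<nu> \<and> full_support \<nu> \<and>
     dirichlet_form \<nu> D E \<and> regular_form \<nu> D E \<and> local_form \<nu> D E \<and>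
     obtained_from_energies K S c \<nu> D E \<and> self_similar_energy K S D E"
proof -
  have "countable Vstar" using finite_V by (auto simp: Vstar_def countable_finite)
  moreover have "Vstar \<noteq> {}" using p1_in_V by (auto simp: Vstar_def)
  ultimately obtain \<nu> where \<nu>: "radon_measure_on K \<nu>" "full_support \<nu>"
    using full_support_measure_exists[OF compact_K, of Vstar] Vstar_subset_K K_subset_closure_Vstar
    by blast
  interpret harmonic_dirichlet S K \<tau> \<nu> by unfold_locales (rule \<nu>)+
  show ?thesis
    using \<nu> form_dirichlet form_regular form_local form_obtained form_self_similar by blast
qed

end

section \<open>The network of the sickle\<close>

lemma cell_map_corner:
  "cell_map s p1 = q (fst s) (snd s)" "cell_map s p2 = q (Suc (fst s)) (snd s)"
  "cell_map s p3 = q (fst s) (Suc (snd s))"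
  by (simp_all add: coords_eq_iff)

lemma q_eq_iff: "q i j = q i' j' \<longleftrightarrow> i = i' \<and> j = j'"
  by (auto simp: coords_eq_iff)

lemma q_corner: "q 0 0 = p1" "q 7 0 = p2" "q 0 7 = p3"
  by (simp_all add: coords_eq_iff)

lemma cell_vertices_triangle: "cell_map s ` V0 \<subseteq> cell_triangle s"
  unfolding cell_triangle_def by (intro image_mono hull_subset)

lemma tri_energy_third:
  assumes "a \<in> V0" "b \<in> V0" "a \<noteq> b"
  obtains c where "V0 = {a, b, c}" "c \<noteq> a" "c \<noteq> b"
    "\<And>f. tri_energy f = (f a - f b)\<^sup>2 + (f b - f c)\<^sup>2 + (f c - f a)\<^sup>2"
proof -
  consider "a = p1" "b = p2" | "a = p2" "b = p1" | "a = p2" "b = p3" | "a = p3" "b = p2"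
    | "a = p1" "b = p3" | "a = p3" "b = p1" using assms by (auto simp: V0_def)
  hence "\<exists>c. V0 = {a, b, c} \<and> c \<noteq> a \<and> c \<noteq> b \<and>
      (\<forall>f. tri_energy f = (f a - f b)\<^sup>2 + (f b - f c)\<^sup>2 + (f c - f a)\<^sup>2)"
  proof cases
    case 1 thus ?thesis
      by (intro exI[of _ p3]) (auto simp: V0_def tri_energy_def power2_eq_square algebra_simps)
  next
    case 2 thus ?thesis
      by (intro exI[of _ p3]) (auto simp: V0_def tri_energy_def power2_eq_square algebra_simps)
  next
    case 3 thus ?thesis
      by (intro exI[of _ p1]) (auto simp: V0_def tri_energy_def power2_eq_square algebra_simps)
  next
    case 4 thus ?thesis
      by (intro exI[of _ p1]) (auto simp: V0_def tri_energy_def power2_eq_square algebra_simps)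
  next
    case 5 thus ?thesis
      by (intro exI[of _ p2]) (auto simp: V0_def tri_energy_def power2_eq_square algebra_simps)
  next
    case 6 thus ?thesis
      by (intro exI[of _ p2]) (auto simp: V0_def tri_energy_def power2_eq_square algebra_simps)
  qed
  thus ?thesis using that by blast
qed

lemma tri_energy_edge: 
  assumes "a \<in> V0" "b \<in> V0"
  shows "(f a - f b)\<^sup>2 \<le> tri_energy f"
  using assms by (auto simp: V0_def tri_energy_def power2_commute)

text \<open>A cell with prescribed values at two corners: the free third corner is optimal halfway.\<close>

lemma tri_energy_ge:
  assumes "a \<in> V0" "b \<in> V0" "a \<noteq> b"
  shows "3 / 2 * (f a - f b)\<^sup>2 \<le> tri_energy f"
proof -
  obtain c where c: "tri_energy f = (f a - f b)\<^sup>2 + (f b - f c)\<^sup>2 + (f c - f a)\<^sup>2"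
    using tri_energy_third[OF assms] by metis
  show ?thesis using sq_add_le[of "f b - f c" "f c - f a"] unfolding c
    by (simp add: power2_commute)
qed

lemma tri_energy_halfway:
  assumes "a \<in> V0" "b \<in> V0" "a \<noteq> b" "f b = f a + h"
    and "\<And>c. c \<in> V0 \<Longrightarrow> c \<noteq> a \<Longrightarrow> c \<noteq> b \<Longrightarrow> f c = f a + h / 2"
  shows "tri_energy f = 3 / 2 * h\<^sup>2"
proof -
  obtain c where c: "V0 = {a, b, c}" "c \<noteq> a" "c \<noteq> b"
    "tri_energy f = (f a - f b)\<^sup>2 + (f b - f c)\<^sup>2 + (f c - f a)\<^sup>2"
    using tri_energy_third[OF assms(1-3)] by metis
  have "c \<in> V0" using c(1) by blast
  hence "f c = f a + h / 2" using c(2,3) by (rule assms(5))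
  thus ?thesis unfolding c(4) assms(4) by (simp add: power2_eq_square field_simps)
qed

text \<open>\<open>s k\<close> leads from \<open>y (k - 1)\<close> to \<open>y k\<close>, for \<open>1 \<le> k \<le> n\<close>.\<close>

definition cell_chain :: "nat \<Rightarrow> (nat \<Rightarrow> cell) \<Rightarrow> (nat \<Rightarrow> point) \<Rightarrow> bool" where
  "cell_chain n s y \<longleftrightarrow> (\<forall>k\<in>{1..n}. y (k - 1) \<noteq> y k \<and>
     y (k - 1) \<in> cell_map (s k) ` V0 \<and> y k \<in> cell_map (s k) ` V0)"

lemma cell_chainE:
  assumes "cell_chain n s y" "k \<in> {1..n}"
  obtains a b where "a \<in> V0" "b \<in> V0" "a \<noteq> b"
    "y (k - 1) = cell_map (s k) a" "y k = cell_map (s k) b"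
proof -
  have y: "y (k - 1) \<noteq> y k" "y (k - 1) \<in> cell_map (s k) ` V0" "y k \<in> cell_map (s k) ` V0"
    using assms unfolding cell_chain_def by blast+
  obtain a where a: "a \<in> V0" "y (k - 1) = cell_map (s k) a" using y(2) by (rule imageE)
  obtain b where b: "b \<in> V0" "y k = cell_map (s k) b" using y(3) by (rule imageE)
  have "a \<noteq> b" using y(1) a(2) b(2) by metis
  thus ?thesis using that a b by blast
qed

text \<open>Resistances in series: by the Cauchy-Schwarz inequality, the energy of a chain is at least
  \<open>1 / n\<close> times that of a single cell with the same total drop.\<close>

lemma cell_chain_energy_ge:
  assumes "cell_chain n s y"
  shows "3 / 2 * (v (y 0) - v (y n))\<^sup>2 \<le> real n * (\<Sum>k=1..n. tri_energy (v \<circ> cell_map (s k)))"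
proof -
  have "v (y 0) - v (y n) = (\<Sum>k=1..n. v (y (k - 1)) - v (y k))"
    by (induction n) auto
  hence "(v (y 0) - v (y n))\<^sup>2 \<le> real n * (\<Sum>k=1..n. (v (y (k - 1)) - v (y k))\<^sup>2)"
    using sum_squared_le_sum_of_squares[of "\<lambda>k. v (y (k - 1)) - v (y k)" "{1..n}"]
    by (simp add: mult.commute)
  hence "3 / 2 * (v (y 0) - v (y n))\<^sup>2
      \<le> real n * (3 / 2 * (\<Sum>k=1..n. (v (y (k - 1)) - v (y k))\<^sup>2))" by linarith
  also have "3 / 2 * (\<Sum>k=1..n. (v (y (k - 1)) - v (y k))\<^sup>2)
      \<le> (\<Sum>k=1..n. tri_energy (v \<circ> cell_map (s k)))"
    unfolding sum_distrib_left
  proof (rule sum_mono)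
    fix k assume k: "k \<in> {1..n}"
    obtain a b where "a \<in> V0" "b \<in> V0" "a \<noteq> b" "y (k - 1) = cell_map (s k) a" "y k = cell_map (s k) b"
      using cell_chainE[OF assms k] .
    thus "3 / 2 * (v (y (k - 1)) - v (y k))\<^sup>2 \<le> tri_energy (v \<circ> cell_map (s k))"
      using tri_energy_ge[of a b "v \<circ> cell_map (s k)"] by simp
  qed
  finally show ?thesis by (simp add: mult_left_mono)
qed

text \<open>Equality holds for equal steps with all free corners halfway.\<close>

lemma cell_chain_energy_affine:
  assumes ch: "cell_chain n s y"
    and v: "\<And>k. k \<le> n \<Longrightarrow> v (y k) = \<alpha> + h * real k"
    and half: "\<And>k x. k \<in> {1..n} \<Longrightarrow> x \<in> cell_map (s k) ` V0 \<Longrightarrow> x \<noteq> y (k - 1) \<Longrightarrow> x \<noteq> y k \<Longrightarrow>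
      v x = \<alpha> + h * (real k - 1 / 2)"
  shows "(\<Sum>k=1..n. tri_energy (v \<circ> cell_map (s k))) = real n * (3 / 2 * h\<^sup>2)"
proof -
  have "tri_energy (v \<circ> cell_map (s k)) = 3 / 2 * h\<^sup>2" if k: "k \<in> {1..n}" for k
  proof -
    obtain a b where ab: "a \<in> V0" "b \<in> V0" "a \<noteq> b" "y (k - 1) = cell_map (s k) a" "y k = cell_map (s k) b"
      using cell_chainE[OF ch k] .
    have a: "v (cell_map (s k) a) = \<alpha> + h * (real k - 1)" and b: "v (cell_map (s k) b) = \<alpha> + h * real k"
      using v[of "k - 1"] v[of k] k ab by (auto simp: of_nat_diff)
    show ?thesis
    proof (rule tri_energy_halfway[OF ab(1-3)])
      show "(v \<circ> cell_map (s k)) b = (v \<circ> cell_map (s k)) a + h" using a b by (simp add: algebra_simps)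
      fix c assume "c \<in> V0" "c \<noteq> a" "c \<noteq> b"
      hence "v (cell_map (s k) c) = \<alpha> + h * (real k - 1 / 2)" using half[OF k] ab by simp
      thus "(v \<circ> cell_map (s k)) c = (v \<circ> cell_map (s k)) a + h / 2" using a by (simp add: algebra_simps)
    qed
  qed
  hence "(\<Sum>k=1..n. tri_energy (v \<circ> cell_map (s k))) = (\<Sum>k=1..n. 3 / 2 * h\<^sup>2)"
    by (intro sum.cong refl)
  thus ?thesis by simp
qed

lemma cell_chain_potential_bound:
  assumes ch: "cell_chain n s y" and L: "\<And>k. k \<in> {1..n} \<Longrightarrow> tri_energy (v \<circ> cell_map (s k)) \<le> L\<^sup>2" "0 \<le> L"
    and k: "k \<le> n"
  shows "\<bar>v (y k) - v (y 0)\<bar> \<le> real k * L"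
  using k
proof (induction k)
  case (Suc k)
  have k: "Suc k \<in> {1..n}" using Suc.prems by simp
  obtain a b where ab: "a \<in> V0" "b \<in> V0" "y k = cell_map (s (Suc k)) a" "y (Suc k) = cell_map (s (Suc k)) b"
    using cell_chainE[OF ch k] unfolding diff_Suc_1 by metis
  have "(v (y k) - v (y (Suc k)))\<^sup>2 \<le> L\<^sup>2"
    using tri_energy_edge[OF ab(1,2), of "v \<circ> cell_map (s (Suc k))"] L(1)[OF k] ab by simp
  hence "\<bar>v (y k) - v (y (Suc k))\<bar> \<le> L" using L(2) by (metis abs_le_square_iff abs_of_nonneg)
  thus ?case using Suc by (simp add: distrib_right)
qed simp

text \<open>The network left after replacing the two chains by single edges of conductance \<open>75 / 11\<close>, where
  \<open>u1, u2, u3\<close> are the values at the corners and \<open>a, b, d, e, f\<close> those at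
  \<open>q 0 5, q 2 5, q 1 5, q 0 6, q 1 6\<close>. The values subtracted in \<open>A, B, D, E, F\<close> are the equilibrium
  potential. It is orthogonal to everything that vanishes at the corners, so the energy splits into
  the equilibrium energy, which is that of the unit triangle, and the energy of the difference.\<close>

lemma top_network:
  fixes u1 u2 u3 a b d e f :: real
  defines "A \<equiv> a - (53 * u1 + 11 * u2 + 11 * u3) / 75" and "B \<equiv> b - (11 * u1 + 53 * u2 + 11 * u3) / 75"
    and "D \<equiv> d - (28 * u1 + 28 * u2 + 19 * u3) / 75" and "E \<equiv> e - (10 * u1 + 6 * u2 + 9 * u3) / 25"
    and "F \<equiv> f - (6 * u1 + 10 * u2 + 9 * u3) / 25"
  shows "75 / 11 * (u1 - a)\<^sup>2 + 75 / 11 * (u2 - b)\<^sup>2 + 25 / 8 * ((a - d)\<^sup>2 + (d - e)\<^sup>2 + (e - a)\<^sup>2)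
      + 25 / 8 * ((d - b)\<^sup>2 + (b - f)\<^sup>2 + (f - d)\<^sup>2) + 25 / 16 * ((e - f)\<^sup>2 + (f - u3)\<^sup>2 + (u3 - e)\<^sup>2)
    = (u1 - u2)\<^sup>2 + (u2 - u3)\<^sup>2 + (u3 - u1)\<^sup>2
      + (75 / 11 * A\<^sup>2 + 75 / 11 * B\<^sup>2 + 25 / 8 * ((A - D)\<^sup>2 + (D - E)\<^sup>2 + (E - A)\<^sup>2)
      + 25 / 8 * ((D - B)\<^sup>2 + (B - F)\<^sup>2 + (F - D)\<^sup>2) + 25 / 16 * ((E - F)\<^sup>2 + F\<^sup>2 + E\<^sup>2))"
proof -
  \<comment> \<open>Clear all denominators.\<close>
  define v1 v2 v3 where "v1 = u1 / 75" and "v2 = u2 / 75" and "v3 = u3 / 75"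
  have u: "u1 = 75 * v1" "u2 = 75 * v2" "u3 = 75 * v3" by (simp_all add: v1_def v2_def v3_def)
  have v: "a = A + (53 * v1 + 11 * v2 + 11 * v3)" "b = B + (11 * v1 + 53 * v2 + 11 * v3)"
    "d = D + (28 * v1 + 28 * v2 + 19 * v3)" "e = E + (30 * v1 + 18 * v2 + 27 * v3)"
    "f = F + (18 * v1 + 30 * v2 + 27 * v3)"
    by (simp_all add: A_def B_def D_def E_def F_def u)
  have "1200 * (u1 - a)\<^sup>2 + 1200 * (u2 - b)\<^sup>2 + 550 * ((a - d)\<^sup>2 + (d - e)\<^sup>2 + (e - a)\<^sup>2)
      + 550 * ((d - b)\<^sup>2 + (b - f)\<^sup>2 + (f - d)\<^sup>2) + 275 * ((e - f)\<^sup>2 + (f - u3)\<^sup>2 + (u3 - e)\<^sup>2)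
    = 176 * ((u1 - u2)\<^sup>2 + (u2 - u3)\<^sup>2 + (u3 - u1)\<^sup>2)
      + (1200 * A\<^sup>2 + 1200 * B\<^sup>2 + 550 * ((A - D)\<^sup>2 + (D - E)\<^sup>2 + (E - A)\<^sup>2)
      + 550 * ((D - B)\<^sup>2 + (B - F)\<^sup>2 + (F - D)\<^sup>2) + 275 * ((E - F)\<^sup>2 + F\<^sup>2 + E\<^sup>2))"
    using u v by algebra
  moreover have "75 / 11 * x1 + 75 / 11 * x2 + 25 / 8 * x3 + 25 / 8 * x4 + 25 / 16 * x5 =
      y + (75 / 11 * z1 + 75 / 11 * z2 + 25 / 8 * z3 + 25 / 8 * z4 + 25 / 16 * z5)"
    if "1200 * x1 + 1200 * x2 + 550 * x3 + 550 * x4 + 275 * x5 =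
      176 * y + (1200 * z1 + 1200 * z2 + 550 * z3 + 550 * z4 + 275 * z5)"
    for x1 x2 x3 x4 x5 y z1 z2 z3 z4 z5 :: real using that by linarith
  ultimately show ?thesis by blast
qed

text \<open>Replace each triangle by the equivalent star, and measure resistances by the arm of the unit
  triangle. With weights \<open>8 / 25, 8 / 25, 16 / 25\<close> the three centres of the top cells form a triangle
  with edges \<open>16 / 25, 24 / 25, 24 / 25\<close>, that is a star with arms \<open>6 / 25, 6 / 25, 9 / 25\<close>. Adding the
  outer arms gives \<open>14 / 25, 14 / 25, 1\<close>, and \<open>11 / 25\<close> is left for each chain. A chain cell is passed
  along two of its arms, so the weights are \<open>11 / 25\<close> divided by \<open>2 * 5\<close> and by \<open>2 * 9\<close>.\<close>

definition sickle_weight :: "cell \<Rightarrow> real" where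
  "sickle_weight s = (if s \<in> left_cells then 11 / 250 else if s = (0, 6) then 16 / 25
     else if s \<in> top_cells then 8 / 25 else 11 / 450)"

lemma sickle_weight_bounds: "0 < sickle_weight s" "sickle_weight s < 1"
  by (auto simp: sickle_weight_def)

lemma left_chain: "cell_chain 5 (\<lambda>k. (0, k - 1)) (q 0)"
  unfolding cell_chain_def
proof
  fix k :: nat assume "k \<in> {1..5}"
  then obtain j where k: "k = Suc j" by (cases k) auto
  show "q 0 (k - 1) \<noteq> q 0 k \<and> q 0 (k - 1) \<in> cell_map (0, k - 1) ` V0 \<and> q 0 k \<in> cell_map (0, k - 1) ` V0"
    unfolding k by (auto simp: V0_def cell_map_corner q_eq_iff)
qed

lemma left_cells_image: "left_cells = (\<lambda>k. (0, k - 1)) ` {1..5}"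
  by (auto simp: left_cells_def image_iff Bex_def) presburger+

locale sickle_chain =
  fixes r :: "nat \<Rightarrow> cell" and z :: "nat \<Rightarrow> point"
  assumes chain: "right_chain r z"
begin

lemma right_cell_chain: "cell_chain 9 r z"
  using chain by (simp add: right_chain_def cell_chain_def)

lemma right_in_triangle: "k \<in> {1..9} \<Longrightarrow> fst (r k) + snd (r k) \<le> 6"
  and z0: "z 0 = q 2 5" and z9: "z 9 = q 7 0"
  using chain by (auto simp: right_chain_def)

lemma z_step: "k \<in> {1..9} \<Longrightarrow> z (k - 1) \<noteq> z k"
  and z_cell: "k \<in> {1..9} \<Longrightarrow> z (k - 1) \<in> cell_triangle (r k)" "k \<in> {1..9} \<Longrightarrow> z k \<in> cell_triangle (r k)"
proof -
  assume k: "k \<in> {1..9}"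
  have "z (k - 1) \<noteq> z k \<and> z (k - 1) \<in> cell_map (r k) ` V0 \<and> z k \<in> cell_map (r k) ` V0"
    using right_cell_chain k unfolding cell_chain_def by blast
  thus "z (k - 1) \<noteq> z k" "z (k - 1) \<in> cell_triangle (r k)" "z k \<in> cell_triangle (r k)"
    using subsetD[OF cell_vertices_triangle] by blast+
qed

lemma right_cells_meet:
  assumes "k \<in> {1..9}" "l \<in> {1..9}" "k < l" "x \<in> cell_triangle (r k)" "x \<in> cell_triangle (r l)"
  shows "l = k + 1 \<and> x = z k"
proof (cases "k + 1 < l")
  case True
  hence "cell_triangle (r k) \<inter> cell_triangle (r l) = {}"
    using chain assms(1,2) unfolding right_chain_def by blast
  thus ?thesis using assms by blast
next
  case False
  hence l: "l = k + 1" using assms(3) by simp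
  hence "k \<in> {1..<9}" using assms by auto
  hence "cell_triangle (r k) \<inter> cell_triangle (r (k + 1)) = {z k}"
    using chain unfolding right_chain_def by blast
  thus ?thesis using assms l by blast
qed

lemma right_meets_rest:
  assumes "k \<in> {1..9}" "s \<in> left_cells \<union> top_cells" "x \<in> cell_triangle (r k)" "x \<in> cell_triangle s"
  shows "x = q 2 5"
proof -
  have meet: "(\<Union>k\<in>{1..9}. cell_triangle (r k)) \<inter> (\<Union>s\<in>left_cells \<union> top_cells. cell_triangle s) = {z 0}"
    using chain unfolding right_chain_def by (elim conjE) assumption
  have "x \<in> (\<Union>k\<in>{1..9}. cell_triangle (r k))" using assms(1,3) by (rule UN_I)
  moreover have "x \<in> (\<Union>s\<in>left_cells \<union> top_cells. cell_triangle s)" using assms(2,4) by (rule UN_I)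
  ultimately have "x \<in> {z 0}" unfolding meet[symmetric] by (rule IntI)
  thus ?thesis using z0 by simp
qed

lemma two_vertices: "cell_map s p1 \<in> cell_triangle s" "cell_map s p2 \<in> cell_triangle s"
  "cell_map s p1 \<noteq> cell_map s p2"
  using cell_vertices_triangle[of s] by (auto simp: V0_def)

lemma inj_right: "inj_on r {1..9}"
proof (rule linorder_inj_onI)
  fix k l :: nat assume kl: "k < l" "k \<in> {1..9}" "l \<in> {1..9}"
  show "r k \<noteq> r l"
  proof
    assume "r k = r l"
    hence "cell_map (r k) p1 = z k" "cell_map (r k) p2 = z k"
      using right_cells_meet[OF kl(2,3,1)] two_vertices by metis+
    thus False using two_vertices(3) by metis
  qed
qed auto

lemma right_notin_rest:
  assumes "k \<in> {1..9}"
  shows "r k \<notin> left_cells" "r k \<notin> top_cells"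
proof -
  have "r k \<notin> left_cells \<union> top_cells"
    using right_meets_rest[OF assms, of "r k"] two_vertices[of "r k"] by metis
  thus "r k \<notin> left_cells" "r k \<notin> top_cells" by auto
qed

text \<open>The chain does not return: a connecting point lies in the two cells it connects only.\<close>

lemma z_in_cell:
  assumes "j \<le> 9" "k \<in> {1..9}" "z j \<in> cell_triangle (r k)"
  shows "j = k - 1 \<or> j = k"
proof (rule ccontr)
  assume "\<not> ?thesis"
  hence "j + 1 < k \<or> k < j" using assms(2) by auto
  thus False
  proof
    assume "j + 1 < k"
    moreover have "j + 1 \<in> {1..9}" using \<open>j + 1 < k\<close> assms(2) by auto
    ultimately show False
      using right_cells_meet[of "j + 1" k "z j"] z_cell(1)[of "j + 1"] z_step[of "j + 1"] assms by simp
  next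
    assume "k < j"
    moreover have "j \<in> {1..9}" using \<open>k < j\<close> assms(1,2) by auto
    ultimately show False
      using right_cells_meet[of k j "z j"] z_cell(2)[of j] z_step[of j] assms by auto
  qed
qed

lemma inj_z: "inj_on z {..9}"
proof (rule linorder_inj_onI)
  fix i j :: nat assume ij: "i < j" "i \<in> {..9}" "j \<in> {..9}"
  have j: "j \<in> {1..9}" using ij by auto
  show "z i \<noteq> z j"
  proof
    assume "z i = z j"
    moreover have "i = j - 1" using z_in_cell[of i j] z_cell(2)[OF j] calculation ij j by auto
    ultimately show False using z_step[OF j] by simp
  qed
qed auto

text \<open>The position of a vertex along the right chain: \<open>z j\<close> is at \<open>j\<close>, the free corner of the \<open>k\<close>-th cell
  halfway between \<open>k - 1\<close> and \<open>k\<close>. It is well defined because a free corner lies in no other right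
  cell.\<close>

lemma position_exists:
  "\<exists>pos. (\<forall>j\<le>9. pos (z j) = real j) \<and>
     (\<forall>k\<in>{1..9}. \<forall>x\<in>cell_map (r k) ` V0. x \<noteq> z (k - 1) \<longrightarrow> x \<noteq> z k \<longrightarrow> pos x = real k - 1 / 2)"
proof -
  define pos where "pos x = (if x \<in> z ` {..9} then real (inv_into {..9} z x)
    else real (SOME k. k \<in> {1..9} \<and> x \<in> cell_triangle (r k)) - 1 / 2)" for x
  have "pos (z j) = real j" if "j \<le> 9" for j
    using that inj_z by (simp add: pos_def)
  moreover have "pos x = real k - 1 / 2"
    if k: "k \<in> {1..9}" and x: "x \<in> cell_map (r k) ` V0" "x \<noteq> z (k - 1)" "x \<noteq> z k" for k x
  proof -
    have xk: "x \<in> cell_triangle (r k)" using x(1) cell_vertices_triangle by blast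
    have nz: "x \<notin> z ` {..9}"
      using z_in_cell[OF _ k] xk x(2,3) by auto
    have "l = k" if "l \<in> {1..9} \<and> x \<in> cell_triangle (r l)" for l
    proof (rule ccontr)
      assume "l \<noteq> k"
      hence "x = z l \<or> x = z k" using right_cells_meet[of l k x] right_cells_meet[of k l x] that k xk
        by (cases "l < k") auto
      thus False using nz that k by auto
    qed
    hence "(SOME k. k \<in> {1..9} \<and> x \<in> cell_triangle (r k)) = k"
      using k xk by (intro some_equality) auto
    thus ?thesis using nz by (simp add: pos_def)
  qed
  ultimately show ?thesis by blast
qed

lemma sum_sickle_cells:
  "(\<Sum>s\<in>sickle_cells r. g s) = (\<Sum>k=1..5. g (0, k - 1)) + (g (0, 5) + g (1, 5) + g (0, 6)) + (\<Sum>k=1..9. g (r k) :: real)"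
proof -
  have fin: "finite left_cells" "finite top_cells" by (auto simp: left_cells_def top_cells_def)
  have disj: "left_cells \<inter> top_cells = {}" by (auto simp: left_cells_def top_cells_def)
  have disj': "(left_cells \<union> top_cells) \<inter> r ` {1..9} = {}" using right_notin_rest by blast
  have "(\<Sum>s\<in>sickle_cells r. g s) = sum g left_cells + sum g top_cells + sum g (r ` {1..9})"
    unfolding sickle_cells_def using fin disj disj' by (simp add: sum.union_disjoint)
  also have "sum g left_cells = (\<Sum>k=1..5. g (0, k - 1))"
    unfolding left_cells_image by (subst sum.reindex) (auto simp: inj_on_def)
  also have "sum g top_cells = g (0, 5) + g (1, 5) + g (0, 6)"
    by (simp add: top_cells_def add_ac)
  also have "sum g (r ` {1..9}) = (\<Sum>k=1..9. g (r k))"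
    using inj_right by (simp add: sum.reindex)
  finally show ?thesis .
qed

lemma sickle_weights:
  "k \<in> {1..5} \<Longrightarrow> sickle_weight (0, k - 1) = 11 / 250"
  "sickle_weight (0, 5) = 8 / 25" "sickle_weight (1, 5) = 8 / 25" "sickle_weight (0, 6) = 16 / 25"
  "k \<in> {1..9} \<Longrightarrow> sickle_weight (r k) = 11 / 450"
proof -
  show "sickle_weight (0, k - 1) = 11 / 250" if "k \<in> {1..5}"
    using that unfolding sickle_weight_def left_cells_image by simp
  show "sickle_weight (r k) = 11 / 450" if "k \<in> {1..9}"
    using right_notin_rest[OF that] by (auto simp: sickle_weight_def top_cells_def)
qed (simp_all add: sickle_weight_def left_cells_def top_cells_def)

lemma level_one_sickle:
  "level_one_energy (sickle_cells r) sickle_weight v =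
     250 / 11 * (\<Sum>k=1..5. tri_energy (v \<circ> cell_map (0, k - 1)))
     + 25 / 8 * tri_energy (v \<circ> cell_map (0, 5)) + 25 / 8 * tri_energy (v \<circ> cell_map (1, 5))
     + 25 / 16 * tri_energy (v \<circ> cell_map (0, 6))
     + 450 / 11 * (\<Sum>k=1..9. tri_energy (v \<circ> cell_map (r k)))"
proof -
  have inv: "inverse (11 / 250) = (250 / 11 :: real)" "inverse (11 / 450) = (450 / 11 :: real)"
    "inverse (8 / 25) = (25 / 8 :: real)" "inverse (16 / 25) = (25 / 16 :: real)" by simp_all
  have "(\<Sum>k=1..5. inverse (sickle_weight (0, k - 1)) * tri_energy (v \<circ> cell_map (0, k - 1))) =
      250 / 11 * (\<Sum>k=1..5. tri_energy (v \<circ> cell_map (0, k - 1)))"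
    unfolding sum_distrib_left by (intro sum.cong refl) (simp only: sickle_weights inv)
  moreover have "(\<Sum>k=1..9. inverse (sickle_weight (r k)) * tri_energy (v \<circ> cell_map (r k))) =
      450 / 11 * (\<Sum>k=1..9. tri_energy (v \<circ> cell_map (r k)))"
    unfolding sum_distrib_left by (intro sum.cong refl) (simp only: sickle_weights inv)
  ultimately show ?thesis
    unfolding level_one_energy_def sum_sickle_cells by (simp only: sickle_weights inv add.assoc)
qed

lemma top_vertices:
  "cell_map (0, 5) p1 = q 0 5" "cell_map (0, 5) p2 = q 1 5" "cell_map (0, 5) p3 = q 0 6"
  "cell_map (1, 5) p1 = q 1 5" "cell_map (1, 5) p2 = q 2 5" "cell_map (1, 5) p3 = q 1 6"
  "cell_map (0, 6) p1 = q 0 6" "cell_map (0, 6) p2 = q 1 6" "cell_map (0, 6) p3 = p3"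
  by (simp_all add: coords_eq_iff)

lemma top_energies:
  "tri_energy (v \<circ> cell_map (0, 5)) =
     (v (q 0 5) - v (q 1 5))\<^sup>2 + (v (q 1 5) - v (q 0 6))\<^sup>2 + (v (q 0 6) - v (q 0 5))\<^sup>2"
  "tri_energy (v \<circ> cell_map (1, 5)) =
     (v (q 1 5) - v (q 2 5))\<^sup>2 + (v (q 2 5) - v (q 1 6))\<^sup>2 + (v (q 1 6) - v (q 1 5))\<^sup>2"
  "tri_energy (v \<circ> cell_map (0, 6)) =
     (v (q 0 6) - v (q 1 6))\<^sup>2 + (v (q 1 6) - v p3)\<^sup>2 + (v p3 - v (q 0 6))\<^sup>2"
  by (simp_all only: tri_energy_def comp_apply top_vertices)

lemma sickle_trace_le: "tri_energy v \<le> level_one_energy (sickle_cells r) sickle_weight v"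
proof -
  have "3 / 2 * (v p1 - v (q 0 5))\<^sup>2 \<le> 5 * (\<Sum>k=1..5. tri_energy (v \<circ> cell_map (0, k - 1)))"
    using cell_chain_energy_ge[OF left_chain, of v] by (simp add: q_corner)
  moreover have "3 / 2 * (v p2 - v (q 2 5))\<^sup>2 \<le> 9 * (\<Sum>k=1..9. tri_energy (v \<circ> cell_map (r k)))"
    using cell_chain_energy_ge[OF right_cell_chain, of v]
    by (simp add: z0 z9 q_corner power2_commute)
  moreover have "tri_energy v \<le> 75 / 11 * (v p1 - v (q 0 5))\<^sup>2 + 75 / 11 * (v p2 - v (q 2 5))\<^sup>2
      + 25 / 8 * tri_energy (v \<circ> cell_map (0, 5)) + 25 / 8 * tri_energy (v \<circ> cell_map (1, 5))
      + 25 / 16 * tri_energy (v \<circ> cell_map (0, 6))"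
    unfolding top_energies tri_energy_def[of v] top_network by simp
  ultimately show ?thesis unfolding level_one_sickle by linarith
qed

lemma not_right:
  assumes "s \<in> left_cells \<union> top_cells" "x \<in> cell_map s ` V0" "x \<noteq> q 2 5"
  shows "x \<notin> (\<Union>k\<in>{1..9}. cell_map (r k) ` V0)"
  using right_meets_rest assms cell_vertices_triangle by blast

text \<open>The equilibrium potential: affine along the two chains, and at the remaining vertices the values
  that make \<open>A, B, D, E, F\<close> in \<open>top_network\<close> vanish.\<close>

lemma sickle_trace_attained:
  "\<exists>v. (\<forall>x\<in>V0. v x = u x) \<and> level_one_energy (sickle_cells r) sickle_weight v = tri_energy u"
proof -
  define u1 u2 u3 where "u1 = u p1" and "u2 = u p2" and "u3 = u p3"
  define a b d e f where "a = (53 * u1 + 11 * u2 + 11 * u3) / 75"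
    and "b = (11 * u1 + 53 * u2 + 11 * u3) / 75" and "d = (28 * u1 + 28 * u2 + 19 * u3) / 75"
    and "e = (10 * u1 + 6 * u2 + 9 * u3) / 25" and "f = (6 * u1 + 10 * u2 + 9 * u3) / 25"
  obtain pos where pos: "\<And>j. j \<le> 9 \<Longrightarrow> pos (z j) = real j"
    "\<And>k x. k \<in> {1..9} \<Longrightarrow> x \<in> cell_map (r k) ` V0 \<Longrightarrow> x \<noteq> z (k - 1) \<Longrightarrow> x \<noteq> z k \<Longrightarrow>
      pos x = real k - 1 / 2" using position_exists by blast
  define R where "R = (\<Union>k\<in>{1..9}. cell_map (r k) ` V0)"
  \<comment> \<open>In the second line \<open>7 * cx x\<close> is 1 at the free corners of the left cells and 0 on the chain, so
    the former are halfway.\<close>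
  define v where "v x = (if x \<in> R then b + (u2 - b) / 9 * pos x
    else if cy x \<le> 4 / 7 then u1 + (a - u1) / 5 * (7 * cy x + 7 / 2 * cx x)
    else if x = q 0 5 then a else if x = q 1 5 then d else if x = q 0 6 then e
    else if x = q 1 6 then f else u3)" for x
  have zR: "z j \<in> R" if "j \<le> 9" for j
  proof (cases "j = 0")
    case True
    have "z (1 - 1) \<in> cell_map (r 1) ` V0"
      using right_cell_chain unfolding cell_chain_def by (elim ballE[of _ _ 1]) auto
    thus ?thesis unfolding R_def using True by (intro UN_I[of 1]) auto
  next
    case False
    hence "j \<in> {1..9}" using that by auto
    thus ?thesis using right_cell_chain unfolding R_def cell_chain_def by blast
  qed
  have nR: "q i j \<notin> R" if "q i j \<noteq> q 2 5" "s \<in> left_cells \<union> top_cells" "q i j \<in> cell_map s ` V0" for i j s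
    using not_right[OF that(2,3,1)] by (simp add: R_def)
  have left: "v (q 0 j) = u1 + (a - u1) / 5 * real j" if "j \<le> 5" for j
  proof (cases "j = 5")
    case True
    have "q 0 5 \<notin> R" by (rule nR[of _ _ "(0, 5)"]) (auto simp: q_eq_iff top_cells_def V0_def cell_map_corner)
    thus ?thesis using True by (simp add: v_def field_simps)
  next
    case False
    have "(0, j) \<in> left_cells" using False that by (auto simp: left_cells_def)
    hence "q 0 j \<notin> R" by (intro nR[of _ _ "(0, j)"]) (auto simp: q_eq_iff V0_def cell_map_corner)
    thus ?thesis using False that by (simp add: v_def)
  qed
  have left_third: "v (q 1 j) = u1 + (a - u1) / 5 * (real j + 1 / 2)" if "j \<le> 4" for j
  proof -
    have "(0, j) \<in> left_cells" using that by (auto simp: left_cells_def)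
    hence "q 1 j \<notin> R" by (intro nR[of _ _ "(0, j)"]) (auto simp: q_eq_iff V0_def cell_map_corner)
    thus ?thesis using that by (simp add: v_def)
  qed
  have top: "v (q 1 5) = d" "v (q 0 6) = e" "v (q 1 6) = f" "v p3 = u3" "v (q 0 5) = a"
  proof -
    have "q 1 5 \<notin> R" "q 0 6 \<notin> R"
      by (rule nR[of _ _ "(0, 5)"]; auto simp: q_eq_iff top_cells_def V0_def cell_map_corner)+
    moreover have "q 1 6 \<notin> R" "q 0 7 \<notin> R"
      by (rule nR[of _ _ "(0, 6)"]; auto simp: q_eq_iff top_cells_def V0_def cell_map_corner)+
    ultimately show "v (q 1 5) = d" "v (q 0 6) = e" "v (q 1 6) = f" "v p3 = u3"
      by (simp_all add: v_def q_eq_iff flip: q_corner)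
    show "v (q 0 5) = a" using left[of 5] by (simp add: field_simps)
  qed
  have zv: "v (z j) = b + (u2 - b) / 9 * real j" if "j \<le> 9" for j
    using pos(1)[OF that] zR[OF that] by (simp add: v_def)
  have v_corner: "v p1 = u1" "v p2 = u2" "v (q 2 5) = b"
    using left[of 0] zv[of 9] zv[of 0] by (simp_all add: q_corner z0 z9 field_simps)
  have "(\<Sum>k=1..5. tri_energy (v \<circ> cell_map (0, k - 1))) = real 5 * (3 / 2 * ((a - u1) / 5)\<^sup>2)"
  proof (rule cell_chain_energy_affine[OF left_chain])
    show "v (q 0 k) = u1 + (a - u1) / 5 * real k" if "k \<le> 5" for k using left that by simp
    fix k x assume k: "k \<in> {1..5 :: nat}" and x: "x \<in> cell_map (0, k - 1) ` V0" "x \<noteq> q 0 (k - 1)" "x \<noteq> q 0 k"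
    have "x = q 1 (k - 1)" using x k by (auto simp: V0_def cell_map_corner)
    thus "v x = u1 + (a - u1) / 5 * (real k - 1 / 2)" using left_third[of "k - 1"] k
      by (auto simp: of_nat_diff)
  qed
  moreover have "(\<Sum>k=1..9. tri_energy (v \<circ> cell_map (r k))) = real 9 * (3 / 2 * ((u2 - b) / 9)\<^sup>2)"
  proof (rule cell_chain_energy_affine[OF right_cell_chain zv])
    fix k x assume k: "k \<in> {1..9 :: nat}" and x: "x \<in> cell_map (r k) ` V0" "x \<noteq> z (k - 1)" "x \<noteq> z k"
    have "x \<in> R" using k x(1) by (auto simp: R_def)
    thus "v x = b + (u2 - b) / 9 * (real k - 1 / 2)" using pos(2)[OF k x] by (simp add: v_def)
  qed
  ultimately have "level_one_energy (sickle_cells r) sickle_weight v =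
      75 / 11 * (u1 - a)\<^sup>2 + 75 / 11 * (u2 - b)\<^sup>2 + 25 / 8 * ((a - d)\<^sup>2 + (d - e)\<^sup>2 + (e - a)\<^sup>2)
      + 25 / 8 * ((d - b)\<^sup>2 + (b - f)\<^sup>2 + (f - d)\<^sup>2) + 25 / 16 * ((e - f)\<^sup>2 + (f - u3)\<^sup>2 + (u3 - e)\<^sup>2)"
    unfolding level_one_sickle top_energies top v_corner
    by (simp add: power_divide power2_commute)
  also have "\<dots> = tri_energy u"
    unfolding top_network unfolding a_def b_def d_def e_def f_def
    by (simp add: tri_energy_def u1_def u2_def u3_def)
  finally have "level_one_energy (sickle_cells r) sickle_weight v = tri_energy u" .
  moreover have "\<forall>x\<in>V0. v x = u x" using v_corner top by (simp add: V0_def u1_def u2_def u3_def)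
  ultimately show ?thesis by blast
qed

lemma finite_sickle: "finite (sickle_cells r)"
  by (simp add: sickle_cells_def left_cells_def top_cells_def)

text \<open>Across a cell a potential changes by at most the square root of the energy. From \<open>p1\<close>, at most 5
  left cells, 2 top cells and 9 right cells lead to a vertex of a given cell, and one more step leads
  to its first corner.\<close>

lemma sickle_connected:
  "\<exists>B\<ge>0. \<forall>v. \<forall>s\<in>sickle_cells r. \<bar>v (cell_map s p1) - v p1\<bar>
     \<le> B * sqrt (level_one_energy (sickle_cells r) sickle_weight v)"
proof (intro exI[of _ 17] conjI allI ballI)
  fix v s assume s: "s \<in> sickle_cells r"
  let ?E = "level_one_energy (sickle_cells r) sickle_weight v"
  define L where "L = sqrt ?E"
  have nonneg: "0 \<le> tri_energy f" for f by (simp add: tri_energy_def)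
  have E0: "0 \<le> ?E" unfolding level_one_energy_def
    using nonneg sickle_weight_bounds by (intro sum_nonneg mult_nonneg_nonneg) (auto simp: less_imp_le)
  have L: "0 \<le> L" "L\<^sup>2 = ?E" using E0 by (simp_all add: L_def)
  have cell: "tri_energy (v \<circ> cell_map t) \<le> L\<^sup>2" if t: "t \<in> sickle_cells r" for t
  proof -
    have "tri_energy (v \<circ> cell_map t) \<le> inverse (sickle_weight t) * tri_energy (v \<circ> cell_map t)"
    proof -
      have "1 \<le> inverse (sickle_weight t)"
        using sickle_weight_bounds[of t] by (intro one_le_inverse) auto
      from mult_right_mono[OF this nonneg] show ?thesis by simp
    qed
    also have "\<dots> \<le> ?E" unfolding level_one_energy_def
      using t finite_sickle nonneg sickle_weight_bounds
      by (intro member_le_sum[of t]) (auto simp: less_imp_le)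
    finally show ?thesis using L by simp
  qed
  have edge: "\<bar>v (cell_map t x) - v (cell_map t y)\<bar> \<le> L"
    if "t \<in> sickle_cells r" "x \<in> V0" "y \<in> V0" for t x y
  proof -
    have "(v (cell_map t x) - v (cell_map t y))\<^sup>2 \<le> L\<^sup>2"
      using tri_energy_edge[OF that(2,3), of "v \<circ> cell_map t"] cell[OF that(1)] by simp
    thus ?thesis using L(1) by (metis abs_le_square_iff abs_of_nonneg)
  qed
  have left_in: "k \<in> {1..5} \<Longrightarrow> (0, k - 1) \<in> sickle_cells r" for k
    unfolding sickle_cells_def left_cells_image by blast
  have left: "\<bar>v (q 0 j) - v p1\<bar> \<le> 5 * L" if "j \<le> 5" for j
  proof -
    have "\<bar>v (q 0 j) - v p1\<bar> \<le> real j * L"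
      using cell_chain_potential_bound[OF left_chain cell[OF left_in] L(1) that] q_corner(1) by simp
    also have "\<dots> \<le> 5 * L" using that L(1) by (intro mult_right_mono) auto
    finally show ?thesis .
  qed
  have V0: "p1 \<in> V0" "p2 \<in> V0" "p3 \<in> V0" by (auto simp: V0_def)
  have top_in: "(0, 5) \<in> sickle_cells r" "(1, 5) \<in> sickle_cells r" by (auto simp: sickle_cells_def top_cells_def)
  have "\<bar>v (q 1 5) - v (q 0 5)\<bar> \<le> L" "\<bar>v (q 0 6) - v (q 0 5)\<bar> \<le> L" "\<bar>v (q 2 5) - v (q 1 5)\<bar> \<le> L"
    using edge[OF top_in(1) V0(2,1)] edge[OF top_in(1) V0(3,1)] edge[OF top_in(2) V0(2,1)]
    by (simp_all only: top_vertices)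
  hence top: "\<bar>v (q 1 5) - v p1\<bar> \<le> 6 * L" "\<bar>v (q 0 6) - v p1\<bar> \<le> 6 * L" "\<bar>v (z 0) - v p1\<bar> \<le> 7 * L"
    using left[of 5] z0 by auto
  have right_in: "k \<in> {1..9} \<Longrightarrow> r k \<in> sickle_cells r" for k by (auto simp: sickle_cells_def)
  have right: "\<bar>v (z j) - v (z 0)\<bar> \<le> 9 * L" if "j \<le> 9" for j
  proof -
    have "\<bar>v (z j) - v (z 0)\<bar> \<le> real j * L"
      using cell_chain_potential_bound[OF right_cell_chain cell[OF right_in] L(1) that] by simp
    also have "\<dots> \<le> 9 * L" using that L(1) by (intro mult_right_mono) auto
    finally show ?thesis .
  qed
  have "s \<in> left_cells \<or> s \<in> top_cells \<or> s \<in> r ` {1..9}" using s by (auto simp: sickle_cells_def)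
  hence "\<bar>v (cell_map s p1) - v p1\<bar> \<le> 17 * L"
  proof (elim disjE)
    assume "s \<in> left_cells"
    then obtain j where j: "s = (0, j)" "j \<le> 5" by (auto simp: left_cells_def)
    hence "\<bar>v (cell_map s p1) - v p1\<bar> \<le> 5 * L" using left by (simp add: cell_map_corner)
    thus ?thesis using L(1) by linarith
  next
    assume "s \<in> top_cells"
    hence "s = (0, 5) \<or> s = (1, 5) \<or> s = (0, 6)" by (auto simp: top_cells_def)
    hence "\<bar>v (cell_map s p1) - v p1\<bar> \<le> 6 * L" using left[of 5] top L(1)
      by (auto simp: cell_map_corner)
    thus ?thesis using L(1) by linarith
  next
    assume "s \<in> r ` {1..9}"
    then obtain k where k: "s = r k" "k \<in> {1..9}" by blast
    obtain a where a: "a \<in> V0" "z k = cell_map (r k) a"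
      using cell_chainE[OF right_cell_chain k(2)] by metis
    have "\<bar>v (cell_map s p1) - v (z k)\<bar> \<le> L" using edge[OF s V0(1) a(1)] a(2) k(1) by simp
    thus ?thesis using right[of k] top(3) k(2) by auto
  qed
  thus "\<bar>v (cell_map s p1) - v p1\<bar> \<le> 17 * sqrt ?E" by (simp add: L_def)
qed simp

text \<open>The only cell with the vertex \<open>p2\<close>.\<close>

lemma last_right_cell: "r 9 = (6, 0)"
proof -
  have "q 7 0 \<in> cell_map (r 9) ` V0" "fst (r 9) + snd (r 9) \<le> 6"
    using right_cell_chain right_in_triangle[of 9] z9 unfolding cell_chain_def by force+
  thus ?thesis by (cases "r 9") (auto simp: V0_def cell_map_corner q_eq_iff)
qed

lemma sickle_harmonic_structure:
  assumes "is_attractor (sickle_cells r) K"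
  shows "harmonic_structure (sickle_cells r) K sickle_weight"
proof
  show "fst s + snd s \<le> 6" if "s \<in> sickle_cells r" for s
    using that right_in_triangle by (auto simp: sickle_cells_def left_cells_def top_cells_def)
  show "(0, 0) \<in> sickle_cells r" "(0, 6) \<in> sickle_cells r"
    by (auto simp: sickle_cells_def left_cells_def top_cells_def)
  have "r 9 \<in> sickle_cells r" by (auto simp: sickle_cells_def)
  thus "(6, 0) \<in> sickle_cells r" by (simp only: last_right_cell)
qed (use assms finite_sickle sickle_weight_bounds sickle_trace_le sickle_trace_attained
      sickle_connected in auto)

end

theorem theorem6p2:
  fixes r :: "nat \<Rightarrow> cell" and z :: "nat \<Rightarrow> point" and K :: "point set"
  assumes chain: "right_chain r z"
    and K: "is_attractor (sickle_cells r) K"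
  shows "\<exists>(\<nu> :: point measure) c D E.
    radon_measure_on K \<nu> \<and> full_support \<nu> \<and>
    dirichlet_form \<nu> D E \<and> regular_form \<nu> D E \<and> local_form \<nu> D E \<and>
    obtained_from_energies K (sickle_cells r) c \<nu> D E \<and>
    self_similar_energy K (sickle_cells r) D E"
proof -
  interpret sickle_chain r z by unfold_locales (rule chain)
  interpret harmonic_structure "sickle_cells r" K sickle_weight
    using K by (rule sickle_harmonic_structure)
  show ?thesis by (rule dirichlet_form_exists)
qed

end
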